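(* For a given $T>0$, let $x\mapsto f(x,T)$ be a convex and non-increasing function. Then the convex function $x\mapsto Jf(x,T)$ is of class $C^1$ at $x=c(T)$, i.e. $$\frac{\partial}{\partial x}Jf(x,T)\Big|_{x=c(T)}=-1.$$
   Context: Notation: $\mathbb{R}_+=[0,\infty)$, $\bar{\mathbb{R}}_+=[0,\infty]$. The constants are the interest rate $r\ge0$, the volatility $\sigma>0$, the jump intensity $\lambda>0$ and the strike $K>0$; $\nu$ is a probability measure on $\mathbb{R}_+$, the law of a positive random variable, with $\xi:=\int_{\mathbb{R}_+}x\,\nu(dx)<\infty$, and $\mu=r+\lambda-\lambda\xi$. Let $W$ be a Wiener process, $H_t=\exp\{(\mu-\frac12\sigma^2)t+\sigma W_t\}$, $S^0_t=xH_t$, and let $\mathcal{S}_{0,T}$ be the set of stopping times of $S^0$ with values in $[0,T]$. For a test function $f:\mathbb{R}_+\times\bar{\mathbb{R}}_+\to\mathbb{R}_+$ put $$Pf(x,T)=\int_{\mathbb{R}_+}f(xz,T)\,\nu(dz),$$ $$Jf(x,T)=\sup_{\tau\in\mathcal{S}_{0,T}}\mathbb{E}\Big\{\int_0^\tau e^{-(r+\lambda)t}\lambda\,Pf(xH_t,T-t)\,dt+e^{-(r+\lambda)\tau}(K-xH_\tau)^+\Big\}.$$ Here $c(T)=c^{Jf}(T)\in(0,K)$ denotes the boundary point of the continuation region at $T$, i.e. the number for which $\{x\in(0,\infty):Jf(x,T)>(K-x)^+\}=(c(T),\infty)$.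
   Formalization: Convexity and monotonicity in x are required of f(.,T-t) for every t in [0,T], i.e. of all sections entering Jf(.,T), and not only of f(.,T); with the single section alone Jf(.,T) need not be convex. f is also taken jointly Borel. *)

theory Defs
  imports "HOL-Probability.Probability"
begin

text \<open>
  Time horizons live in \<^typ>\<open>ennreal\<close>, so that they range over the closed half line
  including infinity. All rewards are nonnegative, so expectations, time integrals and the
  supremum over stopping times are taken in \<^typ>\<open>ennreal\<close>.
\<close>

definition natural_filtration ::
    "'w measure \<Rightarrow> (real \<Rightarrow> 'w \<Rightarrow> real) \<Rightarrow> ennreal \<Rightarrow> 'w measure" where
  "natural_filtration M X t =
     sigma (space M) {X s -` A \<inter> space M | s A. 0 \<le> s \<and> ennreal s \<le> t \<and> A \<in> sets borel}"

locale wiener_process = prob_space M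
  for M :: "'w measure" and W :: "real \<Rightarrow> 'w \<Rightarrow> real" +
  assumes W_measurable: "\<And>t. 0 \<le> t \<Longrightarrow> W t \<in> borel_measurable M"
    and W_start: "AE \<omega> in M. W 0 \<omega> = 0"
    and W_paths: "\<And>\<omega>. \<omega> \<in> space M \<Longrightarrow> continuous_on {0..} (\<lambda>t. W t \<omega>)"
    and W_normal: "\<And>s t. 0 \<le> s \<Longrightarrow> s < t \<Longrightarrow>
          distributed M lborel (\<lambda>\<omega>. W t \<omega> - W s \<omega>) (\<lambda>x. ennreal (normal_density 0 (sqrt (t - s)) x))"
    and W_indep: "\<And>s t. 0 \<le> s \<Longrightarrow> s < t \<Longrightarrow>
          indep_set (sets (natural_filtration M W (ennreal s)))
            {(\<lambda>\<omega>. W t \<omega> - W s \<omega>) -` A \<inter> space M | A. A \<in> sets borel}"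

definition mean_jump :: "real measure \<Rightarrow> real" where
  "mean_jump \<nu> = (LINT z|\<nu>. z)"

definition drift :: "real \<Rightarrow> real \<Rightarrow> real measure \<Rightarrow> real" where
  "drift r lam \<nu> = r + lam - lam * mean_jump \<nu>"

definition H_proc ::
    "real \<Rightarrow> real \<Rightarrow> real \<Rightarrow> real measure \<Rightarrow> (real \<Rightarrow> 'w \<Rightarrow> real) \<Rightarrow> real \<Rightarrow> 'w \<Rightarrow> real" where
  "H_proc r vol lam \<nu> W t \<omega> = exp ((drift r lam \<nu> - vol\<^sup>2 / 2) * t + vol * W t \<omega>)"

definition stopping_times ::
    "'w measure \<Rightarrow> (real \<Rightarrow> 'w \<Rightarrow> real) \<Rightarrow> ennreal \<Rightarrow> ('w \<Rightarrow> ennreal) set" where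
  "stopping_times M X T =
     {\<tau>. stopping_time (natural_filtration M X) \<tau> \<and> (\<forall>\<omega>\<in>space M. \<tau> \<omega> \<le> T)}"

definition P_op :: "real measure \<Rightarrow> (real \<Rightarrow> ennreal \<Rightarrow> real) \<Rightarrow> real \<Rightarrow> ennreal \<Rightarrow> ennreal" where
  "P_op \<nu> f x T = (\<integral>\<^sup>+ z\<in>{0..}. ennreal (f (x * z) T) \<partial>\<nu>)"

text \<open>
  The discounted put payoff on stopping; on the event that the stopping time is infinite
  (possible only for an infinite horizon) the discount factor is zero.
\<close>

definition stopped_payoff ::
    "real \<Rightarrow> real \<Rightarrow> real \<Rightarrow> (real \<Rightarrow> 'w \<Rightarrow> real) \<Rightarrow> ennreal \<Rightarrow> 'w \<Rightarrow> ennreal" where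
  "stopped_payoff r lam K S t \<omega> =
     (if t = \<infinity> then 0
      else ennreal (exp (- (r + lam) * enn2real t) * max 0 (K - S (enn2real t) \<omega>)))"

definition reward ::
    "'w measure \<Rightarrow> real \<Rightarrow> real \<Rightarrow> real \<Rightarrow> real measure \<Rightarrow> (real \<Rightarrow> 'w \<Rightarrow> real) \<Rightarrow>
      (real \<Rightarrow> ennreal \<Rightarrow> real) \<Rightarrow> ennreal \<Rightarrow> ('w \<Rightarrow> ennreal) \<Rightarrow> ennreal" where
  "reward M r lam K \<nu> S f T \<tau> =
     (\<integral>\<^sup>+ \<omega>. ((\<integral>\<^sup>+ t\<in>{t. 0 \<le> t \<and> ennreal t \<le> \<tau> \<omega>}.
                  (ennreal (exp (- (r + lam) * t) * lam) * P_op \<nu> f (S t \<omega>) (T - ennreal t)) \<partial>lborel)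
             + stopped_payoff r lam K S (\<tau> \<omega>) \<omega>) \<partial>M)"

definition J_op ::
    "'w measure \<Rightarrow> (real \<Rightarrow> 'w \<Rightarrow> real) \<Rightarrow> real \<Rightarrow> real \<Rightarrow> real \<Rightarrow> real \<Rightarrow> real measure \<Rightarrow>
      (real \<Rightarrow> ennreal \<Rightarrow> real) \<Rightarrow> real \<Rightarrow> ennreal \<Rightarrow> ennreal" where
  "J_op M W r vol lam K \<nu> f x T =
     (let S = (\<lambda>t \<omega>. x * H_proc r vol lam \<nu> W t \<omega>)
      in SUP \<tau>\<in>stopping_times M S T. reward M r lam K \<nu> S f T \<tau>)"

end

theory Submission
  imports Defs "HOL-Real_Asymp.Real_Asymp"
begin

text \<open>
  Write \<open>V x\<close> for the value started at \<open>x\<close>. Since \<open>V x = K - x\<close> for \<open>x \<le> c\<close> and \<open>V x > K - x\<close>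
  beyond \<open>c\<close>, only the bound \<open>V (c + h) \<le> K - c - h + o(h)\<close> as \<open>h\<close> tends to \<open>0\<close> from above is
  needed. No regularity of \<open>f\<close> in time is available, so the starting points \<open>c\<close> and \<open>c + h\<close>
  are compared on the same clock, through a waiting time \<open>t = h powr (4/3)\<close>. Waiting until \<open>t\<close>
  costs \<open>O(t) = o(h)\<close>. After \<open>t\<close>, a Cameron--Martin shift of the Brownian path on \<open>{0..t}\<close>
  represents the reward from \<open>c + h\<close> as a reward from \<open>c\<close> weighted by a density \<open>Z\<close>. As \<open>c\<close> is
  in the stopping region, on no event known at time \<open>t\<close> does continuing from \<open>c\<close> gain more than
  \<open>O(t)\<close> over stopping at \<open>t\<close>. A layer cake decomposition of \<open>min Z 2\<close> transfers this to
  the weighted reward. The remaining weight is at most \<open>(Z - 1) ^ 4\<close>, whose mean has order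
  \<open>(h\<^sup>2 / t)\<^sup>2 = h powr (4/3)\<close>, and rewards from \<open>c\<close> are bounded because \<open>V y \<le> K\<close> for \<open>y\<close>
  near \<open>0\<close>.
\<close>

subsection \<open>Natural filtrations and the Cameron--Martin formula\<close>

text \<open>The exponent 4/3 balances the two errors: the waiting cost has order t, the weight tail
  order (h^2/t)^2, and these agree when t^3 = h^4. Any exponent strictly between 1 and 3/2 would do.
  The variance of \<open>Z\<close> has order h^2/t, which is never o(h) when t = o(h); so a second
  moment cannot serve, and the fourth is the first even one that can. Truncation is forced by the
  kind of information available at \<open>c\<close>: continuing is controlled on each event known at
  \<open>t\<close>, always with the same absolute error \<open>rho * K * t\<close>. Over the levels
  of an unbounded weight these errors would add up to infinity; up to level 2 they cost twice that
  error. The level sets are admissible events because \<open>Z\<close> depends on the path through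
  \<open>W t\<close> alone. Changing the drift moves the stopping rule together with the reward, so
  a rule must be a function of the path. This is arranged for rules with finitely many dates only,
  whose events can be lifted one by one; a Fatou argument covers the others.\<close>

lemma space_natural_filtration [simp]: "space (natural_filtration M X t) = space M"
  by (simp add: natural_filtration_def space_measure_of_conv)

lemma measurable_into_natural_filtration:
  assumes "\<phi> \<in> space N \<rightarrow> space M"
    and "\<And>s. 0 \<le> s \<Longrightarrow> ennreal s \<le> t \<Longrightarrow> (\<lambda>\<omega>. X s (\<phi> \<omega>)) \<in> borel_measurable N"
  shows "\<phi> \<in> N \<rightarrow>\<^sub>M natural_filtration M X t"
  unfolding natural_filtration_def
proof (rule measurable_measure_of)
  show "\<phi> \<in> space N \<rightarrow> space M" by fact
  fix y assume "y \<in> {X s -` A \<inter> space M |s A. 0 \<le> s \<and> ennreal s \<le> t \<and> A \<in> sets borel}"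
  then obtain s A where y: "y = X s -` A \<inter> space M" "0 \<le> s" "ennreal s \<le> t" "A \<in> sets borel"
    by blast
  have "\<phi> -` y \<inter> space N = (\<lambda>\<omega>. X s (\<phi> \<omega>)) -` A \<inter> space N"
    using assms(1) y(1) by auto
  also have "\<dots> \<in> sets N"
    using assms(2)[OF y(2,3)] y(4) by (rule measurable_sets)
  finally show "\<phi> -` y \<inter> space N \<in> sets N" .
qed auto

lemma measurable_natural_filtration_component:
  assumes "0 \<le> s" "ennreal s \<le> t"
  shows "X s \<in> borel_measurable (natural_filtration M X t)"
proof (rule measurableI)
  fix A :: "real set" assume "A \<in> sets borel"
  then show "X s -` A \<inter> space (natural_filtration M X t) \<in> sets (natural_filtration M X t)"
    using assms unfolding space_natural_filtration
    unfolding natural_filtration_def by (subst sets_measure_of) auto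
qed simp

lemma sets_natural_filtration_subset:
  assumes "space N = space M"
    and "\<And>s. 0 \<le> s \<Longrightarrow> ennreal s \<le> t \<Longrightarrow> X s \<in> borel_measurable N"
  shows "sets (natural_filtration M X t) \<subseteq> sets N"
proof
  fix A assume A: "A \<in> sets (natural_filtration M X t)"
  have "(\<lambda>\<omega>. \<omega>) \<in> N \<rightarrow>\<^sub>M natural_filtration M X t"
    using assms by (intro measurable_into_natural_filtration) auto
  from measurable_sets[OF this A] have "A \<inter> space N \<in> sets N" by simp
  moreover have "A \<subseteq> space N" using sets.sets_into_space[OF A] assms(1) by simp
  ultimately show "A \<in> sets N" by (simp add: Int_absorb2)
qed

lemma sets_natural_filtration_mono:
  assumes "s \<le> t"
  shows "sets (natural_filtration M X s) \<subseteq> sets (natural_filtration M X t)"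
  using assms order_trans
  by (intro sets_natural_filtration_subset measurable_natural_filtration_component) auto

lemma borel_measurable_natural_filtration_mono:
  assumes "s \<le> t" and Y: "Y \<in> borel_measurable (natural_filtration M X s)"
  shows "Y \<in> borel_measurable (natural_filtration M X t)"
proof -
  have "(\<lambda>\<omega>. \<omega>) \<in> natural_filtration M X t \<rightarrow>\<^sub>M natural_filtration M X s"
    using assms(1) order_trans
    by (intro measurable_into_natural_filtration measurable_natural_filtration_component) auto
  from measurable_compose[OF this Y] show ?thesis .
qed

text \<open>Serves to replace the price filtration by that of \<open>W\<close>: at a fixed time each
  is a Borel function of the other, so the admissible stopping times do not depend on the starting
  point.\<close>

lemma natural_filtration_cong:
  assumes "\<And>s. 0 \<le> s \<Longrightarrow> \<exists>\<phi>\<in>borel_measurable borel. \<forall>\<omega>\<in>space M. X s \<omega> = \<phi> (Y s \<omega>)"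
    and "\<And>s. 0 \<le> s \<Longrightarrow> \<exists>\<phi>\<in>borel_measurable borel. \<forall>\<omega>\<in>space M. Y s \<omega> = \<phi> (X s \<omega>)"
  shows "natural_filtration M X t = natural_filtration M Y t"
proof -
  have sub: "sets (natural_filtration M X t) \<subseteq> sets (natural_filtration M Y t)"
    if *: "\<And>s. 0 \<le> s \<Longrightarrow> \<exists>\<phi>\<in>borel_measurable borel. \<forall>\<omega>\<in>space M. X s \<omega> = \<phi> (Y s \<omega>)"
    for X Y :: "real \<Rightarrow> 'a \<Rightarrow> real"
  proof (rule sets_natural_filtration_subset)
    fix s :: real assume s: "0 \<le> s" "ennreal s \<le> t"
    obtain \<phi> where \<phi>: "\<phi> \<in> borel_measurable borel" "\<forall>\<omega>\<in>space M. X s \<omega> = \<phi> (Y s \<omega>)"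
      using *[OF s(1)] by blast
    have "(\<lambda>\<omega>. \<phi> (Y s \<omega>)) \<in> borel_measurable (natural_filtration M Y t)"
      by (rule measurable_compose[OF measurable_natural_filtration_component[OF s] \<phi>(1)])
    then show "X s \<in> borel_measurable (natural_filtration M Y t)"
      using \<phi>(2) by (subst measurable_cong[where g="\<lambda>\<omega>. \<phi> (Y s \<omega>)"]) auto
  qed simp
  show ?thesis
  \<comment> \<open>A \<open>sigma\<close> measure is identically zero, so only the sets have to be
    compared.\<close>
  proof (rule measure_eqI)
    show "sets (natural_filtration M X t) = sets (natural_filtration M Y t)"
      using sub[of X Y] sub[of Y X] assms by blast
  qed (simp add: natural_filtration_def emeasure_sigma)
qed

text \<open>Completing the square: the exponential weight moves the mean of the normal law from 0 to
  \<open>b * d\<close>. This is Cameron--Martin for a single increment.\<close>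

lemma nn_integral_normal_tilt:
  fixes g :: "real \<Rightarrow> ennreal"
  assumes [measurable]: "g \<in> borel_measurable borel" and d: "0 < d"
  shows "(\<integral>\<^sup>+z. ennreal (normal_density 0 (sqrt d) z) *
             (ennreal (exp (b * z - b\<^sup>2 * d / 2)) * g z) \<partial>lborel)
       = (\<integral>\<^sup>+z. ennreal (normal_density 0 (sqrt d) z) * g (z + b * d) \<partial>lborel)"
proof -
  have eq: "normal_density 0 (sqrt d) z * exp (b * z - b\<^sup>2 * d / 2)
      = normal_density 0 (sqrt d) (z - b * d)" for z
  proof -
    have "- z\<^sup>2 / (2 * d) + (b * z - b\<^sup>2 * d / 2) = - (z - b * d)\<^sup>2 / (2 * d)"
      using d by (simp add: field_simps power2_eq_square)
    then show ?thesis using d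
      by (simp add: normal_density_def exp_add[symmetric])
  qed
  have "(\<integral>\<^sup>+z. ennreal (normal_density 0 (sqrt d) z) *
             (ennreal (exp (b * z - b\<^sup>2 * d / 2)) * g z) \<partial>lborel)
      = (\<integral>\<^sup>+z. ennreal (normal_density 0 (sqrt d) (z - b * d)) * g z \<partial>lborel)"
    by (simp add: mult.assoc[symmetric] ennreal_mult[symmetric] eq)
  also have "\<dots> = (\<integral>\<^sup>+z. ennreal (normal_density 0 (sqrt d) z) * g (z + b * d) \<partial>lborel)"
    by (subst nn_integral_real_affine[where c=1 and t="b * d"]) (auto simp: add.commute)
  finally show ?thesis .
qed

section \<open>Independent increments and Cameron--Martin at finitely many times\<close>

context wiener_process
begin

lemma sets_F_subset: "sets (natural_filtration M W t) \<subseteq> sets M"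
  by (intro sets_natural_filtration_subset) (auto intro: W_measurable)

lemma measurable_id_F: "(\<lambda>\<omega>. \<omega>) \<in> M \<rightarrow>\<^sub>M natural_filtration M W t"
  by (intro measurable_into_natural_filtration) (auto intro: W_measurable)

lemma borel_measurable_F_imp:
  "Y \<in> borel_measurable (natural_filtration M W t) \<Longrightarrow> Y \<in> borel_measurable M"
  using measurable_compose[OF measurable_id_F] by blast

text \<open>By independence, the point \<open>\<omega>\<close> seen through the past and the
  increment have a product law, so the increment is integrated out against its density with
  \<open>\<omega>\<close> frozen. The past enters as a whole sigma-algebra, which admits arbitrary
  factors known at time \<open>s\<close>.\<close>

lemma nn_integral_increment:
  assumes s: "0 \<le> s" "s < t"
    and \<Phi>: "\<Phi> \<in> borel_measurable (natural_filtration M W (ennreal s) \<Otimes>\<^sub>M borel)"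
  shows "(\<integral>\<^sup>+\<omega>. \<Phi> (\<omega>, W t \<omega> - W s \<omega>) \<partial>M)
    = (\<integral>\<^sup>+\<omega>. \<integral>\<^sup>+z. ennreal (normal_density 0 (sqrt (t - s)) z) * \<Phi> (\<omega>, z) \<partial>lborel \<partial>M)"
proof -
  let ?F = "natural_filtration M W (ennreal s)"
  let ?D = "\<lambda>\<omega>. W t \<omega> - W s \<omega>"
  have D [measurable]: "?D \<in> borel_measurable M"
    using s by (intro borel_measurable_diff W_measurable) auto
  interpret X: prob_space "distr M ?F (\<lambda>\<omega>. \<omega>)"
    by (rule prob_space_distr) (rule measurable_id_F)
  interpret Y: prob_space "distr M borel ?D"
    by (rule prob_space_distr) (rule D)
  have pair: "(\<lambda>\<omega>. (\<omega>, ?D \<omega>)) \<in> M \<rightarrow>\<^sub>M ?F \<Otimes>\<^sub>M borel"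
    using measurable_id_F D by (rule measurable_Pair)
  have eq: "distr M ?F (\<lambda>\<omega>. \<omega>) \<Otimes>\<^sub>M distr M borel ?D
      = distr M (?F \<Otimes>\<^sub>M borel) (\<lambda>\<omega>. (\<omega>, ?D \<omega>))"
  proof (rule pair_measure_eqI)
    show "sigma_finite_measure (distr M ?F (\<lambda>\<omega>. \<omega>))" "sigma_finite_measure (distr M borel ?D)"
      by unfold_locales
    fix A B assume "A \<in> sets (distr M ?F (\<lambda>\<omega>. \<omega>))" "B \<in> sets (distr M borel ?D)"
    then have A: "A \<in> sets ?F" and B: "B \<in> sets borel" by auto
    have A': "A \<inter> space M = A" using sets.sets_into_space[OF A] by auto
    have "emeasure (distr M ?F (\<lambda>\<omega>. \<omega>)) A * emeasure (distr M borel ?D) B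
        = emeasure M A * emeasure M (?D -` B \<inter> space M)"
      using A B A' by (simp add: emeasure_distr[OF measurable_id_F] emeasure_distr)
    also have "\<dots> = emeasure M (A \<inter> (?D -` B \<inter> space M))"
    proof -
      have "prob (A \<inter> (?D -` B \<inter> space M)) = prob A * prob (?D -` B \<inter> space M)"
        using W_indep[OF s] A B unfolding indep_sets2_eq by blast
      then show ?thesis by (simp add: emeasure_eq_measure ennreal_mult measure_nonneg)
    qed
    also have "A \<inter> (?D -` B \<inter> space M) = (\<lambda>\<omega>. (\<omega>, ?D \<omega>)) -` (A \<times> B) \<inter> space M"
      by auto
    also have "emeasure M \<dots> = emeasure (distr M (?F \<Otimes>\<^sub>M borel) (\<lambda>\<omega>. (\<omega>, ?D \<omega>))) (A \<times> B)"
      using A B by (subst emeasure_distr[OF pair]) auto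
    finally show "emeasure (distr M ?F (\<lambda>\<omega>. \<omega>)) A * emeasure (distr M borel ?D) B
        = emeasure (distr M (?F \<Otimes>\<^sub>M borel) (\<lambda>\<omega>. (\<omega>, ?D \<omega>))) (A \<times> B)" .
  qed simp
  have dD: "distr M borel ?D = density lborel (\<lambda>x. ennreal (normal_density 0 (sqrt (t - s)) x))"
  proof -
    have "distr M borel ?D = distr M lborel ?D" by (rule distr_cong) auto
    with distributed_distr_eq_density[OF W_normal[OF s]] show ?thesis by simp
  qed
  have "(\<integral>\<^sup>+\<omega>. \<Phi> (\<omega>, ?D \<omega>) \<partial>M) = (\<integral>\<^sup>+p. \<Phi> p \<partial>distr M (?F \<Otimes>\<^sub>M borel) (\<lambda>\<omega>. (\<omega>, ?D \<omega>)))"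
    using pair \<Phi> by (subst nn_integral_distr) auto
  also have "\<dots> = (\<integral>\<^sup>+\<omega>. \<integral>\<^sup>+z. \<Phi> (\<omega>, z) \<partial>distr M borel ?D \<partial>distr M ?F (\<lambda>\<omega>. \<omega>))"
    unfolding eq[symmetric] using \<Phi>
    by (subst Y.nn_integral_fst[symmetric]) (auto cong: measurable_cong_sets)
  also have "\<dots> = (\<integral>\<^sup>+\<omega>. \<integral>\<^sup>+z. \<Phi> (\<omega>, z) \<partial>distr M borel ?D \<partial>M)"
  proof (subst nn_integral_distr[OF measurable_id_F])
    show "(\<lambda>\<omega>. \<integral>\<^sup>+z. \<Phi> (\<omega>, z) \<partial>distr M borel ?D) \<in> borel_measurable (distr M ?F (\<lambda>\<omega>. \<omega>))"
      using \<Phi> by (intro Y.borel_measurable_nn_integral) (auto cong: measurable_cong_sets)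
  qed simp
  also have "\<dots> = (\<integral>\<^sup>+\<omega>. \<integral>\<^sup>+z. ennreal (normal_density 0 (sqrt (t - s)) z) * \<Phi> (\<omega>, z) \<partial>lborel \<partial>M)"
  proof (rule nn_integral_cong)
    fix \<omega> assume \<omega>: "\<omega> \<in> space M"
    have "(\<lambda>z. \<Phi> (\<omega>, z)) \<in> borel_measurable borel"
      using measurable_Pair2[OF \<Phi>, of \<omega>] \<omega> by simp
    then show "(\<integral>\<^sup>+z. \<Phi> (\<omega>, z) \<partial>distr M borel ?D)
        = (\<integral>\<^sup>+z. ennreal (normal_density 0 (sqrt (t - s)) z) * \<Phi> (\<omega>, z) \<partial>lborel)"
      unfolding dD by (subst nn_integral_density) auto
  qed
  finally show ?thesis .
qed

text \<open>The density, with respect to the law of \<open>W\<close>, of the law of \<open>W\<close>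
  with drift \<open>b\<close> added up to time \<open>t\<close> and none afterwards.\<close>

definition girsanov :: "real \<Rightarrow> real \<Rightarrow> 'w \<Rightarrow> real" where
  "girsanov b t \<omega> = exp (b * W t \<omega> - b\<^sup>2 * t / 2)"

lemma girsanov_measurable_F:
  assumes "0 \<le> s" "s \<le> t"
  shows "girsanov b s \<in> borel_measurable (natural_filtration M W (ennreal t))"
proof -
  have [measurable]: "W s \<in> borel_measurable (natural_filtration M W (ennreal t))"
    using assms by (intro measurable_natural_filtration_component) auto
  show ?thesis unfolding girsanov_def[abs_def] by measurable
qed

text \<open>The last increment is integrated out of both expectations at once; the point is that a
  single \<open>g'\<close> serves the weighted and the shifted one, for every factor
  \<open>Y\<close> known at time \<open>s\<close>. By the side condition the drift acts during the
  whole increment or not at all. In the first case the normal tilt turns weight into shift, in the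
  second the increment is the same on both sides.\<close>

lemma cameron_martin_step_aux:
  fixes g :: "real \<Rightarrow> ennreal"
  assumes g [measurable]: "g \<in> borel_measurable borel" and s: "0 \<le> s" "s < s'"
    and t: "s' \<le> t \<or> t \<le> s" and t0: "0 \<le> t"
  shows "\<exists>g'\<in>borel_measurable borel. \<forall>Y::'w \<Rightarrow> ennreal\<in>borel_measurable (natural_filtration M W (ennreal s)).
     (\<integral>\<^sup>+\<omega>. ennreal (girsanov b (min s' t) \<omega>) * (Y \<omega> * g (W s' \<omega>)) \<partial>M)
       = (\<integral>\<^sup>+\<omega>. ennreal (girsanov b (min s t) \<omega>) * (Y \<omega> * g' (W s \<omega>)) \<partial>M) \<and>
     (\<integral>\<^sup>+\<omega>. Y \<omega> * g (W s' \<omega> + b * min s' t) \<partial>M)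
       = (\<integral>\<^sup>+\<omega>. Y \<omega> * g' (W s \<omega> + b * min s t) \<partial>M)"
proof -
  let ?n = "\<lambda>z. ennreal (normal_density 0 (sqrt (s' - s)) z)"
  let ?\<beta> = "\<lambda>u. b * min u t"
  let ?F = "natural_filtration M W (ennreal s)"
  define g' where "g' w = (\<integral>\<^sup>+z. ?n z * g (w + z + (?\<beta> s' - ?\<beta> s)) \<partial>lborel)" for w
  have g' [measurable]: "g' \<in> borel_measurable borel"
    unfolding g'_def[abs_def] by measurable
  have Ws [measurable]: "W s \<in> borel_measurable ?F"
    using s by (intro measurable_natural_filtration_component) auto
  show ?thesis
  proof (intro bexI[of _ g'] ballI conjI)
    fix Y :: "'w \<Rightarrow> ennreal" assume Y [measurable]: "Y \<in> borel_measurable ?F"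
    have "(\<integral>\<^sup>+\<omega>. Y \<omega> * g (W s' \<omega> + ?\<beta> s') \<partial>M)
        = (\<integral>\<^sup>+\<omega>. (\<lambda>(\<omega>, z). Y \<omega> * g (W s \<omega> + z + ?\<beta> s')) (\<omega>, W s' \<omega> - W s \<omega>) \<partial>M)"
      by simp
    also have "\<dots> = (\<integral>\<^sup>+\<omega>. \<integral>\<^sup>+z. ?n z * (Y \<omega> * g (W s \<omega> + z + ?\<beta> s')) \<partial>lborel \<partial>M)"
      by (subst nn_integral_increment[OF s]) auto
    also have "\<dots> = (\<integral>\<^sup>+\<omega>. Y \<omega> * g' (W s \<omega> + ?\<beta> s) \<partial>M)"
      unfolding g'_def by (subst nn_integral_cmult[symmetric]) (auto simp: algebra_simps)
    finally show "(\<integral>\<^sup>+\<omega>. Y \<omega> * g (W s' \<omega> + ?\<beta> s') \<partial>M)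
        = (\<integral>\<^sup>+\<omega>. Y \<omega> * g' (W s \<omega> + ?\<beta> s) \<partial>M)" .
    show "(\<integral>\<^sup>+\<omega>. ennreal (girsanov b (min s' t) \<omega>) * (Y \<omega> * g (W s' \<omega>)) \<partial>M)
       = (\<integral>\<^sup>+\<omega>. ennreal (girsanov b (min s t) \<omega>) * (Y \<omega> * g' (W s \<omega>)) \<partial>M)"
    proof (cases "s' \<le> t")
      case True
      have Z [measurable]: "girsanov b s \<in> borel_measurable ?F"
        using s by (intro girsanov_measurable_F) auto
      let ?E = "\<lambda>z. ennreal (exp (b * z - b\<^sup>2 * (s' - s) / 2))"
      have "girsanov b s' \<omega> = girsanov b s \<omega> * exp (b * (W s' \<omega> - W s \<omega>) - b\<^sup>2 * (s' - s) / 2)" for \<omega>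
        by (simp add: girsanov_def exp_add[symmetric] algebra_simps diff_divide_distrib)
      then have "(\<integral>\<^sup>+\<omega>. ennreal (girsanov b s' \<omega>) * (Y \<omega> * g (W s' \<omega>)) \<partial>M)
          = (\<integral>\<^sup>+\<omega>. (\<lambda>(\<omega>, z). (ennreal (girsanov b s \<omega>) * ?E z) * (Y \<omega> * g (W s \<omega> + z)))
               (\<omega>, W s' \<omega> - W s \<omega>) \<partial>M)"
        by (simp add: ennreal_mult girsanov_def)
      also have "\<dots> = (\<integral>\<^sup>+\<omega>. \<integral>\<^sup>+z. ?n z *
          ((ennreal (girsanov b s \<omega>) * ?E z) * (Y \<omega> * g (W s \<omega> + z))) \<partial>lborel \<partial>M)"
        by (subst nn_integral_increment[OF s]) auto
      also have "\<dots> = (\<integral>\<^sup>+\<omega>. ennreal (girsanov b s \<omega>) * (Y \<omega> * g' (W s \<omega>)) \<partial>M)"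
      proof (rule nn_integral_cong)
        fix \<omega>
        have "(\<integral>\<^sup>+z. ?n z *
            ((ennreal (girsanov b s \<omega>) * ?E z) * (Y \<omega> * g (W s \<omega> + z))) \<partial>lborel)
          = (\<integral>\<^sup>+z. (ennreal (girsanov b s \<omega>) * Y \<omega>) * (?n z * (?E z * g (W s \<omega> + z))) \<partial>lborel)"
          by (intro nn_integral_cong) (simp add: ac_simps)
        also have "\<dots> = (ennreal (girsanov b s \<omega>) * Y \<omega>) * (\<integral>\<^sup>+z. ?n z * (?E z * g (W s \<omega> + z)) \<partial>lborel)"
          by (rule nn_integral_cmult) measurable
        also have "(\<integral>\<^sup>+z. ?n z * (?E z * g (W s \<omega> + z)) \<partial>lborel)
            = (\<integral>\<^sup>+z. ?n z * g (W s \<omega> + (z + b * (s' - s))) \<partial>lborel)"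
          using s by (intro nn_integral_normal_tilt) auto
        also have "\<dots> = g' (W s \<omega>)"
          using True s by (simp add: g'_def algebra_simps)
        finally show "(\<integral>\<^sup>+z. ?n z *
            ((ennreal (girsanov b s \<omega>) * ?E z) * (Y \<omega> * g (W s \<omega> + z))) \<partial>lborel)
          = ennreal (girsanov b s \<omega>) * (Y \<omega> * g' (W s \<omega>))"
          by (simp add: mult.assoc)
      qed
      finally show ?thesis using True s by simp
    next
      case False
      then have t: "t \<le> s" using t by simp
      show ?thesis
      proof -
        have [measurable]: "girsanov b t \<in> borel_measurable ?F"
          using t0 t by (intro girsanov_measurable_F) auto
        have "(\<integral>\<^sup>+\<omega>. ennreal (girsanov b t \<omega>) * (Y \<omega> * g (W s' \<omega>)) \<partial>M)
          = (\<integral>\<^sup>+\<omega>. (\<lambda>(\<omega>, z). ennreal (girsanov b t \<omega>) * (Y \<omega> * g (W s \<omega> + z)))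
               (\<omega>, W s' \<omega> - W s \<omega>) \<partial>M)"
          by simp
        also have "\<dots> = (\<integral>\<^sup>+\<omega>. \<integral>\<^sup>+z. ?n z *
            (ennreal (girsanov b t \<omega>) * (Y \<omega> * g (W s \<omega> + z))) \<partial>lborel \<partial>M)"
          by (subst nn_integral_increment[OF s]) auto
        also have "\<dots> = (\<integral>\<^sup>+\<omega>. ennreal (girsanov b t \<omega>) * (Y \<omega> * g' (W s \<omega>)) \<partial>M)"
          unfolding g'_def using t s
          by (intro nn_integral_cong) (simp add: nn_integral_cmult[symmetric] mult.assoc[symmetric], simp add: ac_simps)
        finally show ?thesis using t s by simp
      qed
    qed
  qed measurable
qed

text \<open>An increment during which the drift is switched off is cut at \<open>t\<close>, and its
  two pieces are integrated out in turn.\<close>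

lemma cameron_martin_step:
  fixes g :: "real \<Rightarrow> ennreal"
  assumes g: "g \<in> borel_measurable borel" and s: "0 \<le> s" "s \<le> s'" and t: "0 \<le> t"
  shows "\<exists>g'\<in>borel_measurable borel. \<forall>Y::'w \<Rightarrow> ennreal\<in>borel_measurable (natural_filtration M W (ennreal s)).
     (\<integral>\<^sup>+\<omega>. ennreal (girsanov b (min s' t) \<omega>) * (Y \<omega> * g (W s' \<omega>)) \<partial>M)
       = (\<integral>\<^sup>+\<omega>. ennreal (girsanov b (min s t) \<omega>) * (Y \<omega> * g' (W s \<omega>)) \<partial>M) \<and>
     (\<integral>\<^sup>+\<omega>. Y \<omega> * g (W s' \<omega> + b * min s' t) \<partial>M)
       = (\<integral>\<^sup>+\<omega>. Y \<omega> * g' (W s \<omega> + b * min s t) \<partial>M)"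
proof -
  consider "s = s'" | "s < s'" "s' \<le> t \<or> t \<le> s" | "s < t" "t < s'"
    using s by linarith
  then show ?thesis
  proof cases
    case 1
    then show ?thesis using g by (intro bexI[of _ g]) auto
  next
    case 2
    show ?thesis using cameron_martin_step_aux[OF g s(1) 2(1,2) t] by blast
  next
    case 3
    from cameron_martin_step_aux[OF g t 3(2) _ t, of b]
    obtain g1 where g1: "g1 \<in> borel_measurable borel"
      "\<And>Y::'w \<Rightarrow> ennreal. Y \<in> borel_measurable (natural_filtration M W (ennreal t)) \<Longrightarrow>
     (\<integral>\<^sup>+\<omega>. ennreal (girsanov b (min s' t) \<omega>) * (Y \<omega> * g (W s' \<omega>)) \<partial>M)
       = (\<integral>\<^sup>+\<omega>. ennreal (girsanov b (min t t) \<omega>) * (Y \<omega> * g1 (W t \<omega>)) \<partial>M) \<and>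
     (\<integral>\<^sup>+\<omega>. Y \<omega> * g (W s' \<omega> + b * min s' t) \<partial>M)
       = (\<integral>\<^sup>+\<omega>. Y \<omega> * g1 (W t \<omega> + b * min t t) \<partial>M)"
      by auto
    from cameron_martin_step_aux[OF g1(1) s(1) 3(1) _ t, of b]
    obtain g2 where g2: "g2 \<in> borel_measurable borel"
      "\<And>Y::'w \<Rightarrow> ennreal. Y \<in> borel_measurable (natural_filtration M W (ennreal s)) \<Longrightarrow>
     (\<integral>\<^sup>+\<omega>. ennreal (girsanov b (min t t) \<omega>) * (Y \<omega> * g1 (W t \<omega>)) \<partial>M)
       = (\<integral>\<^sup>+\<omega>. ennreal (girsanov b (min s t) \<omega>) * (Y \<omega> * g2 (W s \<omega>)) \<partial>M) \<and>
     (\<integral>\<^sup>+\<omega>. Y \<omega> * g1 (W t \<omega> + b * min t t) \<partial>M)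
       = (\<integral>\<^sup>+\<omega>. Y \<omega> * g2 (W s \<omega> + b * min s t) \<partial>M)"
      by auto
    have "Y \<in> borel_measurable (natural_filtration M W (ennreal t))"
      if "Y \<in> borel_measurable (natural_filtration M W (ennreal s))" for Y :: "'w \<Rightarrow> ennreal"
      using 3(1) that by (intro borel_measurable_natural_filtration_mono[of "ennreal s" "ennreal t"] ennreal_leI) auto
    with g1(2) g2(2) show ?thesis by (intro bexI[OF _ g2(1)] ballI conjI) (metis (no_types, lifting))+
  qed
qed

text \<open>Induction on the observation times, removing the latest: its indicator and everything
  after it are absorbed into a function of \<open>W\<close> at that time. This is why a general
  terminal function \<open>g\<close> is carried along.\<close>

lemma cameron_martin_cylinder:
  fixes A :: "real \<Rightarrow> real set"
  assumes "finite J" and A: "\<And>j. j \<in> J \<Longrightarrow> A j \<in> sets borel" and t: "0 \<le> t"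
    and "0 \<le> s" "\<And>j. j \<in> J \<Longrightarrow> j \<le> s" and "g \<in> borel_measurable borel"
  shows "(\<integral>\<^sup>+\<omega>. ennreal (girsanov b (min s t) \<omega>) *
            ((\<Prod>j\<in>J. indicator (A j) (W (max 0 j) \<omega>)) * g (W s \<omega>)) \<partial>M)
       = (\<integral>\<^sup>+\<omega>. (\<Prod>j\<in>J. indicator (A j) (W (max 0 j) \<omega> + b * min (max 0 j) t)) *
            g (W s \<omega> + b * min s t) \<partial>M)"
  using assms
proof (induction J arbitrary: s g rule: finite_linorder_max_induct)
  case empty
  obtain g' where g': "g' \<in> borel_measurable borel" 
     "\<forall>Y::'w \<Rightarrow> ennreal\<in>borel_measurable (natural_filtration M W (ennreal 0)).
     (\<integral>\<^sup>+\<omega>. ennreal (girsanov b (min s t) \<omega>) * (Y \<omega> * g (W s \<omega>)) \<partial>M)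
       = (\<integral>\<^sup>+\<omega>. ennreal (girsanov b (min 0 t) \<omega>) * (Y \<omega> * g' (W 0 \<omega>)) \<partial>M) \<and>
     (\<integral>\<^sup>+\<omega>. Y \<omega> * g (W s \<omega> + b * min s t) \<partial>M)
       = (\<integral>\<^sup>+\<omega>. Y \<omega> * g' (W 0 \<omega> + b * min 0 t) \<partial>M)"
    using cameron_martin_step[OF empty(5) order_refl empty(3) empty(2), of b] by auto
  \<comment> \<open>At time 0 the weight is \<open>exp (b * W 0 \<omega>)\<close>, which is 1 almost
    surely.\<close>
  have "(\<integral>\<^sup>+\<omega>. ennreal (girsanov b 0 \<omega>) * g' (W 0 \<omega>) \<partial>M) = (\<integral>\<^sup>+\<omega>. g' (W 0 \<omega>) \<partial>M)"
    using W_start by (intro nn_integral_cong_AE) (auto simp: girsanov_def)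
  with g'(2)[THEN bspec, of "\<lambda>_. 1"] t show ?case by simp
next
  case (insert j J)
  have A [measurable]: "A i \<in> sets borel" if "i \<in> insert j J" for i
    using insert.prems(1) that by blast
  let ?j = "max 0 j"
  have j: "0 \<le> ?j" "?j \<le> s" using insert.prems by auto
  let ?F = "natural_filtration M W (ennreal ?j)"
  obtain g' where g': "g' \<in> borel_measurable borel" 
     "\<And>Y::'w \<Rightarrow> ennreal. Y \<in> borel_measurable ?F \<Longrightarrow>
     (\<integral>\<^sup>+\<omega>. ennreal (girsanov b (min s t) \<omega>) * (Y \<omega> * g (W s \<omega>)) \<partial>M)
       = (\<integral>\<^sup>+\<omega>. ennreal (girsanov b (min ?j t) \<omega>) * (Y \<omega> * g' (W ?j \<omega>)) \<partial>M)"
     "\<And>Y::'w \<Rightarrow> ennreal. Y \<in> borel_measurable ?F \<Longrightarrow>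
     (\<integral>\<^sup>+\<omega>. Y \<omega> * g (W s \<omega> + b * min s t) \<partial>M)
       = (\<integral>\<^sup>+\<omega>. Y \<omega> * g' (W ?j \<omega> + b * min ?j t) \<partial>M)"
    using cameron_martin_step[OF insert.prems(5) j t, of b] by blast
  have Wi [measurable]: "W (max 0 i) \<in> borel_measurable ?F" if "i \<in> insert j J" for i
    using that insert.hyps(2)
    by (intro measurable_natural_filtration_component) (auto simp: ennreal_leI less_imp_le intro!: ennreal_leI max.mono)
  have Y: "(\<lambda>\<omega>. \<Prod>i\<in>insert j J. indicator (A i) (W (max 0 i) \<omega> + a i) :: ennreal) \<in> borel_measurable ?F" for a
    by (intro borel_measurable_prod_ennreal) measurable
  have nj: "j \<notin> J" using insert.hyps(2) by blast
  define g1 where "g1 w = indicator (A j) w * g' w" for w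
  have g1: "g1 \<in> borel_measurable borel"
    unfolding g1_def[abs_def] using g'(1) A by measurable
  have "(\<integral>\<^sup>+\<omega>. ennreal (girsanov b (min s t) \<omega>) *
            ((\<Prod>i\<in>insert j J. indicator (A i) (W (max 0 i) \<omega>)) * g (W s \<omega>)) \<partial>M)
      = (\<integral>\<^sup>+\<omega>. ennreal (girsanov b (min ?j t) \<omega>) *
            ((\<Prod>i\<in>insert j J. indicator (A i) (W (max 0 i) \<omega>)) * g' (W ?j \<omega>)) \<partial>M)"
    using Y[of "\<lambda>_. 0"] by (intro g'(2)) simp
  also have "\<dots> = (\<integral>\<^sup>+\<omega>. ennreal (girsanov b (min ?j t) \<omega>) *
            ((\<Prod>i\<in>J. indicator (A i) (W (max 0 i) \<omega>)) * g1 (W ?j \<omega>)) \<partial>M)"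
    using insert.hyps(1) nj by (simp add: g1_def ac_simps)
  also have "\<dots> = (\<integral>\<^sup>+\<omega>. (\<Prod>i\<in>J. indicator (A i) (W (max 0 i) \<omega> + b * min (max 0 i) t)) *
            g1 (W ?j \<omega> + b * min ?j t) \<partial>M)"
    using insert.hyps(2) A by (intro insert.IH t g1) (auto simp: less_imp_le max_def)
  also have "\<dots> = (\<integral>\<^sup>+\<omega>. (\<Prod>i\<in>insert j J. indicator (A i) (W (max 0 i) \<omega> + b * min (max 0 i) t)) *
            g' (W ?j \<omega> + b * min ?j t) \<partial>M)"
    using insert.hyps(1) nj by (simp add: g1_def ac_simps)
  also have "\<dots> = (\<integral>\<^sup>+\<omega>. (\<Prod>i\<in>insert j J. indicator (A i) (W (max 0 i) \<omega> + b * min (max 0 i) t)) *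
            g (W s \<omega> + b * min s t) \<partial>M)"
    by (rule g'(3)[symmetric]) (rule Y)
  finally show ?case .
qed

end

text \<open>Paths are indexed by all reals. As \<open>W\<close> is unspecified at negative times, it
  enters as \<open>\<lambda>u. W (max 0 u) \<omega>\<close>, frozen at its initial value
  there.\<close>

abbreviation path_space :: "(real \<Rightarrow> real) measure" where
  "path_space \<equiv> PiM UNIV (\<lambda>_. borel)"

section \<open>Cameron--Martin on path space, moments, joint measurability\<close>

context wiener_process
begin

lemma path_measurable:
  "(\<lambda>\<omega> u. W (max 0 u) \<omega> + a u) \<in> M \<rightarrow>\<^sub>M path_space"
proof (rule measurable_PiM_single')
  show "(\<lambda>\<omega>. W (max 0 u) \<omega> + a u) \<in> borel_measurable M" for u
    by (intro borel_measurable_add W_measurable) auto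
qed auto

lemma girsanov_measurable [measurable]: "0 \<le> t \<Longrightarrow> girsanov b t \<in> borel_measurable M"
  by (rule borel_measurable_F_imp[OF girsanov_measurable_F]) auto

text \<open>Finite measures on path space are determined by finite-dimensional rectangles, where the
  identity is the cylinder formula with \<open>g\<close> constantly 1.\<close>

lemma cameron_martin_distr:
  assumes t: "0 \<le> t"
  shows "distr M path_space (\<lambda>\<omega> u. W (max 0 u) \<omega> + b * min (max 0 u) t)
       = distr (density M (\<lambda>\<omega>. ennreal (girsanov b t \<omega>))) path_space (\<lambda>\<omega> u. W (max 0 u) \<omega>)"
    (is "?P = ?Q")
proof (rule measure_eqI_PiM_infinite)
  have m0: "(\<lambda>\<omega> u. W (max 0 u) \<omega>) \<in> M \<rightarrow>\<^sub>M path_space"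
    using path_measurable[of "\<lambda>_. 0"] by simp
  note [measurable] = m0 path_measurable
  fix A :: "real \<Rightarrow> real set" and J :: "real set"
  assume J: "finite J" and A: "\<And>i. i \<in> J \<Longrightarrow> A i \<in> sets borel"
  let ?X = "prod_emb UNIV (\<lambda>_. borel) J (Pi\<^sub>E J A)"
  have X [measurable]: "?X \<in> sets path_space"
    using J A by (intro sets_PiM_I) auto
  have iX: "indicator ?X p = (\<Prod>j\<in>J. indicator (A j) (p j) :: ennreal)" for p
  proof -
    have "p \<in> ?X \<longleftrightarrow> (\<forall>j\<in>J. p j \<in> A j)"
      by (auto simp: prod_emb_def PiE_iff)
    then show ?thesis using J
      by (auto simp: indicator_def prod_zero_iff split: if_splits)
  qed
  \<comment> \<open>The terminal time has to lie beyond \<open>t\<close>: the cylinder formula takes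
    its density at \<open>min s t\<close>, and the density at \<open>t\<close> is wanted.\<close>
  define s where "s = Max (insert t J)"
  have s: "t \<le> s" "0 \<le> s" "\<And>j. j \<in> J \<Longrightarrow> j \<le> s"
    using J t by (auto simp: s_def Max_ge_iff)
  have "emeasure ?P ?X = (\<integral>\<^sup>+p. indicator ?X p \<partial>?P)" by simp
  also have "\<dots> = (\<integral>\<^sup>+\<omega>. (\<Prod>j\<in>J. indicator (A j) (W (max 0 j) \<omega> + b * min (max 0 j) t)) \<partial>M)"
    by (subst nn_integral_distr) (auto simp: iX)
  also have "\<dots> = (\<integral>\<^sup>+\<omega>. ennreal (girsanov b t \<omega>) *
            (\<Prod>j\<in>J. indicator (A j) (W (max 0 j) \<omega>)) \<partial>M)"
    using cameron_martin_cylinder[OF J A t s(2,3), where b=b and g="\<lambda>_. 1"] s(1) by (simp add: min_absorb2)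
  also have "\<dots> = (\<integral>\<^sup>+p. indicator ?X p \<partial>?Q)"
  proof -
    have [measurable]: "A j \<in> sets borel" if "j \<in> J" for j using A that .
    have [measurable]: "W (max 0 j) \<in> borel_measurable M" for j by (intro W_measurable) auto
    have "(\<lambda>\<omega>. \<Prod>j\<in>J. indicator (A j) (W (max 0 j) \<omega>) :: ennreal) \<in> borel_measurable M"
      by (intro borel_measurable_prod_ennreal) measurable
    then show ?thesis using t
      by (subst nn_integral_distr) (auto simp: iX nn_integral_density)
  qed
  also have "\<dots> = emeasure ?Q ?X" by simp
  finally show "emeasure ?P ?X = emeasure ?Q ?X" .
next
  interpret P: prob_space ?P
    by (rule prob_space_distr) (rule path_measurable)
  show "finite_measure ?P" by unfold_locales
qed simp_all

lemma cameron_martin: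
  assumes t: "0 \<le> t" and G: "G \<in> borel_measurable path_space"
  shows "(\<integral>\<^sup>+\<omega>. G (\<lambda>u. W (max 0 u) \<omega> + b * min (max 0 u) t) \<partial>M)
       = (\<integral>\<^sup>+\<omega>. ennreal (girsanov b t \<omega>) * G (\<lambda>u. W (max 0 u) \<omega>) \<partial>M)"
proof -
  have m0: "(\<lambda>\<omega> u. W (max 0 u) \<omega>) \<in> M \<rightarrow>\<^sub>M path_space"
    using path_measurable[of "\<lambda>_. 0"] by simp
  have "(\<integral>\<^sup>+\<omega>. G (\<lambda>u. W (max 0 u) \<omega> + b * min (max 0 u) t) \<partial>M)
      = (\<integral>\<^sup>+p. G p \<partial>distr M path_space (\<lambda>\<omega> u. W (max 0 u) \<omega> + b * min (max 0 u) t))"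
    using path_measurable G by (subst nn_integral_distr) auto
  also have "\<dots> = (\<integral>\<^sup>+\<omega>. G (\<lambda>u. W (max 0 u) \<omega>) \<partial>density M (\<lambda>\<omega>. ennreal (girsanov b t \<omega>)))"
    unfolding cameron_martin_distr[OF t] using m0 G by (subst nn_integral_distr) auto
  also have "\<dots> = (\<integral>\<^sup>+\<omega>. ennreal (girsanov b t \<omega>) * G (\<lambda>u. W (max 0 u) \<omega>) \<partial>M)"
    using t measurable_compose[OF m0 G] by (subst nn_integral_density) auto
  finally show ?thesis .
qed

lemma nn_integral_girsanov:
  "0 \<le> t \<Longrightarrow> (\<integral>\<^sup>+\<omega>. ennreal (girsanov b t \<omega>) \<partial>M) = 1"
  using cameron_martin[of t "\<lambda>_. 1" b] by (simp add: emeasure_space_1)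

text \<open>The density with drift \<open>a\<close> has mean 1, and this is the exponential moment
  up to a constant factor; no Gaussian integral has to be computed again.\<close>

lemma exp_W_moment:
  assumes t: "0 \<le> t"
  shows integrable_exp_W: "integrable M (\<lambda>\<omega>. exp (a * W t \<omega>))"
    and integral_exp_W: "(\<integral>\<omega>. exp (a * W t \<omega>) \<partial>M) = exp (a\<^sup>2 * t / 2)"
proof -
  have [measurable]: "W t \<in> borel_measurable M" using t by (rule W_measurable)
  have *: "exp (a * W t \<omega>) = exp (a\<^sup>2 * t / 2) * girsanov a t \<omega>" for \<omega>
    by (simp add: girsanov_def exp_add[symmetric])
  have "(\<integral>\<^sup>+\<omega>. ennreal (exp (a * W t \<omega>)) \<partial>M) = ennreal (exp (a\<^sup>2 * t / 2))"
    using t unfolding * by (simp add: ennreal_mult girsanov_def[abs_def] nn_integral_cmult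
        nn_integral_girsanov[OF t, unfolded girsanov_def[abs_def]])
  then have "has_bochner_integral M (\<lambda>\<omega>. exp (a * W t \<omega>)) (exp (a\<^sup>2 * t / 2))"
    by (intro has_bochner_integral_nn_integral) auto
  then show "integrable M (\<lambda>\<omega>. exp (a * W t \<omega>))"
    "(\<integral>\<omega>. exp (a * W t \<omega>) \<partial>M) = exp (a\<^sup>2 * t / 2)"
    by (auto simp: has_bochner_integral_iff)
qed

text \<open>The n-th moment of the density is exp ((n^2 - n) q / 2), which gives the exponents 6q,
  3q, q, 0, 0 for n = 4 down to 0, with alternating binomial coefficients. The terms of order 0 and
  1 in q cancel, leaving 3 q^2 to leading order.\<close>

lemma expectation_girsanov_power4:
  fixes b :: real
  assumes t: "0 \<le> t"
  defines "q \<equiv> b\<^sup>2 * t"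
  shows "integrable M (\<lambda>\<omega>. (girsanov b t \<omega> - 1) ^ 4)"
    and "(\<integral>\<omega>. (girsanov b t \<omega> - 1) ^ 4 \<partial>M) = exp (6 * q) - 4 * exp (3 * q) + 6 * exp q - 3"
proof -
  let ?e = "\<lambda>n \<omega>. exp (- (n * q / 2)) * exp ((n * b) * W t \<omega>)"
  have e: "girsanov b t \<omega> ^ n = ?e (real n) \<omega>" for n \<omega>
    by (simp add: girsanov_def q_def exp_add[symmetric] exp_of_nat_mult[symmetric] algebra_simps)
  have expand: "(girsanov b t \<omega> - 1) ^ 4 = ?e 4 \<omega> - 4 * ?e 3 \<omega> + 6 * ?e 2 \<omega> - 4 * ?e 1 \<omega> + 1" for \<omega>
  proof -
    have "(z - 1) ^ 4 = z ^ 4 - 4 * z ^ 3 + 6 * z ^ 2 - 4 * z ^ 1 + 1" for z :: real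
      by (simp add: algebra_simps power_numeral_reduce)
    then show ?thesis by (simp only: e of_nat_numeral of_nat_1)
  qed
  have i: "integrable M (?e n)" for n
    using integrable_exp_W[OF t] by simp
  have I: "(\<integral>\<omega>. ?e n \<omega> \<partial>M) = exp ((n\<^sup>2 - n) * q / 2)" for n
  proof -
    have "(\<integral>\<omega>. ?e n \<omega> \<partial>M) = exp (- (n * q / 2)) * exp ((n * b)\<^sup>2 * t / 2)"
      by (simp add: integral_exp_W[OF t])
    also have "\<dots> = exp ((n\<^sup>2 - n) * q / 2)"
      by (simp add: q_def exp_add[symmetric] algebra_simps power2_eq_square diff_divide_distrib)
    finally show ?thesis .
  qed
  show "integrable M (\<lambda>\<omega>. (girsanov b t \<omega> - 1) ^ 4)"
    unfolding expand by (intro Bochner_Integration.integrable_add Bochner_Integration.integrable_diff integrable_mult_right i) auto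
  have "(\<integral>\<omega>. (girsanov b t \<omega> - 1) ^ 4 \<partial>M)
     = (\<integral>\<omega>. ?e 4 \<omega> \<partial>M) - 4 * (\<integral>\<omega>. ?e 3 \<omega> \<partial>M) + 6 * (\<integral>\<omega>. ?e 2 \<omega> \<partial>M) - 4 * (\<integral>\<omega>. ?e 1 \<omega> \<partial>M) + 1"
    unfolding expand using i[of 4] i[of 3] i[of 2] i[of 1] by (simp add: prob_space del: mult_1)
  then show "(\<integral>\<omega>. (girsanov b t \<omega> - 1) ^ 4 \<partial>M) = exp (6 * q) - 4 * exp (3 * q) + 6 * exp q - 3"
    unfolding I by simp
qed

text \<open>By path continuity \<open>W\<close> is the limit of its values at times rounded down to
  a grid of mesh \<open>1 / real (Suc n)\<close>; a rounded version uses countably many times and is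
  therefore jointly measurable. Exchanging time integral and expectation rests on this.\<close>

lemma W_joint_measurable:
  "(\<lambda>(t, \<omega>). W (max 0 t) \<omega>) \<in> borel_measurable (borel \<Otimes>\<^sub>M M)"
proof (rule borel_measurable_LIMSEQ_real[where
      u="\<lambda>n (t, \<omega>). W (max 0 (real_of_int \<lfloor>t * real (Suc n)\<rfloor> / real (Suc n))) \<omega>"])
  let ?g = "\<lambda>n (t::real). max 0 (real_of_int \<lfloor>t * real (Suc n)\<rfloor> / real (Suc n))"
  fix p :: "real \<times> 'w" assume "p \<in> space (borel \<Otimes>\<^sub>M M)"
  then obtain t \<omega> where p: "p = (t, \<omega>)" "\<omega> \<in> space M" by (auto simp: space_pair_measure)
  have "(\<lambda>n. real_of_int \<lfloor>t * real (Suc n)\<rfloor> / real (Suc n)) \<longlonglongrightarrow> t"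
  proof (rule tendsto_sandwich)
    show "\<forall>\<^sub>F n in sequentially. t - 1 / real (Suc n) \<le> real_of_int \<lfloor>t * real (Suc n)\<rfloor> / real (Suc n)"
    proof (intro always_eventually allI)
      fix n
      have "t * real (Suc n) - 1 \<le> real_of_int \<lfloor>t * real (Suc n)\<rfloor>" by linarith
      then have "(t * real (Suc n) - 1) / real (Suc n) \<le> real_of_int \<lfloor>t * real (Suc n)\<rfloor> / real (Suc n)"
        by (intro divide_right_mono) auto
      then show "t - 1 / real (Suc n) \<le> real_of_int \<lfloor>t * real (Suc n)\<rfloor> / real (Suc n)"
        by (simp add: diff_divide_distrib del: of_nat_Suc)
    qed
    show "\<forall>\<^sub>F n in sequentially. real_of_int \<lfloor>t * real (Suc n)\<rfloor> / real (Suc n) \<le> t"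
      by (intro always_eventually allI) (simp add: pos_divide_le_eq del: of_nat_Suc)
    show "(\<lambda>n. t - 1 / real (Suc n)) \<longlonglongrightarrow> t" by real_asymp
  qed simp
  then have "(\<lambda>n. ?g n t) \<longlonglongrightarrow> max 0 t" by (intro tendsto_max tendsto_const)
  then have "(\<lambda>n. W (?g n t) \<omega>) \<longlonglongrightarrow> W (max 0 t) \<omega>"
    by (intro continuous_on_tendsto_compose[OF W_paths[OF p(2)]]) auto
  then show "(\<lambda>n. (\<lambda>(t, \<omega>). W (?g n t) \<omega>) p) \<longlonglongrightarrow> (\<lambda>(t, \<omega>). W (max 0 t) \<omega>) p"
    by (simp add: p)
next
  fix n
  let ?h = "\<lambda>i::int. max 0 (real_of_int i / real (Suc n))"
  have "(\<lambda>p. (\<lambda>i p. W (?h i) (snd p)) \<lfloor>fst p * real (Suc n)\<rfloor> p) \<in> borel_measurable ((borel::real measure) \<Otimes>\<^sub>M M)"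
  proof (rule measurable_compose_countable[where f="\<lambda>i p. W (?h i) (snd p)"
        and g="\<lambda>p. \<lfloor>fst p * real (Suc n)\<rfloor>"])
    fix i :: int
    have [measurable]: "W (?h i) \<in> borel_measurable M" by (intro W_measurable) auto
    show "(\<lambda>p. W (?h i) (snd p)) \<in> borel_measurable ((borel::real measure) \<Otimes>\<^sub>M M)" by measurable
  qed measurable
  then show "(\<lambda>(t, \<omega>). W (max 0 (real_of_int \<lfloor>t * real (Suc n)\<rfloor> / real (Suc n))) \<omega>) \<in> borel_measurable (borel \<Otimes>\<^sub>M M)"
    by (simp add: case_prod_beta')
qed

end

subsection \<open>The optimal stopping problem\<close>

text \<open>\<open>rho\<close> stands for \<open>r + lam\<close>, and \<open>k y t\<close> for the
  discounted running reward at price \<open>y\<close> and time \<open>t\<close>, with the remaining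
  horizon already inserted. In time only measurability is kept. Prices are positive, so order and
  convexity are asked at positive arguments; \<open>mu_le\<close> makes the discounted price a
  supermartingale.\<close>

locale put_problem = wiener_process M W
  for M :: "'w measure" and W :: "real \<Rightarrow> 'w \<Rightarrow> real" +
  fixes vol mu rho K :: real and k :: "real \<Rightarrow> real \<Rightarrow> ennreal" and T :: ennreal
  assumes vol_pos: "0 < vol" and mu_le: "mu \<le> rho" and rho_pos: "0 < rho"
    and K_pos: "0 < K" and T_pos: "0 < T"
    and k_measurable: "(\<lambda>(y, t). k y t) \<in> borel_measurable (borel \<Otimes>\<^sub>M borel)"
    and k_antimono: "\<And>x y t. 0 < x \<Longrightarrow> x \<le> y \<Longrightarrow> k y t \<le> k x t"
    and k_convex: "\<And>x y u t. 0 < x \<Longrightarrow> 0 < y \<Longrightarrow> 0 \<le> u \<Longrightarrow> u \<le> 1 \<Longrightarrow>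
      k ((1 - u) * x + u * y) t \<le> ennreal (1 - u) * k x t + ennreal u * k y t"
begin

abbreviation F :: "real \<Rightarrow> 'w measure" where
  "F s \<equiv> natural_filtration M W (ennreal s)"

definition H :: "real \<Rightarrow> 'w \<Rightarrow> real" where
  "H t \<omega> = exp ((mu - vol\<^sup>2 / 2) * t + vol * W t \<omega>)"

definition pay :: "real \<Rightarrow> real \<Rightarrow> 'w \<Rightarrow> ennreal" where
  "pay x t \<omega> = ennreal (exp (- rho * t) * max 0 (K - x * H t \<omega>))"

definition run :: "real \<Rightarrow> real set \<Rightarrow> 'w \<Rightarrow> ennreal" where
  "run x A \<omega> = (\<integral>\<^sup>+t\<in>A. k (x * H t \<omega>) t \<partial>lborel)"

definition gain :: "real \<Rightarrow> ennreal \<Rightarrow> 'w \<Rightarrow> ennreal" where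
  "gain x \<theta> \<omega> = run x {t. 0 \<le> t \<and> ennreal t \<le> \<theta>} \<omega>
     + (if \<theta> = \<infinity> then 0 else pay x (enn2real \<theta>) \<omega>)"

definition value_of :: "real \<Rightarrow> ('w \<Rightarrow> ennreal) \<Rightarrow> ennreal" where
  "value_of x \<tau> = (\<integral>\<^sup>+\<omega>. gain x (\<tau> \<omega>) \<omega> \<partial>M)"

definition V :: "real \<Rightarrow> ennreal" where
  "V x = (SUP \<tau>\<in>stopping_times M W T. value_of x \<tau>)"

section \<open>Measurability of the rewards\<close>

lemma H_pos [simp]: "0 < H t \<omega>" by (simp add: H_def)

lemma H_measurable_F: "0 \<le> s \<Longrightarrow> s \<le> t \<Longrightarrow> H s \<in> borel_measurable (F t)"
  unfolding H_def[abs_def]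
  using measurable_natural_filtration_component[of s "ennreal t" W M] by (auto intro!: ennreal_leI)

lemma H_measurable: "0 \<le> s \<Longrightarrow> H s \<in> borel_measurable M"
  using H_measurable_F[of s s] borel_measurable_F_imp by blast

lemma pay_measurable_F: "0 \<le> s \<Longrightarrow> s \<le> t \<Longrightarrow> pay x s \<in> borel_measurable (F t)"
  unfolding pay_def[abs_def] using H_measurable_F[of s t] by measurable

lemma pay_measurable: "0 \<le> s \<Longrightarrow> pay x s \<in> borel_measurable M"
  using pay_measurable_F[of s s] borel_measurable_F_imp by blast

lemma pay_le: "0 \<le> s \<Longrightarrow> 0 < x \<Longrightarrow> pay x s \<omega> \<le> ennreal K"
proof -
  assume "0 \<le> s" "0 < x"
  then have "exp (- rho * s) * max 0 (K - x * H s \<omega>) \<le> 1 * K"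
    using K_pos rho_pos by (intro mult_mono) (auto simp: max_def mult_pos_pos less_imp_le)
  then show ?thesis unfolding pay_def by (intro ennreal_leI) simp
qed

lemma H_joint: "(\<lambda>p. H (max 0 (fst p)) (snd p)) \<in> borel_measurable (borel \<Otimes>\<^sub>M M)"
  unfolding H_def[abs_def] using W_joint_measurable[unfolded case_prod_beta'] by measurable

text \<open>The time set may depend on \<open>\<omega>\<close>, as the period up to a stopping time
  does. Joint measurability is at hand for clamped time only; on the time set the clamp is
  invisible.\<close>

lemma run_integrand_measurable:
  assumes A: "Measurable.pred (M \<Otimes>\<^sub>M borel) (\<lambda>p. snd p \<in> A (fst p))"
    and nonneg: "\<And>\<omega> t. t \<in> A \<omega> \<Longrightarrow> 0 \<le> t"
  shows "(\<lambda>p. k (x * H (snd p) (fst p)) (snd p) * indicator (A (fst p)) (snd p))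
      \<in> borel_measurable (M \<Otimes>\<^sub>M borel)"
proof -
  have [measurable]: "(\<lambda>p. H (max 0 (snd p)) (fst p)) \<in> borel_measurable (M \<Otimes>\<^sub>M borel)"
    using measurable_compose[OF measurable_Pair[OF measurable_snd measurable_fst] H_joint] by simp
  have [measurable]: "(\<lambda>p. k (fst p) (snd p)) \<in> borel_measurable (borel \<Otimes>\<^sub>M borel)"
    using k_measurable by (simp add: case_prod_beta')
  have m: "(\<lambda>p. k (x * H (max 0 (snd p)) (fst p)) (snd p)) \<in> borel_measurable (M \<Otimes>\<^sub>M borel)"
    by (rule measurable_compose[of "\<lambda>p. (x * H (max 0 (snd p)) (fst p), snd p)" _ "borel \<Otimes>\<^sub>M borel"
          "\<lambda>p. k (fst p) (snd p)", simplified]) measurable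
  have "(\<lambda>p. k (x * H (snd p) (fst p)) (snd p) * indicator (A (fst p)) (snd p))
     = (\<lambda>p. if snd p \<in> A (fst p) then k (x * H (max 0 (snd p)) (fst p)) (snd p) else 0)"
    using nonneg by (fastforce simp: fun_eq_iff max_absorb2)
  then show ?thesis using m A by simp
qed

lemma run_section_measurable:
  assumes [measurable]: "A \<in> sets borel" and nonneg: "\<And>t. t \<in> A \<Longrightarrow> 0 \<le> t" and \<omega>: "\<omega> \<in> space M"
  shows "(\<lambda>t. k (x * H t \<omega>) t * indicator A t) \<in> borel_measurable lborel"
proof -
  have "Measurable.pred (M \<Otimes>\<^sub>M borel) (\<lambda>p. snd p \<in> A)" by measurable
  from measurable_Pair2[OF run_integrand_measurable[of "\<lambda>_. A", OF this nonneg] \<omega>]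
  show ?thesis by simp
qed

lemma run_measurable:
  assumes A: "Measurable.pred (M \<Otimes>\<^sub>M borel) (\<lambda>p. snd p \<in> A (fst p))"
    and nonneg: "\<And>\<omega> t. t \<in> A \<omega> \<Longrightarrow> 0 \<le> t"
  shows "(\<lambda>\<omega>. run x (A \<omega>) \<omega>) \<in> borel_measurable M"
  unfolding run_def
  using lborel.borel_measurable_nn_integral_fst[of "\<lambda>p. k (x * H (snd p) (fst p)) (snd p) * indicator (A (fst p)) (snd p)" M]
    run_integrand_measurable[OF assms] by simp

lemma pay_random_time_measurable:
  assumes [measurable]: "\<theta> \<in> borel_measurable M" and nonneg: "\<And>\<omega>. 0 \<le> \<theta> \<omega>"
  shows "(\<lambda>\<omega>. pay x (\<theta> \<omega>) \<omega>) \<in> borel_measurable M"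
proof -
  have "(\<lambda>\<omega>. H (max 0 (\<theta> \<omega>)) \<omega>) \<in> borel_measurable M"
    by (rule measurable_compose[of "\<lambda>\<omega>. (\<theta> \<omega>, \<omega>)", OF _ H_joint, simplified]) measurable
  then have [measurable]: "(\<lambda>\<omega>. H (\<theta> \<omega>) \<omega>) \<in> borel_measurable M"
    using nonneg by (simp add: max_absorb2)
  show ?thesis unfolding pay_def by measurable
qed

lemma gain_measurable:
  assumes [measurable]: "\<tau> \<in> borel_measurable M"
  shows "(\<lambda>\<omega>. gain x (\<tau> \<omega>) \<omega>) \<in> borel_measurable M"
proof -
  have [measurable]: "(\<lambda>\<omega>. run x {t. 0 \<le> t \<and> ennreal t \<le> \<tau> \<omega>} \<omega>) \<in> borel_measurable M"
    by (rule run_measurable) auto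
  have [measurable]: "(\<lambda>\<omega>. pay x (enn2real (\<tau> \<omega>)) \<omega>) \<in> borel_measurable M"
    by (rule pay_random_time_measurable) auto
  show ?thesis unfolding gain_def by measurable
qed

lemma stopping_time_measurable: "\<tau> \<in> stopping_times M W T \<Longrightarrow> \<tau> \<in> borel_measurable M"
  unfolding stopping_times_def
  using measurable_stopping_time[of "natural_filtration M W" \<tau> M] sets_F_subset by auto

lemma value_le_V: "\<tau> \<in> stopping_times M W T \<Longrightarrow> value_of x \<tau> \<le> V x"
  unfolding V_def by (rule SUP_upper)

section \<open>Monotonicity and convexity in the starting point\<close>

lemma run_antimono: "0 < x \<Longrightarrow> x \<le> y \<Longrightarrow> run y A \<omega> \<le> run x A \<omega>"
  unfolding run_def
  by (intro nn_integral_mono mult_right_mono k_antimono) (auto intro: mult_right_mono less_imp_le)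

lemma run_mono: "A \<subseteq> B \<Longrightarrow> run x A \<omega> \<le> run x B \<omega>"
  unfolding run_def by (intro nn_integral_mono mult_left_mono) (auto simp: indicator_def)

lemma pay_antimono: "0 < x \<Longrightarrow> x \<le> y \<Longrightarrow> pay y t \<omega> \<le> pay x t \<omega>"
  unfolding pay_def
  by (intro ennreal_leI mult_left_mono max.mono diff_left_mono mult_right_mono) (auto intro: less_imp_le)

lemma gain_antimono: "0 < x \<Longrightarrow> x \<le> y \<Longrightarrow> gain y \<theta> \<omega> \<le> gain x \<theta> \<omega>"
  unfolding gain_def by (auto intro!: add_mono run_antimono pay_antimono)

text \<open>The supremum runs over the stopping times of \<open>W\<close>, the same ones for every
  starting point, so an inequality for each rule passes to the value. Convexity is inherited in the
  same way.\<close>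

lemma V_antimono: "0 < x \<Longrightarrow> x \<le> y \<Longrightarrow> V y \<le> V x"
  unfolding V_def value_of_def
  by (intro SUP_mono' nn_integral_mono gain_antimono)

lemma run_convex:
  assumes "0 < x" "0 < y" "0 \<le> u" "u \<le> 1" and [measurable]: "A \<in> sets borel"
    and nonneg: "\<And>t. t \<in> A \<Longrightarrow> 0 \<le> t" and \<omega>: "\<omega> \<in> space M"
  shows "run ((1 - u) * x + u * y) A \<omega> \<le> ennreal (1 - u) * run x A \<omega> + ennreal u * run y A \<omega>"
proof -
  note m = run_section_measurable[OF assms(5) nonneg \<omega>]
  have "run ((1 - u) * x + u * y) A \<omega> \<le> (\<integral>\<^sup>+t. ennreal (1 - u) * (k (x * H t \<omega>) t * indicator A t)
      + ennreal u * (k (y * H t \<omega>) t * indicator A t) \<partial>lborel)"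
    unfolding run_def
  proof (intro nn_integral_mono)
    fix t
    have "k (((1 - u) * x + u * y) * H t \<omega>) t = k ((1 - u) * (x * H t \<omega>) + u * (y * H t \<omega>)) t"
      by (simp add: algebra_simps)
    also have "\<dots> \<le> ennreal (1 - u) * k (x * H t \<omega>) t + ennreal u * k (y * H t \<omega>) t"
      using assms by (intro k_convex) auto
    finally show "k (((1 - u) * x + u * y) * H t \<omega>) t * indicator A t
       \<le> ennreal (1 - u) * (k (x * H t \<omega>) t * indicator A t) + ennreal u * (k (y * H t \<omega>) t * indicator A t)"
      by (auto simp: indicator_def)
  qed
  also have "\<dots> = ennreal (1 - u) * run x A \<omega> + ennreal u * run y A \<omega>"
    unfolding run_def using m by (simp add: nn_integral_add nn_integral_cmult)
  finally show ?thesis .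
qed

lemma pay_convex:
  assumes "0 \<le> u" "u \<le> 1"
  shows "pay ((1 - u) * x + u * y) t \<omega> \<le> ennreal (1 - u) * pay x t \<omega> + ennreal u * pay y t \<omega>"
proof -
  have "max 0 (K - ((1 - u) * x + u * y) * H t \<omega>)
      = max 0 ((1 - u) * (K - x * H t \<omega>) + u * (K - y * H t \<omega>))"
    by (simp add: algebra_simps)
  also have "\<dots> \<le> (1 - u) * max 0 (K - x * H t \<omega>) + u * max 0 (K - y * H t \<omega>)"
    using assms by (intro max.boundedI add_mono mult_left_mono add_nonneg_nonneg mult_nonneg_nonneg) auto
  finally have "exp (- rho * t) * max 0 (K - ((1 - u) * x + u * y) * H t \<omega>)
     \<le> exp (- rho * t) * ((1 - u) * max 0 (K - x * H t \<omega>) + u * max 0 (K - y * H t \<omega>))"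
    by (intro mult_left_mono) auto
  then have "pay ((1 - u) * x + u * y) t \<omega>
     \<le> ennreal ((1 - u) * (exp (- rho * t) * max 0 (K - x * H t \<omega>))
         + u * (exp (- rho * t) * max 0 (K - y * H t \<omega>)))"
    unfolding pay_def by (intro ennreal_leI) (simp add: algebra_simps)
  also have "\<dots> = ennreal (1 - u) * pay x t \<omega> + ennreal u * pay y t \<omega>"
    unfolding pay_def using assms by (simp add: ennreal_plus ennreal_mult)
  finally show ?thesis .
qed

lemma gain_convex:
  assumes "0 < x" "0 < y" "0 \<le> u" "u \<le> 1" and \<omega>: "\<omega> \<in> space M"
  shows "gain ((1 - u) * x + u * y) \<theta> \<omega> \<le> ennreal (1 - u) * gain x \<theta> \<omega> + ennreal u * gain y \<theta> \<omega>"
proof -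
  have "{t. 0 \<le> t \<and> ennreal t \<le> \<theta>} \<in> sets borel" by measurable
  from run_convex[OF assms(1-4) this _ \<omega>] pay_convex[OF assms(3,4), of x y "enn2real \<theta>" \<omega>]
  show ?thesis unfolding gain_def
    by (auto simp: distrib_left ac_simps intro: order_trans[OF add_mono])
qed

lemma V_convex:
  assumes "0 < x" "0 < y" "0 \<le> u" "u \<le> 1"
  shows "V ((1 - u) * x + u * y) \<le> ennreal (1 - u) * V x + ennreal u * V y"
  unfolding V_def[of "(1 - u) * x + u * y"]
proof (rule SUP_least)
  fix \<tau> assume \<tau>: "\<tau> \<in> stopping_times M W T"
  have [measurable]: "(\<lambda>\<omega>. gain z (\<tau> \<omega>) \<omega>) \<in> borel_measurable M" for z
    by (rule gain_measurable[OF stopping_time_measurable[OF \<tau>]])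
  have "value_of ((1 - u) * x + u * y) \<tau>
      \<le> (\<integral>\<^sup>+\<omega>. ennreal (1 - u) * gain x (\<tau> \<omega>) \<omega> + ennreal u * gain y (\<tau> \<omega>) \<omega> \<partial>M)"
    unfolding value_of_def by (intro nn_integral_mono gain_convex assms)
  also have "\<dots> = ennreal (1 - u) * value_of x \<tau> + ennreal u * value_of y \<tau>"
    unfolding value_of_def by (simp add: nn_integral_add nn_integral_cmult)
  also have "\<dots> \<le> ennreal (1 - u) * V x + ennreal u * V y"
    using \<tau> by (intro add_mono mult_left_mono value_le_V) auto
  finally show "value_of ((1 - u) * x + u * y) \<tau> \<le> ennreal (1 - u) * V x + ennreal u * V y" .
qed

subsection \<open>Reduction to finitely many exercise dates\<close>

lemma nn_integral_H_step:
  assumes s: "0 \<le> s" "s \<le> t" and B: "B \<in> sets (F s)"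
  shows "(\<integral>\<^sup>+\<omega>. indicator B \<omega> * ennreal (H t \<omega>) \<partial>M)
       = ennreal (exp (mu * (t - s))) * (\<integral>\<^sup>+\<omega>. indicator B \<omega> * ennreal (H s \<omega>) \<partial>M)"
proof (cases "s = t")
  case False
  then have st: "s < t" using s by simp
  let ?n = "\<lambda>z. ennreal (normal_density 0 (sqrt (t - s)) z)"
  let ?e = "\<lambda>z. ennreal (exp (vol * z - vol\<^sup>2 * (t - s) / 2))"
  have [measurable]: "B \<in> sets (F s)" by fact
  have [measurable]: "H s \<in> borel_measurable (F s)" using s by (intro H_measurable_F) auto
  have BM: "B \<in> sets M" using B sets_F_subset by blast
  have HM [measurable]: "H s \<in> borel_measurable M" using s by (intro H_measurable) auto
  \<comment> \<open>The last factor is independent of \<open>F s\<close> and has mean 1 by the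
    normal tilt with \<open>g\<close> equal to 1. What results is the martingale property of
    \<open>exp (- mu * t) * H t\<close>, tested on events of \<open>F s\<close>.\<close>
  have "H t \<omega> = exp (mu * (t - s)) * H s \<omega> * exp (vol * (W t \<omega> - W s \<omega>) - vol\<^sup>2 * (t - s) / 2)" for \<omega>
    by (simp add: H_def exp_add[symmetric] algebra_simps diff_divide_distrib)
  then have "(\<integral>\<^sup>+\<omega>. indicator B \<omega> * ennreal (H t \<omega>) \<partial>M)
      = (\<integral>\<^sup>+\<omega>. (\<lambda>(\<omega>, z). indicator B \<omega> * ennreal (exp (mu * (t - s)) * H s \<omega>) * ?e z)
          (\<omega>, W t \<omega> - W s \<omega>) \<partial>M)"
    by (simp add: ennreal_mult mult.assoc less_imp_le)
  also have "\<dots> = (\<integral>\<^sup>+\<omega>. \<integral>\<^sup>+z. ?n z * (indicator B \<omega> * ennreal (exp (mu * (t - s)) * H s \<omega>) * ?e z) \<partial>lborel \<partial>M)"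
    by (subst nn_integral_increment[OF s(1) st]) auto
  also have "\<dots> = (\<integral>\<^sup>+\<omega>. indicator B \<omega> * ennreal (exp (mu * (t - s)) * H s \<omega>) \<partial>M)"
  proof (rule nn_integral_cong)
    fix \<omega>
    have "(\<integral>\<^sup>+z. ?n z * (?e z * 1) \<partial>lborel) = (\<integral>\<^sup>+z. ?n z * 1 \<partial>lborel)"
      using st by (intro nn_integral_normal_tilt) auto
    also have "\<dots> = 1"
      using st by (simp add: nn_integral_eq_integral integral_normal_density integrable_normal_density)
    finally have 1: "(\<integral>\<^sup>+z. ?n z * ?e z \<partial>lborel) = 1" by simp
    have "(\<integral>\<^sup>+z. ?n z * (indicator B \<omega> * ennreal (exp (mu * (t - s)) * H s \<omega>) * ?e z) \<partial>lborel)
       = (\<integral>\<^sup>+z. (indicator B \<omega> * ennreal (exp (mu * (t - s)) * H s \<omega>)) * (?n z * ?e z) \<partial>lborel)"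
      by (intro nn_integral_cong) (simp add: ac_simps)
    also have "\<dots> = indicator B \<omega> * ennreal (exp (mu * (t - s)) * H s \<omega>)"
      by (subst nn_integral_cmult) (auto simp: 1)
    finally show "(\<integral>\<^sup>+z. ?n z * (indicator B \<omega> * ennreal (exp (mu * (t - s)) * H s \<omega>) * ?e z) \<partial>lborel)
       = indicator B \<omega> * ennreal (exp (mu * (t - s)) * H s \<omega>)" .
  qed
  also have "\<dots> = (\<integral>\<^sup>+\<omega>. ennreal (exp (mu * (t - s))) * (indicator B \<omega> * ennreal (H s \<omega>)) \<partial>M)"
    by (intro nn_integral_cong) (simp add: ennreal_mult less_imp_le ac_simps)
  also have "\<dots> = ennreal (exp (mu * (t - s))) * (\<integral>\<^sup>+\<omega>. indicator B \<omega> * ennreal (H s \<omega>) \<partial>M)"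
    by (intro nn_integral_cmult borel_measurable_times_ennreal borel_measurable_indicator BM
        measurable_compose[OF HM measurable_ennreal])
  finally show ?thesis .
qed simp

lemma integrable_H: "0 \<le> t \<Longrightarrow> integrable M (H t)"
  and integral_H: "0 \<le> t \<Longrightarrow> (\<integral>\<omega>. H t \<omega> \<partial>M) = exp (mu * t)"
proof -
  assume t: "0 \<le> t"
  have *: "H t = (\<lambda>\<omega>. exp ((mu - vol\<^sup>2 / 2) * t) * exp (vol * W t \<omega>))"
    by (simp add: H_def[abs_def] exp_add)
  show "integrable M (H t)" unfolding * using integrable_exp_W[OF t] by simp
  have "(\<integral>\<omega>. H t \<omega> \<partial>M) = exp ((mu - vol\<^sup>2 / 2) * t) * exp (vol\<^sup>2 * t / 2)"
    unfolding * by (simp add: integral_exp_W[OF t])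
  then show "(\<integral>\<omega>. H t \<omega> \<partial>M) = exp (mu * t)"
    by (simp add: exp_add[symmetric] algebra_simps)
qed

lemma H_square:
  assumes t: "0 \<le> t"
  shows "integrable M (\<lambda>\<omega>. (H t \<omega>)\<^sup>2)"
    and "(\<integral>\<omega>. (H t \<omega>)\<^sup>2 \<partial>M) = exp ((2 * mu + vol\<^sup>2) * t)"
proof -
  have *: "(\<lambda>\<omega>. (H t \<omega>)\<^sup>2) = (\<lambda>\<omega>. exp (2 * ((mu - vol\<^sup>2 / 2) * t)) * exp ((2 * vol) * W t \<omega>))"
    by (simp add: H_def[abs_def] exp_add[symmetric] exp_double[symmetric] algebra_simps)
  show "integrable M (\<lambda>\<omega>. (H t \<omega>)\<^sup>2)" unfolding * using integrable_exp_W[OF t] by simp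
  have "(\<integral>\<omega>. (H t \<omega>)\<^sup>2 \<partial>M) = exp (2 * ((mu - vol\<^sup>2 / 2) * t)) * exp ((2 * vol)\<^sup>2 * t / 2)"
    unfolding * by (simp only: integral_mult_right_zero integral_exp_W[OF t])
  then show "(\<integral>\<omega>. (H t \<omega>)\<^sup>2 \<partial>M) = exp ((2 * mu + vol\<^sup>2) * t)"
    by (simp add: exp_add[symmetric] algebra_simps power2_eq_square)
qed

text \<open>Optional stopping: the only loss from waiting is the interest on the strike, because
  \<open>exp (- rho * t) * H t\<close> is a supermartingale.\<close>

lemma pay_wait:
  assumes s: "0 \<le> s" "s \<le> t" and B: "B \<in> sets (F s)" and x: "0 < x"
  shows "(\<integral>\<^sup>+\<omega>. indicator B \<omega> * pay x s \<omega> \<partial>M)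
    \<le> (\<integral>\<^sup>+\<omega>. indicator B \<omega> * pay x t \<omega> \<partial>M) + ennreal (rho * K * t) * emeasure M B"
proof -
  have t: "0 \<le> t" using s by simp
  have [measurable]: "H s \<in> borel_measurable (F s)" "B \<in> sets (F s)"
    using s B by (auto intro!: H_measurable_F)
  have BM [measurable]: "B \<in> sets M" using B sets_F_subset by blast
  have [measurable]: "H s \<in> borel_measurable M" "H t \<in> borel_measurable M"
    "pay x s \<in> borel_measurable M" "pay x t \<in> borel_measurable M"
    using s t by (auto intro: H_measurable pay_measurable)
  \<comment> \<open>The rest of \<open>B\<close> may be dropped: there the put is worthless at time
    \<open>s\<close> and waiting loses nothing.\<close>
  define B' where "B' = B \<inter> {\<omega> \<in> space M. x * H s \<omega> < K}"
  have "{\<omega> \<in> space (F s). x * H s \<omega> < K} \<in> sets (F s)" by measurable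
  then have B': "B' \<in> sets (F s)" unfolding B'_def using B by auto
  then have B'M [measurable]: "B' \<in> sets M" using sets_F_subset by blast
  have B'B: "B' \<subseteq> B" by (auto simp: B'_def)
  \<comment> \<open>Discounted stock is added to the put on both sides. In the money at
    \<open>s\<close> the sum is the discounted strike; at \<open>t\<close> it is at least the
    discounted strike. Adding avoids subtraction in \<open>ennreal\<close>, and the stock is
    cancelled at the end, for which its mean at \<open>s\<close> has to be finite.\<close>
  let ?h = "\<lambda>u \<omega>. indicator B' \<omega> * ennreal (exp (- rho * u) * x * H u \<omega>)"
  have h_eq: "(\<integral>\<^sup>+\<omega>. ?h u \<omega> \<partial>M) = ennreal (exp (- rho * u) * x) * (\<integral>\<^sup>+\<omega>. indicator B' \<omega> * ennreal (H u \<omega>) \<partial>M)"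
    if "H u \<in> borel_measurable M" for u
  proof -
    have "(\<integral>\<^sup>+\<omega>. ?h u \<omega> \<partial>M) = (\<integral>\<^sup>+\<omega>. ennreal (exp (- rho * u) * x) * (indicator B' \<omega> * ennreal (H u \<omega>)) \<partial>M)"
      using x by (intro nn_integral_cong) (simp add: ennreal_mult less_imp_le ac_simps)
    then show ?thesis using that by (simp add: nn_integral_cmult)
  qed
  have hs_fin: "(\<integral>\<^sup>+\<omega>. ?h s \<omega> \<partial>M) < \<infinity>"
  proof -
    have "(\<integral>\<^sup>+\<omega>. indicator B' \<omega> * ennreal (H s \<omega>) \<partial>M) \<le> (\<integral>\<^sup>+\<omega>. ennreal (H s \<omega>) \<partial>M)"
      by (intro nn_integral_mono) (auto simp: indicator_def)
    also have "\<dots> < \<infinity>"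
      using integrable_H[OF s(1)] by (subst nn_integral_eq_integral) (auto simp: less_imp_le)
    finally show ?thesis by (subst h_eq) (auto simp: ennreal_mult_less_top)
  qed
  have h_le: "(\<integral>\<^sup>+\<omega>. ?h t \<omega> \<partial>M) \<le> (\<integral>\<^sup>+\<omega>. ?h s \<omega> \<partial>M)"
  proof -
    have "exp (- rho * t) * x * exp (mu * (t - s)) = x * exp (- rho * t + mu * (t - s))"
      by (simp only: exp_add ac_simps)
    also have "\<dots> \<le> x * exp (- rho * s)"
      using mult_right_mono[OF mu_le, of "t - s"] s x by (simp add: algebra_simps)
    finally have le: "exp (- rho * t) * x * exp (mu * (t - s)) \<le> exp (- rho * s) * x"
      by (simp add: ac_simps)
    let ?I = "\<integral>\<^sup>+\<omega>. indicator B' \<omega> * ennreal (H s \<omega>) \<partial>M"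
    have "(\<integral>\<^sup>+\<omega>. ?h t \<omega> \<partial>M) = ennreal (exp (- rho * t) * x) * (ennreal (exp (mu * (t - s))) * ?I)"
      by (subst h_eq) (simp_all only: nn_integral_H_step[OF s B'], measurable)
    also have "\<dots> = ennreal (exp (- rho * t) * x * exp (mu * (t - s))) * ?I"
      using x by (simp only: mult.assoc[symmetric] ennreal_mult[symmetric] exp_ge_zero mult_nonneg_nonneg less_imp_le)
    also have "\<dots> \<le> ennreal (exp (- rho * s) * x) * ?I"
      using le by (intro mult_right_mono ennreal_leI) auto
    also have "\<dots> = (\<integral>\<^sup>+\<omega>. ?h s \<omega> \<partial>M)"
      by (subst h_eq) (simp_all, measurable)
    finally show ?thesis .
  qed
  have "(\<integral>\<^sup>+\<omega>. indicator B \<omega> * pay x s \<omega> \<partial>M) + (\<integral>\<^sup>+\<omega>. ?h s \<omega> \<partial>M)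
      = (\<integral>\<^sup>+\<omega>. indicator B \<omega> * pay x s \<omega> + ?h s \<omega> \<partial>M)"
    by (intro nn_integral_add[symmetric]) measurable
  also have "\<dots> \<le> (\<integral>\<^sup>+\<omega>. indicator B \<omega> * pay x t \<omega> + ?h t \<omega> + ennreal (rho * K * t) * indicator B \<omega> \<partial>M)"
  proof (intro nn_integral_mono)
    fix \<omega> assume \<omega>: "\<omega> \<in> space M"
    show "indicator B \<omega> * pay x s \<omega> + ?h s \<omega>
      \<le> indicator B \<omega> * pay x t \<omega> + ?h t \<omega> + ennreal (rho * K * t) * indicator B \<omega>"
    proof (cases "\<omega> \<in> B'")
      case True
      then have "\<omega> \<in> B" "x * H s \<omega> < K" by (auto simp: B'_def)
      have "exp (- rho * s) * max 0 (K - x * H s \<omega>) + exp (- rho * s) * x * H s \<omega> = exp (- rho * s) * K"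
        using \<open>x * H s \<omega> < K\<close> by (simp add: max_def algebra_simps)
      also have "\<dots> \<le> K"
        using s(1) rho_pos K_pos by (simp add: mult_le_cancel_right1)
      \<comment> \<open>Since \<open>1 - rho * t \<le> exp (- rho * t)\<close>, the interest lost on
        the strike is at most \<open>rho * K * t\<close>.\<close>
      also have "\<dots> \<le> exp (- rho * t) * K + rho * K * t"
        using mult_right_mono[OF exp_ge_add_one_self[of "- rho * t"], of K] K_pos by (simp add: algebra_simps)
      also have "exp (- rho * t) * K \<le> exp (- rho * t) * max 0 (K - x * H t \<omega>) + exp (- rho * t) * x * H t \<omega>"
        by (simp add: max_def algebra_simps mult_left_mono)
      finally have "exp (- rho * s) * max 0 (K - x * H s \<omega>) + exp (- rho * s) * x * H s \<omega>
         \<le> exp (- rho * t) * max 0 (K - x * H t \<omega>) + exp (- rho * t) * x * H t \<omega> + rho * K * t"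
        by simp
      then have "ennreal (exp (- rho * s) * max 0 (K - x * H s \<omega>) + exp (- rho * s) * x * H s \<omega>)
         \<le> ennreal (exp (- rho * t) * max 0 (K - x * H t \<omega>) + exp (- rho * t) * x * H t \<omega> + rho * K * t)"
        by (rule ennreal_leI)
      then show ?thesis using True \<open>\<omega> \<in> B\<close> x t rho_pos K_pos
        by (simp add: pay_def ennreal_plus less_imp_le)
    next
      case False
      then have z: "indicator B \<omega> * pay x s \<omega> = 0"
        using \<omega> by (auto simp: B'_def pay_def indicator_def max_def)
      show ?thesis unfolding z using False by simp
    qed
  qed
  also have "\<dots> = (\<integral>\<^sup>+\<omega>. indicator B \<omega> * pay x t \<omega> \<partial>M) + (\<integral>\<^sup>+\<omega>. ?h t \<omega> \<partial>M) + ennreal (rho * K * t) * emeasure M B"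
    by (simp add: nn_integral_add nn_integral_cmult)
  also have "\<dots> \<le> (\<integral>\<^sup>+\<omega>. indicator B \<omega> * pay x t \<omega> \<partial>M) + (\<integral>\<^sup>+\<omega>. ?h s \<omega> \<partial>M) + ennreal (rho * K * t) * emeasure M B"
    using h_le by (intro add_mono) auto
  finally have "(\<integral>\<^sup>+\<omega>. ?h s \<omega> \<partial>M) + (\<integral>\<^sup>+\<omega>. indicator B \<omega> * pay x s \<omega> \<partial>M)
     \<le> (\<integral>\<^sup>+\<omega>. ?h s \<omega> \<partial>M) + ((\<integral>\<^sup>+\<omega>. indicator B \<omega> * pay x t \<omega> \<partial>M) + ennreal (rho * K * t) * emeasure M B)"
    by (simp add: ac_simps)
  then show ?thesis
    unfolding ennreal_add_left_cancel_le using hs_fin by (metis less_irrefl)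
qed

text \<open>A finitely valued stopping time is coded as \<open>u (\<kappa> \<omega>)\<close>, with \<open>u\<close> listing its values in
  increasing order. Monotonicity is what allows the index \<open>\<kappa>\<close> to be lifted to path space.\<close>

definition simple_rule :: "nat \<Rightarrow> (nat \<Rightarrow> real) \<Rightarrow> ('w \<Rightarrow> nat) \<Rightarrow> bool" where
  "simple_rule m u \<kappa> \<longleftrightarrow> (\<forall>\<omega>\<in>space M. \<kappa> \<omega> \<le> m) \<and>
     (\<forall>i\<le>m. \<forall>j\<le>i. u j \<le> u i) \<and>
     (\<forall>i\<le>m. 0 \<le> u i \<and> ennreal (u i) \<le> T \<and> {\<omega> \<in> space M. \<kappa> \<omega> = i} \<in> sets (F (u i)))"

lemma simple_rule_stopping:
  assumes r: "simple_rule m u \<kappa>"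
  shows "(\<lambda>\<omega>. ennreal (u (\<kappa> \<omega>))) \<in> stopping_times M W T"
  unfolding stopping_times_def
proof (intro CollectI conjI ballI stopping_timeI)
  fix s
  have "{\<omega> \<in> space M. ennreal (u (\<kappa> \<omega>)) \<le> s} = (\<Union>i\<in>{i. i \<le> m \<and> ennreal (u i) \<le> s}. {\<omega> \<in> space M. \<kappa> \<omega> = i})"
    using r by (auto simp: simple_rule_def)
  also have "\<dots> \<in> sets (natural_filtration M W s)"
  proof (intro sets.finite_UN)
    fix i assume "i \<in> {i. i \<le> m \<and> ennreal (u i) \<le> s}"
    then show "{\<omega> \<in> space M. \<kappa> \<omega> = i} \<in> sets (natural_filtration M W s)"
      using r sets_natural_filtration_mono[of "ennreal (u i)" s M W] by (auto simp: simple_rule_def)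
  qed auto
  finally show "Measurable.pred (natural_filtration M W s) (\<lambda>\<omega>. ennreal (u (\<kappa> \<omega>)) \<le> s)"
    by (simp add: Measurable.pred_def)
qed (use r in \<open>auto simp: simple_rule_def\<close>)

lemma simple_rule_measurable:
  assumes r: "simple_rule m u \<kappa>"
  shows "\<kappa> \<in> M \<rightarrow>\<^sub>M count_space UNIV"
proof (rule measurable_count_space_eq_countable[THEN iffD2])
  have "{\<omega> \<in> space M. \<kappa> \<omega> = i} \<in> sets M" for i
  proof (cases "i \<le> m")
    case True
    then have "{\<omega> \<in> space M. \<kappa> \<omega> = i} \<in> sets (F (u i))" using r by (simp add: simple_rule_def)
    then show ?thesis using sets_F_subset by blast
  next
    case False
    then have "{\<omega> \<in> space M. \<kappa> \<omega> = i} = {}" using r by (auto simp: simple_rule_def)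
    then show ?thesis by (simp only: sets.empty_sets)
  qed
  moreover have "\<kappa> -` {i} \<inter> space M = {\<omega> \<in> space M. \<kappa> \<omega> = i}" for i by auto
  ultimately show "\<kappa> \<in> space M \<rightarrow> UNIV \<and> (\<forall>a\<in>UNIV. \<kappa> -` {a} \<inter> space M \<in> sets M)" by simp
qed simp

text \<open>\<open>\<tau>\<close> is rounded up to the grid of mesh \<open>1 / real (Suc n)\<close>,
  capped by the horizon \<open>T\<close> and by the last date \<open>Suc n\<close>. Rounding up
  keeps it a stopping time, and the cap at \<open>T\<close> keeps it admissible.\<close>

lemma discretisation:
  assumes \<tau>: "\<tau> \<in> stopping_times M W T"
  obtains m u \<kappa> where "\<And>n::nat. simple_rule (m n) (u n) (\<kappa> n)"
    and "\<And>\<omega> n. \<omega> \<in> space M \<Longrightarrow> \<tau> \<omega> \<le> ennreal (real n) \<Longrightarrow>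
       \<tau> \<omega> \<le> ennreal (u n (\<kappa> n \<omega>)) \<and> u n (\<kappa> n \<omega>) \<le> enn2real (\<tau> \<omega>) + 1 / real (Suc n)"
    and "\<And>\<omega> n. \<omega> \<in> space M \<Longrightarrow> \<tau> \<omega> = \<infinity> \<Longrightarrow> u n (\<kappa> n \<omega>) = real (Suc n)"
proof
  \<comment> \<open>That many steps of length \<open>1 / real (Suc n)\<close> reach time
    \<open>Suc n\<close>, beyond every value of \<open>\<tau>\<close> that is at most
    \<open>n\<close>.\<close>
  define m :: "nat \<Rightarrow> nat" where "m n = Suc n * Suc n" for n
  define u :: "nat \<Rightarrow> nat \<Rightarrow> real" where "u n i = enn2real (min T (ennreal (real i / real (Suc n))))" for n i
  \<comment> \<open>The clause \<open>i = m n\<close> stops at the last date wherever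
    \<open>\<tau>\<close> has not occurred by then, in particular where it is infinite.\<close>
  define \<kappa> :: "nat \<Rightarrow> 'w \<Rightarrow> nat" where "\<kappa> n \<omega> = (LEAST i. i = m n \<or> \<tau> \<omega> \<le> ennreal (u n i))" for n \<omega>
  have eu: "ennreal (u n i) = min T (ennreal (real i / real (Suc n)))" for n i
    unfolding u_def by (rule ennreal_enn2real) (simp add: min_less_iff_disj)
  have u0: "0 \<le> u n i" for n i by (simp add: u_def)
  have uT: "ennreal (u n i) \<le> T" for n i unfolding eu by simp
  have \<tau>T: "\<tau> \<omega> \<le> T" if "\<omega> \<in> space M" for \<omega> using \<tau> that by (simp add: stopping_times_def)
  have umono: "ennreal (u n i) \<le> ennreal (u n j)" if "i \<le> j" for n i j
    unfolding eu using that by (intro min.mono ennreal_leI divide_right_mono) auto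
  have \<kappa>I: "\<kappa> n \<omega> = m n \<or> \<tau> \<omega> \<le> ennreal (u n (\<kappa> n \<omega>))" for n \<omega>
    unfolding \<kappa>_def by (rule LeastI[of _ "m n"]) simp
  have \<kappa>le: "\<kappa> n \<omega> \<le> m n" for n \<omega> unfolding \<kappa>_def by (rule Least_le) simp
  have \<kappa>D: "\<not> \<tau> \<omega> \<le> ennreal (u n j)" if "j < \<kappa> n \<omega>" for n \<omega> j
    using not_less_Least[of j "\<lambda>i. i = m n \<or> \<tau> \<omega> \<le> ennreal (u n i)"] that unfolding \<kappa>_def by blast
  show "simple_rule (m n) (u n) (\<kappa> n)" for n
    unfolding simple_rule_def
  proof (intro conjI allI impI ballI)
    fix i assume i: "i \<le> m n"
    have st: "{\<omega> \<in> space M. \<tau> \<omega> \<le> ennreal (u n j)} \<in> sets (F (u n i))" if "j \<le> i" for j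
    proof -
      have "{\<omega> \<in> space M. \<tau> \<omega> \<le> ennreal (u n j)} \<in> sets (F (u n j))"
        using stopping_timeD[of "natural_filtration M W" \<tau> "ennreal (u n j)"] \<tau>
        by (simp add: stopping_times_def Measurable.pred_def)
      then show ?thesis using sets_natural_filtration_mono[OF umono[OF that]] by blast
    qed
    have "\<kappa> n \<omega> = i \<longleftrightarrow> (i = m n \<or> \<tau> \<omega> \<le> ennreal (u n i)) \<and> (\<forall>j<i. \<not> \<tau> \<omega> \<le> ennreal (u n j))" for \<omega>
    proof
      assume "\<kappa> n \<omega> = i"
      then show "(i = m n \<or> \<tau> \<omega> \<le> ennreal (u n i)) \<and> (\<forall>j<i. \<not> \<tau> \<omega> \<le> ennreal (u n j))"
        using \<kappa>I[of n \<omega>] \<kappa>D[of _ n \<omega>] by auto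
    next
      assume *: "(i = m n \<or> \<tau> \<omega> \<le> ennreal (u n i)) \<and> (\<forall>j<i. \<not> \<tau> \<omega> \<le> ennreal (u n j))"
      show "\<kappa> n \<omega> = i"
        unfolding \<kappa>_def using * i by (intro Least_equality) (auto simp: not_less[symmetric])
    qed
    then have "{\<omega> \<in> space M. \<kappa> n \<omega> = i} = (if i = m n then space M else {\<omega> \<in> space M. \<tau> \<omega> \<le> ennreal (u n i)})
        - (\<Union>j\<in>{..<i}. {\<omega> \<in> space M. \<tau> \<omega> \<le> ennreal (u n j)})"
      by auto
    also have "\<dots> \<in> sets (F (u n i))"
      using st sets.top[of "F (u n i)"] by (intro sets.Diff sets.finite_UN) auto
    finally show "{\<omega> \<in> space M. \<kappa> n \<omega> = i} \<in> sets (F (u n i))" .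
  next
    fix i j :: nat assume "j \<le> i"
    then show "u n j \<le> u n i" using umono[of j i n] u0 by simp
  qed (auto simp: u0 uT \<kappa>le)
  have um: "ennreal (u n (m n)) = min T (ennreal (real (Suc n)))" for n
  proof -
    have "real (m n) / real (Suc n) = real (Suc n)" by (simp only: m_def of_nat_mult) (simp del: of_nat_Suc)
    then show ?thesis unfolding eu by (simp only:)
  qed
  show "\<tau> \<omega> \<le> ennreal (u n (\<kappa> n \<omega>)) \<and> u n (\<kappa> n \<omega>) \<le> enn2real (\<tau> \<omega>) + 1 / real (Suc n)"
    if \<omega>: "\<omega> \<in> space M" and n: "\<tau> \<omega> \<le> ennreal (real n)" for \<omega> n
  proof
    have "\<tau> \<omega> \<le> ennreal (u n (m n))"
      unfolding um using \<tau>T[OF \<omega>] order_trans[OF n, of "ennreal (real (Suc n))"] by (simp add: ennreal_leI)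
    then show "\<tau> \<omega> \<le> ennreal (u n (\<kappa> n \<omega>))" using \<kappa>I[of n \<omega>] by auto
    have fin: "\<tau> \<omega> < \<infinity>" using n by (auto simp: top_unique less_top[symmetric])
    show "u n (\<kappa> n \<omega>) \<le> enn2real (\<tau> \<omega>) + 1 / real (Suc n)"
    proof (cases "\<kappa> n \<omega>")
      case 0
      have "u n 0 = 0" by (simp add: u_def)
      then show ?thesis by (simp add: 0)
    next
      case (Suc j)
      then have "ennreal (u n j) < \<tau> \<omega>" using \<kappa>D[of j n \<omega>] by simp
      then have "ennreal (real j / real (Suc n)) < \<tau> \<omega>"
        using \<tau>T[OF \<omega>] unfolding eu by (auto simp: min_less_iff_disj)
      then have j: "real j / real (Suc n) < enn2real (\<tau> \<omega>)"
        using fin by (metis divide_nonneg_nonneg enn2real_ennreal enn2real_less_iff ennreal_enn2real ennreal_less_iff infinity_ennreal_def of_nat_0_le_iff)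
      have "u n (Suc j) \<le> real (Suc j) / real (Suc n)"
        unfolding u_def by (rule enn2real_leI) (auto simp del: of_nat_Suc)
      also have "\<dots> = real j / real (Suc n) + 1 / real (Suc n)" by (simp add: add_divide_distrib)
      finally show ?thesis using j by (simp add: Suc)
    qed
  qed
  show "u n (\<kappa> n \<omega>) = real (Suc n)" if \<omega>: "\<omega> \<in> space M" and inf: "\<tau> \<omega> = \<infinity>" for \<omega> n
  proof -
    have T: "T = \<infinity>" using \<tau>T[OF \<omega>] inf by (simp add: top_unique)
    have "\<kappa> n \<omega> = m n" using \<kappa>I[of n \<omega>] inf by (simp add: top_unique)
    then show ?thesis using um[of n] T
      by (simp add: u_def m_def field_simps del: of_nat_Suc)
  qed
qed

lemma H_continuous: "\<omega> \<in> space M \<Longrightarrow> continuous_on {0..} (\<lambda>t. H t \<omega>)"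
  unfolding H_def[abs_def] by (intro continuous_intros W_paths)

text \<open>Fatou's lemma along the discretisations. Rounding up only lengthens the period of
  running reward, and the payoff converges by path continuity. Where \<open>\<tau>\<close> is
  infinite the payoff counts as 0, and the running rewards up to time \<open>Suc n\<close> exhaust
  the total.\<close>

lemma value_le_of_simple:
  assumes \<tau>: "\<tau> \<in> stopping_times M W T" and x: "0 < x"
    and C: "\<And>m u \<kappa>. simple_rule m u \<kappa> \<Longrightarrow> value_of x (\<lambda>\<omega>. ennreal (u (\<kappa> \<omega>))) \<le> C"
  shows "value_of x \<tau> \<le> C"
proof -
  obtain m u \<kappa> where r: "\<And>n::nat. simple_rule (m n) (u n) (\<kappa> n)"
    and fin: "\<And>\<omega> n. \<omega> \<in> space M \<Longrightarrow> \<tau> \<omega> \<le> ennreal (real n) \<Longrightarrow>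
       \<tau> \<omega> \<le> ennreal (u n (\<kappa> n \<omega>)) \<and> u n (\<kappa> n \<omega>) \<le> enn2real (\<tau> \<omega>) + 1 / real (Suc n)"
    and inf: "\<And>\<omega> n. \<omega> \<in> space M \<Longrightarrow> \<tau> \<omega> = \<infinity> \<Longrightarrow> u n (\<kappa> n \<omega>) = real (Suc n)"
    by (rule discretisation[OF \<tau>], rule that)
  let ?\<tau> = "\<lambda>n \<omega>. u n (\<kappa> n \<omega>)"
  have path: "gain x (\<tau> \<omega>) \<omega> \<le> liminf (\<lambda>n. gain x (ennreal (?\<tau> n \<omega>)) \<omega>)" if \<omega>: "\<omega> \<in> space M" for \<omega>
  proof (cases "\<tau> \<omega> = \<infinity>")
    case False
    then obtain N :: nat where N: "\<tau> \<omega> \<le> ennreal (real N)"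
      by (metis ennreal_of_nat_eq_real_of_nat infinity_ennreal_def less_imp_le ennreal_Ex_less_of_nat less_top)
    let ?s = "enn2real (\<tau> \<omega>)"
    have ev: "?s \<le> ?\<tau> n \<omega>" "?\<tau> n \<omega> \<le> ?s + 1 / real (Suc n)" "\<tau> \<omega> \<le> ennreal (?\<tau> n \<omega>)" if "N \<le> n" for n
    proof -
      have "\<tau> \<omega> \<le> ennreal (real n)" using N that by (auto intro: order_trans ennreal_leI)
      from fin[OF \<omega> this] show 1: "\<tau> \<omega> \<le> ennreal (?\<tau> n \<omega>)" and "?\<tau> n \<omega> \<le> ?s + 1 / real (Suc n)" by auto
      have "0 \<le> ?\<tau> n \<omega>" using r[of n] \<omega> by (auto simp: simple_rule_def)
      then show "?s \<le> ?\<tau> n \<omega>" using 1 by (simp add: enn2real_leI)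
    qed
    have lim: "(\<lambda>n. ?\<tau> n \<omega>) \<longlonglongrightarrow> ?s"
    proof (rule tendsto_sandwich)
      show "\<forall>\<^sub>F n in sequentially. ?s \<le> ?\<tau> n \<omega>" "\<forall>\<^sub>F n in sequentially. ?\<tau> n \<omega> \<le> ?s + 1 / real (Suc n)"
        using ev by (auto simp: eventually_sequentially)
      show "(\<lambda>n. ?s + 1 / real (Suc n)) \<longlonglongrightarrow> ?s" by real_asymp
    qed simp
    have "(\<lambda>n. H (?\<tau> n \<omega>) \<omega>) \<longlonglongrightarrow> H ?s \<omega>"
      using ev(1) order_trans[OF enn2real_nonneg[of "\<tau> \<omega>"]]
      by (intro continuous_on_tendsto_compose[OF H_continuous[OF \<omega>] lim]) (auto simp: eventually_sequentially)
    then have "(\<lambda>n. pay x (?\<tau> n \<omega>) \<omega>) \<longlonglongrightarrow> pay x ?s \<omega>"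
      unfolding pay_def using lim by (intro tendsto_intros)
    then have "(\<lambda>n. run x {t. 0 \<le> t \<and> ennreal t \<le> \<tau> \<omega>} \<omega> + pay x (?\<tau> n \<omega>) \<omega>)
        \<longlonglongrightarrow> run x {t. 0 \<le> t \<and> ennreal t \<le> \<tau> \<omega>} \<omega> + pay x ?s \<omega>"
      by (intro tendsto_add tendsto_const)
    from lim_imp_Liminf[OF _ this]
    have "gain x (\<tau> \<omega>) \<omega> = liminf (\<lambda>n. run x {t. 0 \<le> t \<and> ennreal t \<le> \<tau> \<omega>} \<omega> + pay x (?\<tau> n \<omega>) \<omega>)"
      using False by (simp add: gain_def)
    also have "\<dots> \<le> liminf (\<lambda>n. gain x (ennreal (?\<tau> n \<omega>)) \<omega>)"
    proof (rule Liminf_mono, rule eventually_sequentiallyI[of N])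
      fix n assume n: "N \<le> n"
      have "0 \<le> ?\<tau> n \<omega>" using r[of n] \<omega> by (auto simp: simple_rule_def)
      then show "run x {t. 0 \<le> t \<and> ennreal t \<le> \<tau> \<omega>} \<omega> + pay x (?\<tau> n \<omega>) \<omega> \<le> gain x (ennreal (?\<tau> n \<omega>)) \<omega>"
      proof -
        have "{t. 0 \<le> t \<and> ennreal t \<le> \<tau> \<omega>} \<subseteq> {t. 0 \<le> t \<and> ennreal t \<le> ennreal (?\<tau> n \<omega>)}"
          using ev(3)[OF n] by (blast intro: order_trans)
        then show ?thesis
          using \<open>0 \<le> ?\<tau> n \<omega>\<close> unfolding gain_def by (auto intro!: add_mono run_mono)
      qed
    qed
    finally show ?thesis .
  next
    case True
    let ?g = "\<lambda>t. k (x * H t \<omega>) t"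
    have m: "(\<lambda>t. ?g t * indicator {0..a} t) \<in> borel_measurable lborel" for a
      using \<omega> by (intro run_section_measurable) auto
    have "gain x (\<tau> \<omega>) \<omega> = (\<integral>\<^sup>+t. ?g t * indicator {0..} t \<partial>lborel)"
      using True by (simp add: gain_def run_def atLeast_def)
    also have "\<dots> \<le> (\<integral>\<^sup>+t. liminf (\<lambda>n. ?g t * indicator {0..real (Suc n)} t) \<partial>lborel)"
    proof (intro nn_integral_mono)
      fix t :: real
      obtain N :: nat where "t \<le> real N" using real_arch_simple by blast
      then have "\<forall>\<^sub>F n in sequentially. ?g t * indicator {0..} t \<le> ?g t * indicator {0..real (Suc n)} t"
        by (intro eventually_sequentiallyI[of N]) (auto simp: indicator_def)
      then show "?g t * indicator {0..} t \<le> liminf (\<lambda>n. ?g t * indicator {0..real (Suc n)} t)"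
        by (rule Liminf_bounded)
    qed
    also have "\<dots> \<le> liminf (\<lambda>n. \<integral>\<^sup>+t. ?g t * indicator {0..real (Suc n)} t \<partial>lborel)"
      by (rule nn_integral_liminf[OF m])
    also have "\<dots> \<le> liminf (\<lambda>n. gain x (ennreal (?\<tau> n \<omega>)) \<omega>)"
    proof (intro Liminf_mono always_eventually allI)
      fix n
      have "{0..real (Suc n)} = {t. 0 \<le> t \<and> ennreal t \<le> ennreal (?\<tau> n \<omega>)}"
        unfolding inf[OF \<omega> True] by (auto simp del: of_nat_Suc)
      then show "(\<integral>\<^sup>+t. ?g t * indicator {0..real (Suc n)} t \<partial>lborel) \<le> gain x (ennreal (?\<tau> n \<omega>)) \<omega>"
        unfolding gain_def run_def by simp
    qed
    finally show ?thesis .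
  qed
  have "value_of x \<tau> \<le> (\<integral>\<^sup>+\<omega>. liminf (\<lambda>n. gain x (ennreal (?\<tau> n \<omega>)) \<omega>) \<partial>M)"
    unfolding value_of_def by (intro nn_integral_mono path)
  also have "\<dots> \<le> liminf (\<lambda>n. value_of x (\<lambda>\<omega>. ennreal (?\<tau> n \<omega>)))"
    unfolding value_of_def
    by (intro nn_integral_liminf gain_measurable stopping_time_measurable simple_rule_stopping[OF r])
  also have "\<dots> \<le> liminf (\<lambda>n::nat. C)"
    using C[OF r] by (intro Liminf_mono always_eventually) auto
  also have "\<dots> = C" by (simp add: Liminf_const)
  finally show ?thesis .
qed

end

subsection \<open>Smooth fit\<close>

context wiener_process
begin

text \<open>Generators correspond under the path map, so the history of \<open>W\<close> is the
  preimage of the coordinate history. This allows a stopping rule to be rewritten as a function of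
  the path.\<close>

lemma natural_filtration_path:
  assumes B: "B \<in> sets (natural_filtration M W s)"
  shows "\<exists>A\<in>sets (natural_filtration path_space (\<lambda>u p. p u) s).
    B = {\<omega> \<in> space M. (\<lambda>u. W (max 0 u) \<omega>) \<in> A}"
proof -
  let ?\<Pi> = "\<lambda>\<omega> u. W (max 0 u) \<omega>"
  let ?GN = "{(\<lambda>p. p u) -` A \<inter> space path_space |u A. 0 \<le> u \<and> ennreal u \<le> s \<and> A \<in> sets borel}"
  let ?GM = "{W u -` A \<inter> space M |u A. 0 \<le> u \<and> ennreal u \<le> s \<and> A \<in> sets borel}"
  have sp: "space path_space = UNIV" by (simp add: space_PiM)
  have G: "?GM = {?\<Pi> -` A \<inter> space M |A. A \<in> ?GN}" (is "_ = ?R")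
  proof (intro set_eqI iffI)
    fix X assume "X \<in> ?GM"
    then obtain u A where X: "X = W u -` A \<inter> space M" "0 \<le> u" "ennreal u \<le> s" "A \<in> sets borel" by blast
    have "X = ?\<Pi> -` ((\<lambda>p. p u) -` A \<inter> space path_space) \<inter> space M"
      using X(1,2) by (auto simp: sp max_absorb2)
    then show "X \<in> ?R" using X by blast
  next
    fix X assume "X \<in> ?R"
    then obtain u A where X: "X = ?\<Pi> -` ((\<lambda>p. p u) -` A \<inter> space path_space) \<inter> space M"
      "0 \<le> u" "ennreal u \<le> s" "A \<in> sets borel" by blast
    then have "X = W u -` A \<inter> space M" by (auto simp: sp max_absorb2)
    then show "X \<in> ?GM" using X by blast
  qed
  have "B \<in> sigma_sets (space M) ?GM"
    using B unfolding natural_filtration_def by (subst (asm) sets_measure_of) auto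
  also have "sigma_sets (space M) ?GM = {?\<Pi> -` A \<inter> space M |A. A \<in> sigma_sets (space path_space) ?GN}"
    unfolding G by (intro sigma_sets_vimage_commute[symmetric]) (auto simp: sp)
  finally obtain A where "A \<in> sigma_sets (space path_space) ?GN" "B = ?\<Pi> -` A \<inter> space M" by blast
  moreover have "sigma_sets (space path_space) ?GN = sets (natural_filtration path_space (\<lambda>u p. p u) s)"
    unfolding natural_filtration_def by (subst sets_measure_of) auto
  ultimately show ?thesis by (intro bexI[of _ A]) auto
qed

end

text \<open>\<open>min (Z \<omega>) L\<close> is the integral over \<open>w\<close> in
  \<open>{0..<L}\<close> of the indicators of the level sets. The hypothesis is used at each level,
  and its error is integrated over an interval of length \<open>L\<close>.\<close>

lemma nn_integral_layer_cake:
  fixes Z :: "'a \<Rightarrow> real" and Q g :: "'a \<Rightarrow> ennreal"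
  assumes "sigma_finite_measure M"
    and [measurable]: "Z \<in> borel_measurable M" "Q \<in> borel_measurable M" "g \<in> borel_measurable M"
    and Z: "\<And>\<omega>. 0 \<le> Z \<omega>" and L: "0 \<le> L"
    and le: "\<And>w. 0 \<le> w \<Longrightarrow> (\<integral>\<^sup>+\<omega>. indicator {\<omega> \<in> space M. w < Z \<omega>} \<omega> * Q \<omega> \<partial>M)
       \<le> (\<integral>\<^sup>+\<omega>. indicator {\<omega> \<in> space M. w < Z \<omega>} \<omega> * g \<omega> \<partial>M) + \<eta>"
  shows "(\<integral>\<^sup>+\<omega>. ennreal (min (Z \<omega>) L) * Q \<omega> \<partial>M)
    \<le> (\<integral>\<^sup>+\<omega>. ennreal (min (Z \<omega>) L) * g \<omega> \<partial>M) + ennreal L * \<eta>"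
proof -
  interpret sigma_finite_measure M by fact
  interpret pair_sigma_finite M lborel by unfold_locales
  let ?i = "\<lambda>w \<omega>. indicator {\<omega> \<in> space M. w < Z \<omega>} \<omega> :: ennreal"
  have cake: "(\<integral>\<^sup>+\<omega>. ennreal (min (Z \<omega>) L) * R \<omega> \<partial>M)
     = (\<integral>\<^sup>+w. indicator {0..<L} w * (\<integral>\<^sup>+\<omega>. ?i w \<omega> * R \<omega> \<partial>M) \<partial>lborel)"
    if [measurable]: "R \<in> borel_measurable M" for R :: "'a \<Rightarrow> ennreal"
  proof -
    have "(\<integral>\<^sup>+\<omega>. ennreal (min (Z \<omega>) L) * R \<omega> \<partial>M)
       = (\<integral>\<^sup>+\<omega>. \<integral>\<^sup>+w. indicator {0..<min (Z \<omega>) L} w * R \<omega> \<partial>lborel \<partial>M)"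
      using Z L by (intro nn_integral_cong) (simp add: nn_integral_multc)
    also have "\<dots> = (\<integral>\<^sup>+w. \<integral>\<^sup>+\<omega>. indicator {0..<min (Z \<omega>) L} w * R \<omega> \<partial>M \<partial>lborel)"
    proof (rule Fubini'[symmetric])
      have "(\<lambda>p. if 0 \<le> snd p \<and> snd p < min (Z (fst p)) L then R (fst p) else 0)
          \<in> borel_measurable (M \<Otimes>\<^sub>M borel)"
        by measurable
      also have "(\<lambda>p. if 0 \<le> snd p \<and> snd p < min (Z (fst p)) L then R (fst p) else 0)
          = (\<lambda>(\<omega>, w). indicator {0..<min (Z \<omega>) L} w * R \<omega>)"
        by (auto simp: fun_eq_iff indicator_def)
      finally show "(\<lambda>(\<omega>, w). indicator {0..<min (Z \<omega>) L} w * R \<omega>) \<in> borel_measurable (M \<Otimes>\<^sub>M lborel)"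
        by (simp cong: measurable_cong_sets sets_pair_measure_cong)
    qed
    also have "\<dots> = (\<integral>\<^sup>+w. indicator {0..<L} w * (\<integral>\<^sup>+\<omega>. ?i w \<omega> * R \<omega> \<partial>M) \<partial>lborel)"
    proof (rule nn_integral_cong)
      fix w
      have "(\<integral>\<^sup>+\<omega>. indicator {0..<min (Z \<omega>) L} w * R \<omega> \<partial>M)
          = (\<integral>\<^sup>+\<omega>. indicator {0..<L} w * (?i w \<omega> * R \<omega>) \<partial>M)"
        by (intro nn_integral_cong) (auto simp: indicator_def)
      then show "(\<integral>\<^sup>+\<omega>. indicator {0..<min (Z \<omega>) L} w * R \<omega> \<partial>M)
          = indicator {0..<L} w * (\<integral>\<^sup>+\<omega>. ?i w \<omega> * R \<omega> \<partial>M)"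
        by (simp add: nn_integral_cmult)
    qed
    finally show ?thesis .
  qed
  have m: "(\<lambda>w. \<integral>\<^sup>+\<omega>. ?i w \<omega> * g \<omega> \<partial>M) \<in> borel_measurable lborel"
  proof -
    have "(\<lambda>w. \<integral>\<^sup>+\<omega>. (if w < Z \<omega> then g \<omega> else 0) \<partial>M) \<in> borel_measurable lborel" by measurable
    also have "(\<lambda>w. \<integral>\<^sup>+\<omega>. (if w < Z \<omega> then g \<omega> else 0) \<partial>M) = (\<lambda>w. \<integral>\<^sup>+\<omega>. ?i w \<omega> * g \<omega> \<partial>M)"
      by (intro ext nn_integral_cong) (auto simp: indicator_def)
    finally show ?thesis .
  qed
  have "(\<integral>\<^sup>+\<omega>. ennreal (min (Z \<omega>) L) * Q \<omega> \<partial>M)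
     \<le> (\<integral>\<^sup>+w. indicator {0..<L} w * (\<integral>\<^sup>+\<omega>. ?i w \<omega> * g \<omega> \<partial>M) + \<eta> * indicator {0..<L} w \<partial>lborel)"
    unfolding cake[OF assms(3)]
  proof (intro nn_integral_mono)
    fix w
    show "indicator {0..<L} w * (\<integral>\<^sup>+\<omega>. ?i w \<omega> * Q \<omega> \<partial>M)
        \<le> indicator {0..<L} w * (\<integral>\<^sup>+\<omega>. ?i w \<omega> * g \<omega> \<partial>M) + \<eta> * indicator {0..<L} w"
      using le[of w] by (cases "w \<in> {0..<L}") simp_all
  qed
  also have "\<dots> = (\<integral>\<^sup>+\<omega>. ennreal (min (Z \<omega>) L) * g \<omega> \<partial>M) + \<eta> * ennreal L"
    unfolding cake[OF assms(4)] using m L by (simp add: nn_integral_add nn_integral_cmult_indicator)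
  finally show ?thesis by (simp add: mult.commute)
qed

section \<open>Comparison of two starting points on one clock\<close>

context put_problem
begin

text \<open>Meant for \<open>t \<le> v\<close>; the half-open interval makes this the exact
  complement of the running reward on \<open>{0..t}\<close>. Only this part goes through
  Cameron--Martin, because after \<open>t\<close> the drift has produced its full shift.\<close>

definition later :: "real \<Rightarrow> real \<Rightarrow> real \<Rightarrow> 'w \<Rightarrow> ennreal" where
  "later x t v \<omega> = run x {t<..v} \<omega> + pay x v \<omega>"

lemma gain_ennreal: "0 \<le> v \<Longrightarrow> gain x (ennreal v) \<omega> = run x {0..v} \<omega> + pay x v \<omega>"
proof -
  assume v: "0 \<le> v"
  then have "{t. 0 \<le> t \<and> ennreal t \<le> ennreal v} = {0..v}" by auto
  then show ?thesis using v by (simp add: gain_def)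
qed

lemma run_split:
  assumes "0 \<le> t" "t \<le> v" and \<omega>: "\<omega> \<in> space M"
  shows "run x {0..v} \<omega> = run x {0..t} \<omega> + run x {t<..v} \<omega>"
proof -
  have "k (x * H s \<omega>) s * indicator {0..v} s
      = k (x * H s \<omega>) s * indicator {0..t} s + k (x * H s \<omega>) s * indicator {t<..v} s" for s
    using assms by (auto simp: indicator_def)
  then show ?thesis
    unfolding run_def using assms
    by (simp only:) (intro nn_integral_add run_section_measurable; auto)
qed

lemma run_interval_measurable [measurable]: "0 \<le> a \<Longrightarrow> (\<lambda>\<omega>. run x {a..b} \<omega>) \<in> borel_measurable M"
  by (rule run_measurable) auto

lemma later_measurable:
  assumes "simple_rule m u \<kappa>" and t: "0 \<le> t"
  shows "(\<lambda>\<omega>. later x t (max t (u (\<kappa> \<omega>))) \<omega>) \<in> borel_measurable M"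
proof -
  have [measurable]: "\<kappa> \<in> M \<rightarrow>\<^sub>M count_space UNIV" by (rule simple_rule_measurable) fact
  have [measurable]: "(\<lambda>\<omega>. run x {t<..max t (u (\<kappa> \<omega>))} \<omega>) \<in> borel_measurable M"
    using t by (intro run_measurable) auto
  have [measurable]: "(\<lambda>\<omega>. pay x (max t (u (\<kappa> \<omega>))) \<omega>) \<in> borel_measurable M"
    using t by (intro pay_random_time_measurable) auto
  show ?thesis unfolding later_def by measurable
qed

lemma simple_rule_max:
  assumes r: "simple_rule m u \<kappa>" and t: "ennreal t \<le> T"
  shows "simple_rule m (\<lambda>i. max t (u i)) \<kappa>"
  unfolding simple_rule_def
proof (intro conjI allI impI)
  fix i assume i: "i \<le> m"
  have "{\<omega> \<in> space M. \<kappa> \<omega> = i} \<in> sets (F (u i))" using r i by (auto simp: simple_rule_def)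
  then show "{\<omega> \<in> space M. \<kappa> \<omega> = i} \<in> sets (F (max t (u i)))"
    using sets_natural_filtration_mono[of "ennreal (u i)" "ennreal (max t (u i))" M W] ennreal_leI[of "u i" "max t (u i)"] by auto
  show "0 \<le> max t (u i)" "ennreal (max t (u i)) \<le> T"
    using r i t by (auto simp: simple_rule_def max_def)
qed (use r in \<open>auto simp: simple_rule_def max_def intro: order_trans\<close>)

text \<open>The waiting estimate is applied on each event where the rule names a given date before
  \<open>t\<close>; the losses are proportional to the probabilities of the events of the rule,
  which sum to 1.\<close>

lemma pay_rule_wait:
  assumes r: "simple_rule m u \<kappa>" and t: "0 \<le> t" and x: "0 < x"
  shows "(\<integral>\<^sup>+\<omega>. pay x (u (\<kappa> \<omega>)) \<omega> \<partial>M)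
    \<le> (\<integral>\<^sup>+\<omega>. pay x (max t (u (\<kappa> \<omega>))) \<omega> \<partial>M) + ennreal (rho * K * t)"
proof -
  let ?B = "\<lambda>i. {\<omega> \<in> space M. \<kappa> \<omega> = i}"
  have B: "?B i \<in> sets (F (u i))" "0 \<le> u i" if "i \<le> m" for i
    using r that by (auto simp: simple_rule_def)
  have BM [measurable]: "?B i \<in> sets M" if "i \<le> m" for i
    using B[OF that] sets_F_subset by blast
  have sum1: "h (\<kappa> \<omega>) = (\<Sum>i\<le>m. indicator (?B i) \<omega> * h i)" if "\<omega> \<in> space M" for \<omega> and h :: "nat \<Rightarrow> ennreal"
  proof -
    have "(\<Sum>i\<le>m. indicator (?B i) \<omega> * h i) = (\<Sum>i\<le>m. if i = \<kappa> \<omega> then h i else 0)"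
      using that by (intro sum.cong) (auto simp: indicator_def)
    also have "\<dots> = h (\<kappa> \<omega>)" using r that by (simp add: simple_rule_def)
    finally show ?thesis by simp
  qed
  have int_sum: "(\<integral>\<^sup>+\<omega>. h (\<kappa> \<omega>) \<omega> \<partial>M) = (\<Sum>i\<le>m. \<integral>\<^sup>+\<omega>. indicator (?B i) \<omega> * h i \<omega> \<partial>M)"
    if [measurable]: "\<And>i. i \<le> m \<Longrightarrow> h i \<in> borel_measurable M" for h :: "nat \<Rightarrow> 'w \<Rightarrow> ennreal"
  proof -
    have "(\<integral>\<^sup>+\<omega>. h (\<kappa> \<omega>) \<omega> \<partial>M) = (\<integral>\<^sup>+\<omega>. (\<Sum>i\<le>m. indicator (?B i) \<omega> * h i \<omega>) \<partial>M)"
      by (intro nn_integral_cong sum1)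
    also have "\<dots> = (\<Sum>i\<le>m. \<integral>\<^sup>+\<omega>. indicator (?B i) \<omega> * h i \<omega> \<partial>M)"
      by (intro nn_integral_sum borel_measurable_times_ennreal borel_measurable_indicator) (auto intro: BM that)
    finally show ?thesis .
  qed
  have pm: "pay x (u i) \<in> borel_measurable M" "pay x (max t (u i)) \<in> borel_measurable M" if "i \<le> m" for i
    using B(2)[OF that] t by (auto intro!: pay_measurable)
  have one: "(\<Sum>i\<le>m. emeasure M (?B i)) = 1"
    using int_sum[of "\<lambda>_ _. 1"] BM by (simp add: emeasure_space_1)
  have "(\<integral>\<^sup>+\<omega>. pay x (u (\<kappa> \<omega>)) \<omega> \<partial>M) = (\<Sum>i\<le>m. \<integral>\<^sup>+\<omega>. indicator (?B i) \<omega> * pay x (u i) \<omega> \<partial>M)"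
    using pm by (intro int_sum)
  also have "\<dots> \<le> (\<Sum>i\<le>m. (\<integral>\<^sup>+\<omega>. indicator (?B i) \<omega> * pay x (max t (u i)) \<omega> \<partial>M)
      + ennreal (rho * K * t) * emeasure M (?B i))"
  proof (intro sum_mono)
    fix i assume "i \<in> {..m}"
    then have i: "i \<le> m" by simp
    show "(\<integral>\<^sup>+\<omega>. indicator (?B i) \<omega> * pay x (u i) \<omega> \<partial>M)
      \<le> (\<integral>\<^sup>+\<omega>. indicator (?B i) \<omega> * pay x (max t (u i)) \<omega> \<partial>M) + ennreal (rho * K * t) * emeasure M (?B i)"
    proof (cases "u i \<le> t")
      case True
      then show ?thesis using pay_wait[OF B(2)[OF i] True B(1)[OF i] x] by (simp add: max_absorb1)
    qed (simp add: max_absorb2 add_increasing2)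
  qed
  also have "\<dots> = (\<integral>\<^sup>+\<omega>. pay x (max t (u (\<kappa> \<omega>))) \<omega> \<partial>M) + ennreal (rho * K * t)"
    using int_sum[of "\<lambda>i. pay x (max t (u i))"] pm
    by (simp add: sum.distrib sum_distrib_left[symmetric] one)
  finally show ?thesis .
qed

text \<open>Postponing the rule to \<open>t\<close> at the earliest can only add running reward, and
  costs the payoff no more than the interest on the strike.\<close>

lemma value_simple_le:
  assumes r: "simple_rule m u \<kappa>" and t: "0 \<le> t" and x: "0 < x"
  shows "value_of x (\<lambda>\<omega>. ennreal (u (\<kappa> \<omega>)))
    \<le> (\<integral>\<^sup>+\<omega>. run x {0..t} \<omega> \<partial>M) + (\<integral>\<^sup>+\<omega>. later x t (max t (u (\<kappa> \<omega>))) \<omega> \<partial>M) + ennreal (rho * K * t)"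
proof -
  let ?v = "\<lambda>\<omega>. max t (u (\<kappa> \<omega>))"
  have [measurable]: "\<kappa> \<in> M \<rightarrow>\<^sub>M count_space UNIV" by (rule simple_rule_measurable) fact
  have u: "0 \<le> u (\<kappa> \<omega>)" if "\<omega> \<in> space M" for \<omega> using r that by (auto simp: simple_rule_def)
  have m1 [measurable]: "(\<lambda>\<omega>. run x {t<..?v \<omega>} \<omega>) \<in> borel_measurable M"
    using t by (intro run_measurable) auto
  have m2 [measurable]: "(\<lambda>\<omega>. pay x (?v \<omega>) \<omega>) \<in> borel_measurable M"
    using t by (intro pay_random_time_measurable) auto
  have m3 [measurable]: "(\<lambda>\<omega>. pay x (u (\<kappa> \<omega>)) \<omega>) \<in> borel_measurable M"
  proof -
    have "(\<lambda>\<omega>. pay x (max 0 (u (\<kappa> \<omega>))) \<omega>) \<in> borel_measurable M"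
      by (intro pay_random_time_measurable) auto
    then show ?thesis using u by (subst measurable_cong[where g="\<lambda>\<omega>. pay x (max 0 (u (\<kappa> \<omega>))) \<omega>"]) auto
  qed
  have "value_of x (\<lambda>\<omega>. ennreal (u (\<kappa> \<omega>)))
     \<le> (\<integral>\<^sup>+\<omega>. run x {0..t} \<omega> + run x {t<..?v \<omega>} \<omega> + pay x (u (\<kappa> \<omega>)) \<omega> \<partial>M)"
    unfolding value_of_def
  proof (intro nn_integral_mono)
    fix \<omega> assume \<omega>: "\<omega> \<in> space M"
    have "gain x (ennreal (u (\<kappa> \<omega>))) \<omega> \<le> run x {0..?v \<omega>} \<omega> + pay x (u (\<kappa> \<omega>)) \<omega>"
      unfolding gain_ennreal[OF u[OF \<omega>]] by (intro add_right_mono run_mono) auto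
    then show "gain x (ennreal (u (\<kappa> \<omega>))) \<omega> \<le> run x {0..t} \<omega> + run x {t<..?v \<omega>} \<omega> + pay x (u (\<kappa> \<omega>)) \<omega>"
      using run_split[OF t _ \<omega>, of "?v \<omega>" x] by simp
  qed
  also have "\<dots> = (\<integral>\<^sup>+\<omega>. run x {0..t} \<omega> \<partial>M) + (\<integral>\<^sup>+\<omega>. run x {t<..?v \<omega>} \<omega> \<partial>M) + (\<integral>\<^sup>+\<omega>. pay x (u (\<kappa> \<omega>)) \<omega> \<partial>M)"
    by (simp add: nn_integral_add)
  also have "\<dots> \<le> (\<integral>\<^sup>+\<omega>. run x {0..t} \<omega> \<partial>M) + (\<integral>\<^sup>+\<omega>. run x {t<..?v \<omega>} \<omega> \<partial>M)
     + ((\<integral>\<^sup>+\<omega>. pay x (?v \<omega>) \<omega> \<partial>M) + ennreal (rho * K * t))"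
    by (intro add_left_mono pay_rule_wait[OF r t x])
  also have "\<dots> = (\<integral>\<^sup>+\<omega>. run x {0..t} \<omega> \<partial>M) + (\<integral>\<^sup>+\<omega>. later x t (?v \<omega>) \<omega> \<partial>M) + ennreal (rho * K * t)"
    unfolding later_def by (simp add: nn_integral_add ac_simps)
  finally show ?thesis .
qed

lemma const_stopping: "ennreal t \<le> T \<Longrightarrow> (\<lambda>_. ennreal t) \<in> stopping_times M W T"
  by (simp add: stopping_times_def stopping_time_const)

lemma pay_0: "0 < c \<Longrightarrow> c < K \<Longrightarrow> (\<integral>\<^sup>+\<omega>. pay c 0 \<omega> \<partial>M) = ennreal (K - c)"
proof -
  assume "0 < c" "c < K"
  then have "(\<integral>\<^sup>+\<omega>. pay c 0 \<omega> \<partial>M) = (\<integral>\<^sup>+\<omega>. ennreal (K - c) \<partial>M)"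
    using W_start by (intro nn_integral_cong_AE) (auto simp: pay_def H_def)
  then show ?thesis by (simp add: emeasure_space_1)
qed

lemma pay_lower:
  assumes "0 < c" "c < K" "0 \<le> t"
  shows "ennreal (K - c) \<le> (\<integral>\<^sup>+\<omega>. pay c t \<omega> \<partial>M) + ennreal (rho * K * t)"
proof -
  have "space M \<in> sets (F 0)" using sets.top[of "F 0"] by simp
  from pay_wait[OF order_refl assms(3) this assms(1)]
  have "(\<integral>\<^sup>+\<omega>. pay c 0 \<omega> \<partial>M) \<le> (\<integral>\<^sup>+\<omega>. pay c t \<omega> \<partial>M) + ennreal (rho * K * t)"
    by (simp add: emeasure_space_1 cong: nn_integral_cong)
  then show ?thesis using pay_0 assms by simp
qed

lemma pay_finite: "0 \<le> t \<Longrightarrow> 0 < c \<Longrightarrow> (\<integral>\<^sup>+\<omega>. pay c t \<omega> \<partial>M) < \<infinity>"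
proof -
  assume "0 \<le> t" "0 < c"
  then have "(\<integral>\<^sup>+\<omega>. pay c t \<omega> \<partial>M) \<le> (\<integral>\<^sup>+\<omega>. ennreal K \<partial>M)" by (intro nn_integral_mono pay_le)
  also have "\<dots> < \<infinity>" by (simp add: emeasure_space_1)
  finally show ?thesis .
qed

text \<open>Stopping at \<open>t\<close> cannot beat \<open>K - c\<close>, yet its payoff alone is
  worth that much up to \<open>rho * K * t\<close>; so no more than this is left for the running
  reward. This takes the place of a direct bound on \<open>k\<close>.\<close>

lemma run_initial:
  assumes c: "0 < c" "c < K" and V: "V c \<le> ennreal (K - c)" and t: "0 \<le> t" "ennreal t \<le> T"
  shows "(\<integral>\<^sup>+\<omega>. run c {0..t} \<omega> \<partial>M) \<le> ennreal (rho * K * t)"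
proof -
  have [measurable]: "pay c t \<in> borel_measurable M" by (rule pay_measurable) fact
  have "(\<integral>\<^sup>+\<omega>. pay c t \<omega> \<partial>M) + (\<integral>\<^sup>+\<omega>. run c {0..t} \<omega> \<partial>M) = value_of c (\<lambda>_. ennreal t)"
    unfolding value_of_def using t by (simp add: gain_ennreal nn_integral_add add.commute)
  also have "\<dots> \<le> (\<integral>\<^sup>+\<omega>. pay c t \<omega> \<partial>M) + ennreal (rho * K * t)"
    using value_le_V[OF const_stopping[OF t(2)], of c] V pay_lower[OF c t(1)] by simp
  finally show ?thesis
    unfolding ennreal_add_left_cancel_le using pay_finite[OF t(1) c(1)] by (metis less_irrefl)
qed

text \<open>Test the rule that continues on \<open>A\<close> and stops at \<open>t\<close>
  elsewhere, a stopping time because \<open>A\<close> is known at \<open>t\<close>. Its value is at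
  most \<open>K - c\<close>, which stopping at \<open>t\<close> attains everywhere up to the waiting
  cost; the contributions off \<open>A\<close> cancel.\<close>

lemma later_on_event:
  assumes c: "0 < c" "c < K" and V: "V c \<le> ennreal (K - c)" and t: "0 \<le> t" "ennreal t \<le> T"
    and r: "simple_rule m u \<kappa>" and A: "A \<in> sets (F t)"
  shows "(\<integral>\<^sup>+\<omega>. indicator A \<omega> * later c t (max t (u (\<kappa> \<omega>))) \<omega> \<partial>M)
    \<le> (\<integral>\<^sup>+\<omega>. indicator A \<omega> * pay c t \<omega> \<partial>M) + ennreal (rho * K * t)"
proof -
  let ?v = "\<lambda>\<omega>. max t (u (\<kappa> \<omega>))"
  let ?\<tau> = "\<lambda>\<omega>. ennreal (if \<omega> \<in> A then ?v \<omega> else t)"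
  have v: "(\<lambda>\<omega>. ennreal (?v \<omega>)) \<in> stopping_times M W T"
    by (rule simple_rule_stopping[OF simple_rule_max[OF r t(2)]])
  have AM [measurable]: "A \<in> sets M" using A sets_F_subset by blast
  have \<tau>: "?\<tau> \<in> stopping_times M W T"
    unfolding stopping_times_def
  proof (intro CollectI conjI ballI stopping_timeI)
    fix s
    show "Measurable.pred (natural_filtration M W s) (\<lambda>\<omega>. ?\<tau> \<omega> \<le> s)"
    proof (cases "ennreal t \<le> s")
      case True
      then have [measurable]: "A \<in> sets (natural_filtration M W s)"
        using A sets_natural_filtration_mono by blast
      have [measurable]: "Measurable.pred (natural_filtration M W s) (\<lambda>\<omega>. ennreal (?v \<omega>) \<le> s)"
        using v stopping_timeD unfolding stopping_times_def by blast
      have "(\<lambda>\<omega>. ?\<tau> \<omega> \<le> s) = (\<lambda>\<omega>. \<omega> \<in> A \<longrightarrow> ennreal (?v \<omega>) \<le> s)"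
        using True by (auto simp: fun_eq_iff)
      then show ?thesis by simp
    next
      case False
      have "\<not> ?\<tau> \<omega> \<le> s" for \<omega>
        using False order_trans[OF ennreal_leI[of t "?v \<omega>"], of s] by auto
      then show ?thesis by simp
    qed
  qed (use v t in \<open>auto simp: stopping_times_def\<close>)
  have [measurable]: "(\<lambda>\<omega>. later c t (?v \<omega>) \<omega>) \<in> borel_measurable M" "pay c t \<in> borel_measurable M"
    using later_measurable[OF r t(1)] pay_measurable[OF t(1)] by auto
  have fin: "(\<integral>\<^sup>+\<omega>. indicator (space M - A) \<omega> * pay c t \<omega> \<partial>M) < \<infinity>"
    using pay_finite[OF t(1) c(1)]
    by (rule le_less_trans[rotated]) (auto intro!: nn_integral_mono simp: indicator_def)
  have "(\<integral>\<^sup>+\<omega>. indicator (space M - A) \<omega> * pay c t \<omega> \<partial>M) + (\<integral>\<^sup>+\<omega>. indicator A \<omega> * later c t (?v \<omega>) \<omega> \<partial>M)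
     = (\<integral>\<^sup>+\<omega>. indicator (space M - A) \<omega> * pay c t \<omega> + indicator A \<omega> * later c t (?v \<omega>) \<omega> \<partial>M)"
    by (simp add: nn_integral_add)
  also have "\<dots> \<le> value_of c ?\<tau>"
    unfolding value_of_def
  proof (intro nn_integral_mono)
    fix \<omega> assume \<omega>: "\<omega> \<in> space M"
    have "run c {t<..?v \<omega>} \<omega> \<le> run c {0..?v \<omega>} \<omega>" using t by (intro run_mono) auto
    then show "indicator (space M - A) \<omega> * pay c t \<omega> + indicator A \<omega> * later c t (?v \<omega>) \<omega> \<le> gain c (?\<tau> \<omega>) \<omega>"
      using \<omega> t by (cases "\<omega> \<in> A") (auto simp: gain_ennreal later_def add_increasing intro: add_right_mono)
  qed
  also have "\<dots> \<le> (\<integral>\<^sup>+\<omega>. pay c t \<omega> \<partial>M) + ennreal (rho * K * t)"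
    using value_le_V[OF \<tau>, of c] V pay_lower[OF c t(1)] by simp
  also have "(\<integral>\<^sup>+\<omega>. pay c t \<omega> \<partial>M) = (\<integral>\<^sup>+\<omega>. indicator (space M - A) \<omega> * pay c t \<omega> + indicator A \<omega> * pay c t \<omega> \<partial>M)"
    by (intro nn_integral_cong) (auto simp: indicator_def)
  also have "\<dots> = (\<integral>\<^sup>+\<omega>. indicator (space M - A) \<omega> * pay c t \<omega> \<partial>M) + (\<integral>\<^sup>+\<omega>. indicator A \<omega> * pay c t \<omega> \<partial>M)"
    by (simp add: nn_integral_add)
  finally show ?thesis
    unfolding add.assoc ennreal_add_left_cancel_le using fin by (metis less_irrefl)
qed

text \<open>The path events that represent the values of \<open>\<kappa>\<close> need be disjoint
  and exhaustive only on actual paths of \<open>W\<close>. Taking the least matching index, with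
  default \<open>m\<close>, repairs this on the rest of path space; since it looks back at earlier
  dates only, the rule stays nonanticipating.\<close>

lemma simple_rule_path:
  assumes r: "simple_rule m u \<kappa>"
  obtains \<kappa>' :: "(real \<Rightarrow> real) \<Rightarrow> nat" where
    "\<And>\<omega>. \<omega> \<in> space M \<Longrightarrow> \<kappa> \<omega> = \<kappa>' (\<lambda>s. W (max 0 s) \<omega>)" "\<And>p. \<kappa>' p \<le> m"
    "\<And>i. i \<le> m \<Longrightarrow> {p. \<kappa>' p = i} \<in> sets (natural_filtration path_space (\<lambda>s p. p s) (ennreal (u i)))"
proof -
  let ?N = "\<lambda>i. natural_filtration path_space (\<lambda>s p. p s) (ennreal (u i))"
  let ?\<Pi> = "\<lambda>\<omega> s. W (max 0 s) \<omega>"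
  have "\<forall>i. \<exists>A. i \<le> m \<longrightarrow> A \<in> sets (?N i) \<and> {\<omega> \<in> space M. \<kappa> \<omega> = i} = {\<omega> \<in> space M. ?\<Pi> \<omega> \<in> A}"
  proof
    fix i
    show "\<exists>A. i \<le> m \<longrightarrow> A \<in> sets (?N i) \<and> {\<omega> \<in> space M. \<kappa> \<omega> = i} = {\<omega> \<in> space M. ?\<Pi> \<omega> \<in> A}"
      using natural_filtration_path[of "{\<omega> \<in> space M. \<kappa> \<omega> = i}" "ennreal (u i)"] r
      by (cases "i \<le> m") (auto simp: simple_rule_def)
  qed
  from choice[OF this] obtain A where
    "\<forall>i. i \<le> m \<longrightarrow> A i \<in> sets (?N i) \<and> {\<omega> \<in> space M. \<kappa> \<omega> = i} = {\<omega> \<in> space M. ?\<Pi> \<omega> \<in> A i}" ..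
  then have A: "\<And>i. i \<le> m \<Longrightarrow> A i \<in> sets (?N i)"
    "\<And>i. i \<le> m \<Longrightarrow> {\<omega> \<in> space M. \<kappa> \<omega> = i} = {\<omega> \<in> space M. ?\<Pi> \<omega> \<in> A i}"
    by blast+
  define \<kappa>' where "\<kappa>' p = (LEAST i. i = m \<or> p \<in> A i)" for p
  have iff: "\<kappa>' p = i \<longleftrightarrow> (i = m \<or> p \<in> A i) \<and> (\<forall>j<i. p \<notin> A j)" if "i \<le> m" for p i
  proof
    assume "\<kappa>' p = i"
    then show "(i = m \<or> p \<in> A i) \<and> (\<forall>j<i. p \<notin> A j)"
      using LeastI[of "\<lambda>i. i = m \<or> p \<in> A i" m] not_less_Least[of _ "\<lambda>i. i = m \<or> p \<in> A i"]
      unfolding \<kappa>'_def by blast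
  next
    assume *: "(i = m \<or> p \<in> A i) \<and> (\<forall>j<i. p \<notin> A j)"
    show "\<kappa>' p = i"
      unfolding \<kappa>'_def using * that by (intro Least_equality) (auto simp: not_less[symmetric])
  qed
  show ?thesis
  proof
    show "\<kappa> \<omega> = \<kappa>' (?\<Pi> \<omega>)" if \<omega>: "\<omega> \<in> space M" for \<omega>
    proof -
      have m: "\<kappa> \<omega> \<le> m" using r \<omega> by (auto simp: simple_rule_def)
      have mem: "?\<Pi> \<omega> \<in> A j \<longleftrightarrow> \<kappa> \<omega> = j" if "j \<le> m" for j
        using A(2)[OF that] \<omega> by blast
      have "\<kappa>' (?\<Pi> \<omega>) = \<kappa> \<omega>" unfolding iff[OF m] using mem m by auto
      then show ?thesis by simp
    qed
    show "\<kappa>' p \<le> m" for p unfolding \<kappa>'_def by (rule Least_le) simp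
    show "{p. \<kappa>' p = i} \<in> sets (?N i)" if i: "i \<le> m" for i
    proof -
      have top: "UNIV \<in> sets (?N i)" using sets.top[of "?N i"] by (simp add: space_PiM)
      have "{p. \<kappa>' p = i} = (if i = m then UNIV else A i) - (\<Union>j\<in>{..<i}. A j)"
        using iff[OF i] by auto
      also have "\<dots> \<in> sets (?N i)"
      proof (intro sets.Diff sets.finite_UN)
        show "(if i = m then UNIV else A i) \<in> sets (?N i)"
          using A(1)[OF i] top by (cases "i = m") simp_all
        fix j assume "j \<in> {..<i}"
        then have j: "j \<le> i" "j \<le> m" using i by auto
        have "ennreal (u j) \<le> ennreal (u i)"
          using r i j by (auto simp: simple_rule_def intro!: ennreal_leI)
        from sets_natural_filtration_mono[OF this] A(1)[OF j(2)]
        show "A j \<in> sets (?N i)" by blast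
      qed auto
      finally show ?thesis .
    qed
  qed
qed

text \<open>Cameron--Martin turns the reward collected after time \<open>t\<close> from the starting point
  \<open>c * exp (vol * b * t)\<close> into a weighted reward from \<open>c\<close>; the stopping rule has to be
  applied to the path shifted back.\<close>

lemma later_shift:
  assumes r: "simple_rule m u \<kappa>" and t: "0 \<le> t" and c: "0 < c"
  obtains \<kappa>' where "simple_rule m u \<kappa>'"
    "(\<integral>\<^sup>+\<omega>. later (c * exp (vol * b * t)) t (max t (u (\<kappa> \<omega>))) \<omega> \<partial>M)
     = (\<integral>\<^sup>+\<omega>. ennreal (girsanov b t \<omega>) * later c t (max t (u (\<kappa>' \<omega>))) \<omega> \<partial>M)"
proof -
  let ?\<Pi> = "\<lambda>\<omega> s. W (max 0 s) \<omega>"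
  let ?\<beta> = "\<lambda>s. b * min (max 0 s) t"
  let ?x = "c * exp (vol * b * t)"
  obtain K' where K': "\<And>\<omega>. \<omega> \<in> space M \<Longrightarrow> \<kappa> \<omega> = K' (?\<Pi> \<omega>)" "\<And>p. K' p \<le> m"
    "\<And>i. i \<le> m \<Longrightarrow> {p. K' p = i} \<in> sets (natural_filtration path_space (\<lambda>s p. p s) (ennreal (u i)))"
    using simple_rule_path[OF r] by blast
  \<comment> \<open>Chosen so that adding the shift to the path turns it back into
    \<open>\<kappa>\<close>. The shift is deterministic, so no information is anticipated.\<close>
  define \<kappa>' where "\<kappa>' \<omega> = K' (\<lambda>s. ?\<Pi> \<omega> s - ?\<beta> s)" for \<omega>
  have r': "simple_rule m u \<kappa>'"
    unfolding simple_rule_def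
  proof (intro conjI allI impI ballI)
    fix i assume i: "i \<le> m"
    have "(\<lambda>\<omega> s. ?\<Pi> \<omega> s - ?\<beta> s) \<in> F (u i) \<rightarrow>\<^sub>M natural_filtration path_space (\<lambda>s p. p s) (ennreal (u i))"
      by (intro measurable_into_natural_filtration borel_measurable_diff measurable_natural_filtration_component)
        (auto simp: space_PiM)
    from measurable_sets[OF this K'(3)[OF i]]
    have "(\<lambda>\<omega> s. ?\<Pi> \<omega> s - ?\<beta> s) -` {p. K' p = i} \<inter> space M \<in> sets (F (u i))" by simp
    also have "(\<lambda>\<omega> s. ?\<Pi> \<omega> s - ?\<beta> s) -` {p. K' p = i} \<inter> space M = {\<omega> \<in> space M. \<kappa>' \<omega> = i}"
      by (auto simp: \<kappa>'_def)
    finally show "{\<omega> \<in> space M. \<kappa>' \<omega> = i} \<in> sets (F (u i))" .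
  qed (use r K'(2) in \<open>auto simp: simple_rule_def \<kappa>'_def\<close>)
  have coord [measurable]: "(\<lambda>p. p s) \<in> borel_measurable path_space" for s :: real
    by (rule measurable_component_singleton) simp
  have shift_m: "(\<lambda>p s. p s - ?\<beta> s) \<in> path_space \<rightarrow>\<^sub>M path_space"
    by (rule measurable_PiM_single') auto
  have K'm: "K' \<in> path_space \<rightarrow>\<^sub>M count_space UNIV"
  proof (rule measurable_count_space_eq_countable[THEN iffD2])
    have "K' -` {i} \<inter> space path_space \<in> sets path_space" for i
    proof (cases "i \<le> m")
      case True
      have "sets (natural_filtration path_space (\<lambda>s p. p s) (ennreal (u i))) \<subseteq> sets path_space"
        by (intro sets_natural_filtration_subset) auto
      moreover have "K' -` {i} \<inter> space path_space = {p. K' p = i}" by (auto simp: space_PiM)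
      ultimately show ?thesis using K'(3)[OF True] by auto
    next
      case False
      then have "K' -` {i} \<inter> space path_space = {}" using K'(2) by auto
      then show ?thesis by (simp only: sets.empty_sets)
    qed
    then show "K' \<in> space path_space \<rightarrow> UNIV \<and> (\<forall>a\<in>UNIV. K' -` {a} \<inter> space path_space \<in> sets path_space)" by simp
  qed simp
  define K'' where "K'' p = K' (\<lambda>s. p s - ?\<beta> s)" for p
  have K''m [measurable]: "K'' \<in> path_space \<rightarrow>\<^sub>M count_space UNIV"
    unfolding K''_def[abs_def] by (rule measurable_compose[OF shift_m K'm])
  have K1: "K'' (\<lambda>s. ?\<Pi> \<omega> s + ?\<beta> s) = \<kappa> \<omega>" if "\<omega> \<in> space M" for \<omega>
    using K'(1)[OF that] by (simp add: K''_def)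
  have K2: "K'' (?\<Pi> \<omega>) = \<kappa>' \<omega>" for \<omega> by (simp add: K''_def \<kappa>'_def)
  let ?v = "\<lambda>i. max t (u i)"
  define h where "h s w = exp ((mu - vol\<^sup>2 / 2) * s + vol * w)" for s w :: real
  \<comment> \<open>From \<open>t\<close> on the accumulated shift is \<open>b * t\<close>, which
    multiplies the price by \<open>exp (vol * b * t)\<close> and so amounts to a new starting
    point.\<close>
  have h1: "c * h s (?\<Pi> \<omega> s + ?\<beta> s) = ?x * H s \<omega>" if "t \<le> s" for s \<omega>
    using that t by (simp add: h_def H_def exp_add[symmetric] algebra_simps max_absorb2 min_absorb2)
  have h2: "h s (?\<Pi> \<omega> s) = H s \<omega>" if "t \<le> s" for s \<omega>
    using that t by (simp add: h_def H_def max_absorb2)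
  have [measurable]: "\<kappa> \<in> M \<rightarrow>\<^sub>M count_space UNIV" "\<kappa>' \<in> M \<rightarrow>\<^sub>M count_space UNIV"
    using simple_rule_measurable r r' by auto
  have [measurable]: "girsanov b t \<in> borel_measurable M" using t by simp
  interpret P: pair_sigma_finite M lborel by unfold_locales
  have ks [measurable]: "(\<lambda>y. k y s) \<in> borel_measurable borel" for s
    using measurable_Pair1[OF k_measurable, of s] by simp
  \<comment> \<open>Time integral and expectation are exchanged first. Cameron--Martin is then
    needed for the coordinate at one time \<open>s\<close> and the index only; a time integral along
    the path is not evidently measurable for the product sigma-algebra.\<close>
  have Fub: "(\<integral>\<^sup>+\<omega>. ennreal (z \<omega>) * run x {t<..?v (\<rho> \<omega>)} \<omega> \<partial>M)
      = (\<integral>\<^sup>+s. \<integral>\<^sup>+\<omega>. ennreal (z \<omega>) * (k (x * H s \<omega>) s * indicator {t<..?v (\<rho> \<omega>)} s) \<partial>M \<partial>lborel)"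
    if [measurable]: "z \<in> borel_measurable M" "\<rho> \<in> M \<rightarrow>\<^sub>M count_space UNIV" for z :: "'w \<Rightarrow> real" and \<rho> x
  proof -
    have [measurable]: "(\<lambda>\<omega>. ?v (\<rho> \<omega>)) \<in> borel_measurable M"
      by (rule measurable_compose[OF that(2)]) simp
    have m: "(\<lambda>p. k (x * H (snd p) (fst p)) (snd p) * indicator {t<..?v (\<rho> (fst p))} (snd p))
        \<in> borel_measurable (M \<Otimes>\<^sub>M borel)"
      using t by (intro run_integrand_measurable) auto
    have m': "(\<lambda>p. ennreal (z (fst p)) * (k (x * H (snd p) (fst p)) (snd p) * indicator {t<..?v (\<rho> (fst p))} (snd p)))
        \<in> borel_measurable (M \<Otimes>\<^sub>M borel)"
      by (intro borel_measurable_times_ennreal m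
          measurable_compose[OF measurable_compose[OF measurable_fst that(1)] measurable_ennreal])
    have "(\<integral>\<^sup>+\<omega>. ennreal (z \<omega>) * run x {t<..?v (\<rho> \<omega>)} \<omega> \<partial>M)
      = (\<integral>\<^sup>+\<omega>. \<integral>\<^sup>+s. ennreal (z \<omega>) * (k (x * H s \<omega>) s * indicator {t<..?v (\<rho> \<omega>)} s) \<partial>lborel \<partial>M)"
      unfolding run_def
    proof (intro nn_integral_cong nn_integral_cmult[symmetric])
      fix \<omega> assume \<omega>: "\<omega> \<in> space M"
      show "(\<lambda>s. k (x * H s \<omega>) s * indicator {t<..?v (\<rho> \<omega>)} s) \<in> borel_measurable lborel"
        using t \<omega> by (intro run_section_measurable) auto
    qed
    also have "\<dots> = (\<integral>\<^sup>+s. \<integral>\<^sup>+\<omega>. ennreal (z \<omega>) * (k (x * H s \<omega>) s * indicator {t<..?v (\<rho> \<omega>)} s) \<partial>M \<partial>lborel)"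
      using m' by (intro P.Fubini'[symmetric])
        (simp add: case_prod_beta' cong: measurable_cong_sets sets_pair_measure_cong)
    finally show ?thesis .
  qed
  have run_eq: "(\<integral>\<^sup>+\<omega>. run ?x {t<..?v (\<kappa> \<omega>)} \<omega> \<partial>M)
      = (\<integral>\<^sup>+\<omega>. ennreal (girsanov b t \<omega>) * run c {t<..?v (\<kappa>' \<omega>)} \<omega> \<partial>M)"
  proof -
    have "(\<integral>\<^sup>+\<omega>. run ?x {t<..?v (\<kappa> \<omega>)} \<omega> \<partial>M)
        = (\<integral>\<^sup>+s. \<integral>\<^sup>+\<omega>. k (?x * H s \<omega>) s * indicator {t<..?v (\<kappa> \<omega>)} s \<partial>M \<partial>lborel)"
      using Fub[of "\<lambda>_. 1" \<kappa> ?x] by simp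
    also have "\<dots> = (\<integral>\<^sup>+s. \<integral>\<^sup>+\<omega>. ennreal (girsanov b t \<omega>) *
        (k (c * H s \<omega>) s * indicator {t<..?v (\<kappa>' \<omega>)} s) \<partial>M \<partial>lborel)"
    proof (rule nn_integral_cong)
      fix s :: real
      define G where "G p = (if t < s \<and> s \<le> ?v (K'' p) then k (c * h s (p s)) s else 0)" for p
      have G [measurable]: "G \<in> borel_measurable path_space"
        unfolding G_def[abs_def] h_def by measurable
      have "(\<integral>\<^sup>+\<omega>. k (?x * H s \<omega>) s * indicator {t<..?v (\<kappa> \<omega>)} s \<partial>M) = (\<integral>\<^sup>+\<omega>. G (\<lambda>s. ?\<Pi> \<omega> s + ?\<beta> s) \<partial>M)"
        by (intro nn_integral_cong) (auto simp: G_def K1 h1 less_imp_le indicator_def)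
      also have "\<dots> = (\<integral>\<^sup>+\<omega>. ennreal (girsanov b t \<omega>) * G (?\<Pi> \<omega>) \<partial>M)"
        by (rule cameron_martin[OF t G])
      also have "\<dots> = (\<integral>\<^sup>+\<omega>. ennreal (girsanov b t \<omega>) *
        (k (c * H s \<omega>) s * indicator {t<..?v (\<kappa>' \<omega>)} s) \<partial>M)"
        by (intro nn_integral_cong) (auto simp: G_def K2 h2 less_imp_le indicator_def)
      finally show "(\<integral>\<^sup>+\<omega>. k (?x * H s \<omega>) s * indicator {t<..?v (\<kappa> \<omega>)} s \<partial>M)
        = (\<integral>\<^sup>+\<omega>. ennreal (girsanov b t \<omega>) * (k (c * H s \<omega>) s * indicator {t<..?v (\<kappa>' \<omega>)} s) \<partial>M)" .
    qed
    also have "\<dots> = (\<integral>\<^sup>+\<omega>. ennreal (girsanov b t \<omega>) * run c {t<..?v (\<kappa>' \<omega>)} \<omega> \<partial>M)"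
      by (rule Fub[symmetric]) measurable
    finally show ?thesis .
  qed
  have pay_eq: "(\<integral>\<^sup>+\<omega>. pay ?x (?v (\<kappa> \<omega>)) \<omega> \<partial>M)
      = (\<integral>\<^sup>+\<omega>. ennreal (girsanov b t \<omega>) * pay c (?v (\<kappa>' \<omega>)) \<omega> \<partial>M)"
  proof -
    define G where "G p = ennreal (exp (- rho * ?v (K'' p)) * max 0 (K - c * h (?v (K'' p)) (p (?v (K'' p)))))"
      for p :: "real \<Rightarrow> real"
    have G: "G \<in> borel_measurable path_space"
      unfolding G_def
    \<comment> \<open>The path is evaluated at a random time; this is measurable because the index
      ranges over a countable set.\<close>
    proof (rule measurable_compose_countable[OF _ K''m,
        where f="\<lambda>i p. ennreal (exp (- rho * ?v i) * max 0 (K - c * h (?v i) (p (?v i))))"])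
      show "(\<lambda>p. ennreal (exp (- rho * ?v i) * max 0 (K - c * h (?v i) (p (?v i))))) \<in> borel_measurable path_space" for i
        unfolding h_def by measurable
    qed
    have "(\<integral>\<^sup>+\<omega>. pay ?x (?v (\<kappa> \<omega>)) \<omega> \<partial>M) = (\<integral>\<^sup>+\<omega>. G (\<lambda>s. ?\<Pi> \<omega> s + ?\<beta> s) \<partial>M)"
    proof (intro nn_integral_cong)
      fix \<omega> assume "\<omega> \<in> space M"
      from K1[OF this] show "pay ?x (?v (\<kappa> \<omega>)) \<omega> = G (\<lambda>s. ?\<Pi> \<omega> s + ?\<beta> s)"
        using h1[of "?v (\<kappa> \<omega>)" \<omega>] by (simp only: G_def pay_def max.cobounded1)
    qed
    also have "\<dots> = (\<integral>\<^sup>+\<omega>. ennreal (girsanov b t \<omega>) * G (?\<Pi> \<omega>) \<partial>M)"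
      by (rule cameron_martin[OF t G])
    also have "\<dots> = (\<integral>\<^sup>+\<omega>. ennreal (girsanov b t \<omega>) * pay c (?v (\<kappa>' \<omega>)) \<omega> \<partial>M)"
    proof (intro nn_integral_cong)
      fix \<omega>
      show "ennreal (girsanov b t \<omega>) * G (?\<Pi> \<omega>) = ennreal (girsanov b t \<omega>) * pay c (?v (\<kappa>' \<omega>)) \<omega>"
        using h2[of "?v (\<kappa>' \<omega>)" \<omega>] by (simp only: G_def pay_def max.cobounded1 K2)
    qed
    finally show ?thesis .
  qed
  have m: "(\<lambda>\<omega>. run x {t<..?v (\<rho> \<omega>)} \<omega>) \<in> borel_measurable M" "(\<lambda>\<omega>. pay x (?v (\<rho> \<omega>)) \<omega>) \<in> borel_measurable M"
    if [measurable]: "\<rho> \<in> M \<rightarrow>\<^sub>M count_space UNIV" for \<rho> x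
  proof -
    have [measurable]: "(\<lambda>\<omega>. ?v (\<rho> \<omega>)) \<in> borel_measurable M"
      by (rule measurable_compose[OF that]) simp
    show "(\<lambda>\<omega>. run x {t<..?v (\<rho> \<omega>)} \<omega>) \<in> borel_measurable M" "(\<lambda>\<omega>. pay x (?v (\<rho> \<omega>)) \<omega>) \<in> borel_measurable M"
      using t by (auto intro!: run_measurable pay_random_time_measurable)
  qed
  note [measurable] = m[of \<kappa>] m[of \<kappa>']
  show ?thesis
  proof (rule that[OF r'])
    show "(\<integral>\<^sup>+\<omega>. later ?x t (?v (\<kappa> \<omega>)) \<omega> \<partial>M) = (\<integral>\<^sup>+\<omega>. ennreal (girsanov b t \<omega>) * later c t (?v (\<kappa>' \<omega>)) \<omega> \<partial>M)"
      unfolding later_def distrib_left by (simp add: nn_integral_add run_eq pay_eq)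
  qed
qed

lemma pay_shift:
  assumes t: "0 \<le> t"
  shows "(\<integral>\<^sup>+\<omega>. ennreal (girsanov b t \<omega>) * pay c t \<omega> \<partial>M) = (\<integral>\<^sup>+\<omega>. pay (c * exp (vol * b * t)) t \<omega> \<partial>M)"
proof -
  define G where "G p = ennreal (exp (- rho * t) * max 0 (K - c * exp ((mu - vol\<^sup>2 / 2) * t + vol * p t)))"
    for p :: "real \<Rightarrow> real"
  have [measurable]: "(\<lambda>p. p t) \<in> borel_measurable path_space"
    by (rule measurable_component_singleton) simp
  have G: "G \<in> borel_measurable path_space" unfolding G_def by measurable
  have "G (\<lambda>s. W (max 0 s) \<omega> + b * min (max 0 s) t) = pay (c * exp (vol * b * t)) t \<omega>" for \<omega>
    using t by (simp add: G_def pay_def H_def exp_add[symmetric] algebra_simps)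
  moreover have "G (\<lambda>s. W (max 0 s) \<omega>) = pay c t \<omega>" for \<omega>
    using t by (simp add: G_def pay_def H_def)
  ultimately show ?thesis using cameron_martin[OF t G, of b] by simp
qed

text \<open>As the price decreases to 0, \<open>k\<close> increases to a limit \<open>ks\<close>
  that depends on time alone. The total of \<open>ks\<close> is therefore deterministic, it bounds
  the running reward along every path, and monotone convergence bounds it by \<open>K\<close>
  through the values at starting points near 0.\<close>

lemma run_total_le:
  assumes V: "\<And>n::nat. V (c / real (Suc n)) \<le> ennreal K" and c: "0 < c"
    and \<omega>: "\<omega> \<in> space M" and x: "0 < x"
  shows "run x {t. 0 \<le> t \<and> ennreal t \<le> T} \<omega> \<le> ennreal K"
proof -
  define D where "D = {t. 0 \<le> t \<and> ennreal t \<le> T}"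
  have D [measurable]: "D \<in> sets borel" unfolding D_def by measurable
  define ks where "ks t = (SUP n. k (1 / real (Suc n)) t)" for t
  have ks_ge: "k y t \<le> ks t" if y: "0 < y" for y t
  proof -
    obtain n where "inverse (real (Suc n)) < y" using reals_Archimedean[OF y] by blast
    then have "k y t \<le> k (1 / real (Suc n)) t" by (intro k_antimono) (auto simp: field_simps)
    also have "\<dots> \<le> ks t" unfolding ks_def by (rule SUP_upper) simp
    finally show ?thesis .
  qed
  \<comment> \<open>A fixed positive factor does not affect the limit at 0; this is what removes the
    random factor \<open>H t \<omega>\<close>.\<close>
  have ks_le: "ks t \<le> (SUP n. k (c / real (Suc n) * h) t)" if h: "0 < h" for h t
    unfolding ks_def
  proof (rule SUP_least)
    fix n
    obtain j where "c * h * real (Suc n) < real j" using reals_Archimedean2 by blast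
    then have "c / real (Suc j) * h \<le> 1 / real (Suc n)" by (simp add: field_simps)
    then have "k (1 / real (Suc n)) t \<le> k (c / real (Suc j) * h) t"
      using c h by (intro k_antimono) auto
    also have "\<dots> \<le> (SUP n. k (c / real (Suc n) * h) t)" by (rule SUP_upper) simp
    finally show "k (1 / real (Suc n)) t \<le> (SUP n. k (c / real (Suc n) * h) t)" .
  qed
  have inc: "incseq (\<lambda>n. k (c / real (Suc n) * h) t)" if "0 < h" for h t
    using c that by (intro incseq_SucI k_antimono mult_right_mono divide_left_mono) auto
  have run_D: "(\<lambda>\<omega>. run y D \<omega>) \<in> borel_measurable M" for y
    by (rule run_measurable) (auto simp: D_def)
  have pointwise: "(\<integral>\<^sup>+t\<in>D. ks t \<partial>lborel) \<le> (SUP n. run (c / real (Suc n)) D \<omega>)" if \<omega>: "\<omega> \<in> space M" for \<omega>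
  proof -
    have "(\<integral>\<^sup>+t\<in>D. ks t \<partial>lborel) \<le> (\<integral>\<^sup>+t. (SUP n. k (c / real (Suc n) * H t \<omega>) t * indicator D t) \<partial>lborel)"
      using ks_le by (intro nn_integral_mono) (auto simp: indicator_def)
    also have "\<dots> = (SUP n. run (c / real (Suc n)) D \<omega>)"
      unfolding run_def
    proof (rule nn_integral_monotone_convergence_SUP)
      show "incseq (\<lambda>n t. k (c / real (Suc n) * H t \<omega>) t * indicator D t)"
        using inc by (auto simp: incseq_def le_fun_def intro!: mult_right_mono)
      show "(\<lambda>t. k (c / real (Suc n) * H t \<omega>) t * indicator D t) \<in> borel_measurable lborel" for n
        using \<omega> by (intro run_section_measurable) (auto simp: D_def)
    qed
    finally show ?thesis .
  qed
  \<comment> \<open>A constant equals its own mean, which turns a bound on expectations into one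
    valid on every path.\<close>
  have "(\<integral>\<^sup>+t\<in>D. ks t \<partial>lborel) = (\<integral>\<^sup>+\<omega>. (\<integral>\<^sup>+t\<in>D. ks t \<partial>lborel) \<partial>M)"
    by (simp add: emeasure_space_1)
  also have "\<dots> \<le> (\<integral>\<^sup>+\<omega>. (SUP n. run (c / real (Suc n)) D \<omega>) \<partial>M)"
    by (intro nn_integral_mono pointwise)
  also have "\<dots> = (SUP n. \<integral>\<^sup>+\<omega>. run (c / real (Suc n)) D \<omega> \<partial>M)"
  proof (rule nn_integral_monotone_convergence_SUP[OF _ run_D])
    show "incseq (\<lambda>n. run (c / real (Suc n)) D)"
      using c by (intro incseq_SucI le_funI run_antimono divide_left_mono) auto
  qed
  also have "\<dots> \<le> ennreal K"
  proof (rule SUP_least)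
    fix n
    have "(\<integral>\<^sup>+\<omega>. run (c / real (Suc n)) D \<omega> \<partial>M) \<le> value_of (c / real (Suc n)) (\<lambda>_. T)"
      unfolding value_of_def gain_def D_def by (intro nn_integral_mono) simp
    also have "\<dots> \<le> V (c / real (Suc n))"
      by (rule value_le_V) (simp add: stopping_times_def stopping_time_const)
    also have "\<dots> \<le> ennreal K" by (rule V)
    finally show "(\<integral>\<^sup>+\<omega>. run (c / real (Suc n)) D \<omega> \<partial>M) \<le> ennreal K" .
  qed
  finally have "(\<integral>\<^sup>+t\<in>D. ks t \<partial>lborel) \<le> ennreal K" .
  moreover have "run x D \<omega> \<le> (\<integral>\<^sup>+t\<in>D. ks t \<partial>lborel)"
    unfolding run_def using x by (intro nn_integral_mono mult_right_mono ks_ge) auto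
  ultimately show ?thesis unfolding D_def by (rule order_trans[rotated])
qed

text \<open>Put--call parity with two simplifications: the discounted strike is replaced by
  \<open>K\<close>, and the call payoff by the multiple \<open>x\<^sup>2 / (K - x)\<close> of
  \<open>(H t - 1)\<^sup>2\<close>, whose mean is the last bracket and has order
  \<open>t\<close>.\<close>

definition pay_bound :: "real \<Rightarrow> real \<Rightarrow> real" where
  "pay_bound x t = K - x * exp ((mu - rho) * t)
    + x\<^sup>2 / (K - x) * (exp ((2 * mu + vol\<^sup>2) * t) - 2 * exp (mu * t) + 1)"

lemma pay_bound:
  assumes x: "0 < x" "x < K" and t: "0 \<le> t"
  shows nn_integral_pay_le: "(\<integral>\<^sup>+\<omega>. pay x t \<omega> \<partial>M) \<le> ennreal (pay_bound x t)"
    and pay_bound_nonneg: "0 \<le> pay_bound x t"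
proof -
  let ?C = "x\<^sup>2 / (K - x)"
  let ?g = "\<lambda>\<omega>. K - x * exp (- rho * t) * H t \<omega> + ?C * ((H t \<omega>)\<^sup>2 - 2 * H t \<omega> + 1)"
  have le: "exp (- rho * t) * max 0 (K - x * y) \<le> K - x * exp (- rho * t) * y + ?C * (y\<^sup>2 - 2 * y + 1)" for y
  proof -
    \<comment> \<open>Where the call pays, \<open>x * (y - 1)\<close> is at least
      \<open>K - x > 0\<close>, so it is at most its own square divided by
      \<open>K - x\<close>.\<close>
    have "max 0 (x * y - K) \<le> ?C * (y\<^sup>2 - 2 * y + 1)"
    proof (cases "x * y \<le> K")
      case True
      have "0 \<le> ?C * (y - 1)\<^sup>2" using x by simp
      also have "(y - 1)\<^sup>2 = y\<^sup>2 - 2 * y + 1" by (simp add: power2_eq_square algebra_simps)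
      finally show ?thesis using True by simp
    next
      case False
      then have *: "K - x \<le> x * (y - 1)" by (simp add: algebra_simps)
      then have "0 < y - 1" using x by (smt (verit) zero_less_mult_pos)
      then have "(y - 1) * (K - x) \<le> (y - 1) * (x * (y - 1))" using * by (intro mult_left_mono) auto
      then have "y - 1 \<le> x * (y - 1)\<^sup>2 / (K - x)" using x by (simp add: pos_le_divide_eq power2_eq_square ac_simps)
      then have "x * (y - 1) \<le> x * (x * (y - 1)\<^sup>2 / (K - x))" using x by (intro mult_left_mono) auto
      moreover have "x * y - K \<le> x * (y - 1)" using x by (simp add: algebra_simps)
      moreover have "x * (x * (y - 1)\<^sup>2 / (K - x)) = ?C * (y\<^sup>2 - 2 * y + 1)"
      proof -
        have "(y - 1)\<^sup>2 = y\<^sup>2 - 2 * y + 1" by (simp add: power2_eq_square algebra_simps)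
        then show ?thesis by (simp add: power2_eq_square)
      qed
      ultimately have "x * y - K \<le> ?C * (y\<^sup>2 - 2 * y + 1)" by linarith
      then show ?thesis using False by simp
    qed
    moreover have "exp (- rho * t) * max 0 (x * y - K) \<le> 1 * max 0 (x * y - K)"
      using rho_pos t by (intro mult_right_mono) auto
    moreover have "exp (- rho * t) * max 0 (K - x * y) = exp (- rho * t) * (K - x * y) + exp (- rho * t) * max 0 (x * y - K)"
      by (simp add: max_def algebra_simps)
    moreover have "exp (- rho * t) * K \<le> K" using rho_pos t K_pos by simp
    ultimately show ?thesis by (simp add: algebra_simps)
  qed
  have nn: "0 \<le> ?g \<omega>" for \<omega>
    by (rule order_trans[OF _ le]) simp
  have int: "integrable M ?g"
    using integrable_H[OF t] H_square(1)[OF t] by simp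
  have "(\<integral>\<omega>. ?g \<omega> \<partial>M) = K - x * exp (- rho * t) * exp (mu * t) + ?C * (exp ((2 * mu + vol\<^sup>2) * t) - 2 * exp (mu * t) + 1)"
    using integrable_H[OF t] H_square[OF t] by (simp add: integral_H[OF t] prob_space)
  also have "x * exp (- rho * t) * exp (mu * t) = x * exp ((mu - rho) * t)"
    by (simp add: exp_add[symmetric] algebra_simps)
  finally have I: "(\<integral>\<omega>. ?g \<omega> \<partial>M) = pay_bound x t" by (simp add: pay_bound_def)
  have "(\<integral>\<^sup>+\<omega>. pay x t \<omega> \<partial>M) \<le> (\<integral>\<^sup>+\<omega>. ennreal (?g \<omega>) \<partial>M)"
    unfolding pay_def by (intro nn_integral_mono ennreal_leI le)
  also have "\<dots> = ennreal (\<integral>\<omega>. ?g \<omega> \<partial>M)"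
    using nn by (intro nn_integral_eq_integral int) auto
  finally show "(\<integral>\<^sup>+\<omega>. pay x t \<omega> \<partial>M) \<le> ennreal (pay_bound x t)" unfolding I .
  show "0 \<le> pay_bound x t" unfolding I[symmetric] using nn by (rule Bochner_Integration.integral_nonneg)
qed

text \<open>The four waiting costs are: one for the running reward before \<open>t\<close>, one for
  postponing the payoff, two from the layer cake up to level 2. The factor \<open>2 * K\<close>
  bounds a reward collected after \<open>t\<close>, namely \<open>K\<close> of running reward and
  \<open>K\<close> of payoff; values at starting points below \<open>c\<close> are needed for the
  former. \<open>q\<close> is \<open>b\<^sup>2 * t\<close> for the drift \<open>b\<close> that
  carries \<open>c\<close> to \<open>x\<close>.\<close>

lemma V_upper_bound:
  assumes c: "0 < c" and x: "c < x" "x < K" and V: "\<And>y. 0 < y \<Longrightarrow> y \<le> c \<Longrightarrow> V y \<le> ennreal (K - y)"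
    and t: "0 < t" "ennreal t \<le> T"
  defines "q \<equiv> (ln (x / c))\<^sup>2 / (vol\<^sup>2 * t)"
  shows "V x \<le> ennreal (4 * (rho * K * t) + pay_bound x t
     + 2 * K * (exp (6 * q) - 4 * exp (3 * q) + 6 * exp q - 3))"
  unfolding V_def[of x]
proof (rule SUP_least, rule value_le_of_simple)
  show "0 < x" using c x by simp
  fix m u \<kappa> assume r: "simple_rule m u \<kappa>"
  have t0: "0 \<le> t" using t by simp
  have cK: "c < K" using x by simp
  define b where "b = ln (x / c) / (vol * t)"
  have cx: "c * exp (vol * b * t) = x"
    using c x vol_pos t by (simp add: b_def)
  have q: "b\<^sup>2 * t = q" using t vol_pos by (simp add: b_def q_def power2_eq_square field_simps)
  let ?\<eta> = "ennreal (rho * K * t)"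
  let ?E = "exp (6 * q) - 4 * exp (3 * q) + 6 * exp q - 3"
  let ?Z = "girsanov b t"
  obtain \<kappa>' where r': "simple_rule m u \<kappa>'"
    and shift: "(\<integral>\<^sup>+\<omega>. later x t (max t (u (\<kappa> \<omega>))) \<omega> \<partial>M)
     = (\<integral>\<^sup>+\<omega>. ennreal (?Z \<omega>) * later c t (max t (u (\<kappa>' \<omega>))) \<omega> \<partial>M)"
    using later_shift[OF r t0 c, of b] unfolding cx by blast
  let ?Q = "\<lambda>\<omega>. later c t (max t (u (\<kappa>' \<omega>))) \<omega>"
  have Z [measurable]: "?Z \<in> borel_measurable M" using t0 by simp
  have Z0: "0 \<le> ?Z \<omega>" for \<omega> by (simp add: girsanov_def)
  have Qm [measurable]: "?Q \<in> borel_measurable M" by (rule later_measurable[OF r' t0])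
  have pm [measurable]: "pay c t \<in> borel_measurable M" by (rule pay_measurable[OF t0])
  have Vn: "V (c / real (Suc n)) \<le> ennreal K" for n
  proof -
    have "V (c / real (Suc n)) \<le> ennreal (K - c / real (Suc n))"
      using c by (intro V) (auto simp: field_simps)
    also have "\<dots> \<le> ennreal K" using c by (intro ennreal_leI) auto
    finally show ?thesis .
  qed
  have Q2K: "?Q \<omega> \<le> ennreal (2 * K)" if \<omega>: "\<omega> \<in> space M" for \<omega>
  proof -
    let ?v = "max t (u (\<kappa>' \<omega>))"
    have "ennreal ?v \<le> T"
      using simple_rule_max[OF r' t(2)] \<omega> by (auto simp: simple_rule_def)
    then have "{t<..?v} \<subseteq> {t. 0 \<le> t \<and> ennreal t \<le> T}"
      using t0 by (auto intro: order_trans[OF ennreal_leI])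
    then have "run c {t<..?v} \<omega> \<le> ennreal K"
      using run_total_le[OF Vn c \<omega> c] by (rule order_trans[OF run_mono])
    moreover have "pay c ?v \<omega> \<le> ennreal K" using t0 c by (intro pay_le) auto
    ultimately have "?Q \<omega> \<le> ennreal K + ennreal K" unfolding later_def by (rule add_mono)
    then show ?thesis using K_pos by (simp flip: ennreal_plus)
  qed
  have body: "(\<integral>\<^sup>+\<omega>. ennreal (min (?Z \<omega>) 2) * ?Q \<omega> \<partial>M)
      \<le> (\<integral>\<^sup>+\<omega>. ennreal (min (?Z \<omega>) 2) * pay c t \<omega> \<partial>M) + ennreal 2 * ?\<eta>"
  proof (rule nn_integral_layer_cake)
    fix w :: real
    have [measurable]: "?Z \<in> borel_measurable (F t)" using t0 by (intro girsanov_measurable_F) auto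
    have "{\<omega> \<in> space (F t). w < ?Z \<omega>} \<in> sets (F t)" by measurable
    then show "(\<integral>\<^sup>+\<omega>. indicator {\<omega> \<in> space M. w < ?Z \<omega>} \<omega> * ?Q \<omega> \<partial>M)
       \<le> (\<integral>\<^sup>+\<omega>. indicator {\<omega> \<in> space M. w < ?Z \<omega>} \<omega> * pay c t \<omega> \<partial>M) + ?\<eta>"
      by (intro later_on_event[OF c cK V[OF c order_refl] t0 t(2) r']) simp
  qed (use Z Qm pm sigma_finite_measure_axioms Z0 in auto)
  have tail: "(\<integral>\<^sup>+\<omega>. ennreal ((?Z \<omega> - 1) ^ 4) * ?Q \<omega> \<partial>M) \<le> ennreal (2 * K * ?E)"
  proof -
    have "(\<integral>\<^sup>+\<omega>. ennreal ((?Z \<omega> - 1) ^ 4) * ?Q \<omega> \<partial>M) \<le> (\<integral>\<^sup>+\<omega>. ennreal ((?Z \<omega> - 1) ^ 4) * ennreal (2 * K) \<partial>M)"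
      by (intro nn_integral_mono mult_left_mono Q2K) auto
    also have "\<dots> = (\<integral>\<^sup>+\<omega>. ennreal ((?Z \<omega> - 1) ^ 4) \<partial>M) * ennreal (2 * K)"
      by (rule nn_integral_multc) measurable
    also have "(\<integral>\<^sup>+\<omega>. ennreal ((?Z \<omega> - 1) ^ 4) \<partial>M) = ennreal ?E"
      using expectation_girsanov_power4[OF t0, of b] unfolding q
      by (subst nn_integral_eq_integral) auto
    also have "ennreal ?E * ennreal (2 * K) = ennreal (2 * K * ?E)"
      using K_pos by (subst ennreal_mult''[symmetric]) (auto simp: mult.commute)
    finally show ?thesis .
  qed
  have "(\<integral>\<^sup>+\<omega>. later x t (max t (u (\<kappa> \<omega>))) \<omega> \<partial>M)
     \<le> (\<integral>\<^sup>+\<omega>. ennreal (min (?Z \<omega>) 2) * ?Q \<omega> + ennreal ((?Z \<omega> - 1) ^ 4) * ?Q \<omega> \<partial>M)"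
    unfolding shift distrib_right[symmetric]
  proof (intro nn_integral_mono mult_right_mono)
    fix \<omega>
    \<comment> \<open>Beyond level 2 one has \<open>?Z \<omega> - 1 \<ge> 1\<close>, so its fourth
      power dominates the excess.\<close>
    have "?Z \<omega> \<le> min (?Z \<omega>) 2 + (?Z \<omega> - 1) ^ 4"
    proof (cases "?Z \<omega> \<le> 2")
      case False
      then have "(?Z \<omega> - 1) ^ 1 \<le> (?Z \<omega> - 1) ^ 4" by (intro power_increasing) auto
      then show ?thesis using False by simp
    qed simp
    then have "ennreal (?Z \<omega>) \<le> ennreal (min (?Z \<omega>) 2 + (?Z \<omega> - 1) ^ 4)" by (rule ennreal_leI)
    then show "ennreal (?Z \<omega>) \<le> ennreal (min (?Z \<omega>) 2) + ennreal ((?Z \<omega> - 1) ^ 4)"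
      by (simp add: girsanov_def ennreal_plus)
  qed simp
  also have "\<dots> = (\<integral>\<^sup>+\<omega>. ennreal (min (?Z \<omega>) 2) * ?Q \<omega> \<partial>M) + (\<integral>\<^sup>+\<omega>. ennreal ((?Z \<omega> - 1) ^ 4) * ?Q \<omega> \<partial>M)"
    by (intro nn_integral_add) measurable
  also have "\<dots> \<le> ((\<integral>\<^sup>+\<omega>. ennreal (min (?Z \<omega>) 2) * pay c t \<omega> \<partial>M) + ennreal 2 * ?\<eta>) + ennreal (2 * K * ?E)"
    by (intro add_mono body tail)
  \<comment> \<open>On the payoff side the truncation may be undone, as this only increases the
    bound; the full weight then moves the starting point back to \<open>x\<close>.\<close>
  also have "(\<integral>\<^sup>+\<omega>. ennreal (min (?Z \<omega>) 2) * pay c t \<omega> \<partial>M) \<le> (\<integral>\<^sup>+\<omega>. ennreal (?Z \<omega>) * pay c t \<omega> \<partial>M)"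
    by (intro nn_integral_mono mult_right_mono ennreal_leI) auto
  also have "(\<integral>\<^sup>+\<omega>. ennreal (?Z \<omega>) * pay c t \<omega> \<partial>M) = (\<integral>\<^sup>+\<omega>. pay x t \<omega> \<partial>M)"
    using pay_shift[OF t0, of b c] by (simp add: cx)
  finally have later_le: "(\<integral>\<^sup>+\<omega>. later x t (max t (u (\<kappa> \<omega>))) \<omega> \<partial>M)
     \<le> (\<integral>\<^sup>+\<omega>. pay x t \<omega> \<partial>M) + ennreal 2 * ?\<eta> + ennreal (2 * K * ?E)"
    by (simp add: add_right_mono)
  have run_le: "(\<integral>\<^sup>+\<omega>. run x {0..t} \<omega> \<partial>M) \<le> ?\<eta>"
  proof -
    have "(\<integral>\<^sup>+\<omega>. run x {0..t} \<omega> \<partial>M) \<le> (\<integral>\<^sup>+\<omega>. run c {0..t} \<omega> \<partial>M)"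
      using c x by (intro nn_integral_mono run_antimono) auto
    also have "\<dots> \<le> ?\<eta>" by (rule run_initial[OF c cK V[OF c order_refl] t0 t(2)])
    finally show ?thesis .
  qed
  let ?P = "pay_bound x t"
  have P0: "0 \<le> ?P" using c x t0 by (intro pay_bound_nonneg) auto
  have E0: "0 \<le> ?E"
    using expectation_girsanov_power4(2)[OF t0, of b, symmetric] unfolding q by simp
  have "value_of x (\<lambda>\<omega>. ennreal (u (\<kappa> \<omega>)))
     \<le> ?\<eta> + ((\<integral>\<^sup>+\<omega>. pay x t \<omega> \<partial>M) + ennreal 2 * ?\<eta> + ennreal (2 * K * ?E)) + ?\<eta>"
    using value_simple_le[OF r t0, of x] c x run_le later_le
    by (meson add_mono add_right_mono order_trans less_trans)
  also have "\<dots> \<le> ?\<eta> + (ennreal ?P + ennreal 2 * ?\<eta> + ennreal (2 * K * ?E)) + ?\<eta>"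
    using c x t0 by (intro add_mono order_refl nn_integral_pay_le) auto
  also have "\<dots> = ennreal (4 * (rho * K * t) + ?P + 2 * K * ?E)"
  proof -
    have "ennreal a + (ennreal p + ennreal 2 * ennreal a + ennreal e) + ennreal a = ennreal (4 * a + p + e)"
      if "0 \<le> a" "0 \<le> p" "0 \<le> e" for a p e
    proof -
      have "4 * a + p + e = a + (p + 2 * a + e) + a" by simp
      then show ?thesis using that by (simp only: ennreal_plus ennreal_mult add_nonneg_nonneg mult_nonneg_nonneg zero_le_numeral)
    qed
    then show ?thesis using rho_pos K_pos t0 P0 E0 by simp
  qed
  finally show "value_of x (\<lambda>\<omega>. ennreal (u (\<kappa> \<omega>))) \<le> ennreal (4 * (rho * K * t) + ?P + 2 * K * ?E)" .
qed

lemma value_stop_now: "0 < x \<Longrightarrow> x < K \<Longrightarrow> ennreal (K - x) \<le> V x"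
proof -
  assume x: "0 < x" "x < K"
  have "ennreal (K - x) \<le> value_of x (\<lambda>_. ennreal 0)"
    unfolding pay_0[OF x, symmetric] value_of_def by (intro nn_integral_mono) (simp only: gain_ennreal order_refl le_add_same_cancel2, simp)
  also have "\<dots> \<le> V x" by (intro value_le_V const_stopping) simp
  finally show ?thesis .
qed

theorem smooth_fit:
  assumes c: "0 < c" "c < K"
    and boundary: "{x \<in> {0<..}. V x > ennreal (max 0 (K - x))} = {c<..}"
  shows "\<forall>x>0. V x < \<infinity>"
    and "convex_on {0<..} (\<lambda>x. enn2real (V x))"
    and "((\<lambda>x. enn2real (V x)) has_real_derivative -1) (at c)"
proof -
  have stop: "V x \<le> ennreal (K - x)" if "0 < x" "x \<le> c" for x
  proof -
    have "\<not> V x > ennreal (max 0 (K - x))" 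
    proof -
      have "x \<notin> {x \<in> {0<..}. V x > ennreal (max 0 (K - x))}"
        unfolding boundary using that by simp
      then show ?thesis using that by simp
    qed
    then show ?thesis using that c by (simp add: max_def not_less split: if_splits)
  qed
  have cont: "ennreal (max 0 (K - x)) < V x" if "c < x" for x
    using boundary that by blast
  have fin: "V x < \<infinity>" if "0 < x" for x
  proof -
    have "V x \<le> V (min x c)" using that c by (intro V_antimono) auto
    also have "\<dots> \<le> ennreal (K - min x c)" using that c by (intro stop) auto
    also have "\<dots> < \<infinity>" by simp
    finally show ?thesis .
  qed
  then show "\<forall>x>0. V x < \<infinity>" by blast
  show "convex_on {0<..} (\<lambda>x. enn2real (V x))"
  proof (rule convex_onI)
    fix u x y :: real assume u: "0 < u" "u < 1" and xy: "x \<in> {0<..}" "y \<in> {0<..}"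
    have "V ((1 - u) * x + u * y) \<le> ennreal (1 - u) * V x + ennreal u * V y"
      using u xy by (intro V_convex) auto
    also have "\<dots> = ennreal ((1 - u) * enn2real (V x) + u * enn2real (V y))"
      using u xy fin[of x] fin[of y] by (simp add: ennreal_plus ennreal_mult)
    finally show "enn2real (V ((1 - u) *\<^sub>R x + u *\<^sub>R y)) \<le> (1 - u) * enn2real (V x) + u * enn2real (V y)"
      using u by (intro enn2real_leI) auto
  qed simp
  define v where "v x = enn2real (V x)" for x
  have v_stop: "v x = K - x" if "0 < x" "x \<le> c" for x
  proof -
    have "V x = ennreal (K - x)"
      using stop[OF that] value_stop_now[of x] that c by (intro antisym) auto
    then show ?thesis using that c by (simp add: v_def)
  qed
  have v_ge: "K - x \<le> v x" if "c < x" for x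
  proof -
    have "ennreal (max 0 (K - x)) \<le> ennreal (v x)"
      using cont[OF that] fin[of x] that c unfolding v_def by simp
    then show ?thesis by (simp add: v_def)
  qed
  define B where "B h = 4 * (rho * K * (h powr (4/3))) + pay_bound (c + h) (h powr (4/3))
     + 2 * K * (exp (6 * ((ln ((c + h) / c))\<^sup>2 / (vol\<^sup>2 * h powr (4/3))))
       - 4 * exp (3 * ((ln ((c + h) / c))\<^sup>2 / (vol\<^sup>2 * h powr (4/3))))
       + 6 * exp ((ln ((c + h) / c))\<^sup>2 / (vol\<^sup>2 * h powr (4/3))) - 3)" for h
  have v_le: "v (c + h) \<le> B h" if h: "0 < h" "c + h < K" "ennreal (h powr (4/3)) \<le> T" for h
  proof -
    have VB: "V (c + h) \<le> ennreal (B h)"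
      unfolding B_def using V_upper_bound[OF c(1) _ h(2) stop, of "h powr (4/3)"] h by simp
    \<comment> \<open>Positivity of \<open>B h\<close> has to be secured separately, as
      \<open>ennreal\<close> would send a negative bound to 0. It follows from the strict inequality
      in the continuation region.\<close>
    have "0 \<le> ennreal (max 0 (K - (c + h)))" by simp
    also have "\<dots> < V (c + h)" using h by (intro cont) simp
    also note VB
    finally have "0 < B h" by simp
    then show ?thesis unfolding v_def using VB by (intro enn2real_leI) auto
  qed
  have "((\<lambda>h. (v (c + h) - v c) / h) \<longlongrightarrow> -1) (at 0)"
    unfolding filterlim_at_split
  proof
    have "\<forall>\<^sub>F h in at_left 0. (v (c + h) - v c) / h = -1"
    proof (rule eventually_at_leftI)
      show "(v (c + h) - v c) / h = -1" if "h \<in> {-c<..<0}" for h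
        using that c v_stop[of "c + h"] v_stop[of c] by simp
    qed (use c in simp)
    then show "((\<lambda>h. (v (c + h) - v c) / h) \<longlongrightarrow> -1) (at_left 0)"
      by (rule tendsto_eventually)
    have vc: "v c = K - c" using v_stop c by simp
    show "((\<lambda>h. (v (c + h) - v c) / h) \<longlongrightarrow> -1) (at_right 0)"
    proof (rule tendsto_sandwich)
      show "\<forall>\<^sub>F h in at_right 0. -1 \<le> (v (c + h) - v c) / h"
      proof (rule eventually_at_rightI)
        show "-1 \<le> (v (c + h) - v c) / h" if "h \<in> {0<..<1}" for h
          using that v_ge[of "c + h"] by (simp add: vc pos_le_divide_eq)
      qed simp
      have "\<forall>\<^sub>F h::real in at_right 0. c + h < K"
        using c by (intro eventually_at_rightI[of 0 "K - c"]) auto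
      moreover have "\<forall>\<^sub>F h in at_right 0. ennreal (h powr (4/3)) \<le> T"
      proof -
        have "((\<lambda>h::real. ennreal (h powr (4/3))) \<longlongrightarrow> ennreal 0) (at_right 0)"
          by (intro tendsto_ennrealI) real_asymp
        then have "\<forall>\<^sub>F h in at_right 0. ennreal (h powr (4/3)) < T"
          using T_pos by (intro order_tendstoD) auto
        then show ?thesis by eventually_elim simp
      qed
      moreover have "\<forall>\<^sub>F h::real in at_right 0. 0 < h" by (simp add: eventually_at_right_less)
      ultimately show "\<forall>\<^sub>F h in at_right 0. (v (c + h) - v c) / h \<le> (B h - (K - c)) / h"
        by eventually_elim (auto intro!: divide_right_mono simp: vc v_le)
      \<comment> \<open>The quotient is split by origin. The strike cancels against
        \<open>K - c\<close>, and the discounted price yields -1. Waiting cost, variance part and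
        weight tail are of order h^(4/3), so they vanish like h^(1/3) after division.\<close>
      have "((\<lambda>h. 4 * (rho * K * (h powr (4/3))) / h
          + (c - (c + h) * exp ((mu - rho) * h powr (4/3))) / h
          + ((c + h)\<^sup>2 / (K - (c + h)) * (exp ((2 * mu + vol\<^sup>2) * h powr (4/3)) - 2 * exp (mu * h powr (4/3)) + 1)) / h
          + 2 * K * ((exp (6 * ((ln ((c + h) / c))\<^sup>2 / (vol\<^sup>2 * h powr (4/3))))
       - 4 * exp (3 * ((ln ((c + h) / c))\<^sup>2 / (vol\<^sup>2 * h powr (4/3))))
       + 6 * exp ((ln ((c + h) / c))\<^sup>2 / (vol\<^sup>2 * h powr (4/3))) - 3) / h)) \<longlongrightarrow> 0 + (-1) + 0 + 2 * K * 0) (at_right 0)"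
      proof (intro tendsto_add tendsto_mult tendsto_const)
        show "((\<lambda>h. 4 * (rho * K * (h powr (4/3))) / h) \<longlongrightarrow> 0) (at_right 0)"
          using rho_pos K_pos by real_asymp
        show "((\<lambda>h. (c - (c + h) * exp ((mu - rho) * h powr (4/3))) / h) \<longlongrightarrow> -1) (at_right 0)"
          using c by real_asymp
        show "((\<lambda>h. ((c + h)\<^sup>2 / (K - (c + h)) * (exp ((2 * mu + vol\<^sup>2) * h powr (4/3)) - 2 * exp (mu * h powr (4/3)) + 1)) / h)
            \<longlongrightarrow> 0) (at_right 0)"
          using c by real_asymp
        show "((\<lambda>h. (exp (6 * ((ln ((c + h) / c))\<^sup>2 / (vol\<^sup>2 * h powr (4/3))))
       - 4 * exp (3 * ((ln ((c + h) / c))\<^sup>2 / (vol\<^sup>2 * h powr (4/3))))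
       + 6 * exp ((ln ((c + h) / c))\<^sup>2 / (vol\<^sup>2 * h powr (4/3))) - 3) / h) \<longlongrightarrow> 0) (at_right 0)"
          using c vol_pos by real_asymp
      qed
      also have "(\<lambda>h. 4 * (rho * K * (h powr (4/3))) / h
          + (c - (c + h) * exp ((mu - rho) * h powr (4/3))) / h
          + ((c + h)\<^sup>2 / (K - (c + h)) * (exp ((2 * mu + vol\<^sup>2) * h powr (4/3)) - 2 * exp (mu * h powr (4/3)) + 1)) / h
          + 2 * K * ((exp (6 * ((ln ((c + h) / c))\<^sup>2 / (vol\<^sup>2 * h powr (4/3))))
       - 4 * exp (3 * ((ln ((c + h) / c))\<^sup>2 / (vol\<^sup>2 * h powr (4/3))))
       + 6 * exp ((ln ((c + h) / c))\<^sup>2 / (vol\<^sup>2 * h powr (4/3))) - 3) / h)) = (\<lambda>h. (B h - (K - c)) / h)"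
        unfolding B_def pay_bound_def times_divide_eq_right add_divide_distrib[symmetric]
        by (intro ext arg_cong2[where f="(/)"] refl) simp
      finally show "((\<lambda>h. (B h - (K - c)) / h) \<longlongrightarrow> -1) (at_right 0)" by simp
    qed simp
  qed
  then have "(v has_real_derivative -1) (at c)" by (simp add: DERIV_def)
  then show "((\<lambda>x. enn2real (V x)) has_real_derivative -1) (at c)" by (simp add: v_def[abs_def])
qed

end

section \<open>Transfer to the operators of the problem\<close>

lemma P_op_measurable:
  fixes f :: "real \<Rightarrow> ennreal \<Rightarrow> real"
  assumes "prob_space \<nu>" and sets: "sets \<nu> = sets borel"
    and f: "(\<lambda>(x, s). f x s) \<in> borel_measurable (restrict_space borel ({0..} \<times> UNIV))"
  shows "(\<lambda>(y, t). P_op \<nu> f (max 0 y) (T - ennreal t)) \<in> borel_measurable (borel \<Otimes>\<^sub>M borel)"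
    and "0 \<le> x \<Longrightarrow> (\<lambda>z. ennreal (f (x * z) s) * indicator {0..} z) \<in> borel_measurable \<nu>"
proof -
  interpret prob_space \<nu> by fact
  have [measurable_cong]: "sets \<nu> = sets borel" by fact
  \<comment> \<open>\<open>f\<close> is measurable on nonnegative prices only; its extension by 0 is
    Borel and agrees with it wherever \<open>P_op\<close> evaluates it.\<close>
  define g where "g p = indicator ({0..} \<times> UNIV) p *\<^sub>R f (fst p) (snd p)" for p :: "real \<times> ennreal"
  have "{0..} \<times> UNIV \<in> sets (borel :: (real \<times> ennreal) measure)"
    unfolding borel_prod[symmetric] by (intro pair_measureI) auto
  then have "g \<in> borel_measurable borel"
    using f unfolding g_def by (subst (asm) borel_measurable_restrict_space_iff) (auto simp: case_prod_beta')
  then have [measurable]: "g \<in> borel_measurable (borel \<Otimes>\<^sub>M borel)" by (simp add: borel_prod)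
  have eq: "ennreal (f (x * z) s) * indicator {0..} z = ennreal (g (x * z, s)) * indicator {0..} z"
    if "0 \<le> x" for x z s
    using that by (simp add: g_def indicator_def)
  show "0 \<le> x \<Longrightarrow> (\<lambda>z. ennreal (f (x * z) s) * indicator {0..} z) \<in> borel_measurable \<nu>"
    by (simp only: eq) measurable
  show "(\<lambda>(y, t). P_op \<nu> f (max 0 y) (T - ennreal t)) \<in> borel_measurable (borel \<Otimes>\<^sub>M borel)"
    unfolding P_op_def by (simp only: eq max.cobounded1) measurable
qed

text \<open>Convexity and monotonicity are asked at every remaining horizon
  \<open>T - ennreal t\<close>, because these are the horizons at which the running reward evaluates
  \<open>f\<close>. Finiteness is part of the conclusion since \<open>enn2real\<close> sends
  infinity to 0, which would empty the other two claims of their meaning.\<close>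

theorem lemma2p9:
  fixes M :: "'w measure" and W :: "real \<Rightarrow> 'w \<Rightarrow> real"
    and r vol lam K c :: real and \<nu> :: "real measure"
    and f :: "real \<Rightarrow> ennreal \<Rightarrow> real" and T :: ennreal
  assumes "wiener_process M W"
    and "r \<ge> 0" and "vol > 0" and "lam > 0" and "K > 0"
    and "prob_space \<nu>" and "sets \<nu> = sets borel" and "AE z in \<nu>. z > 0"
    and "integrable \<nu> (\<lambda>z. z)"
    and f_measurable: "(\<lambda>(x, s). f x s) \<in> borel_measurable (restrict_space borel ({0..} \<times> UNIV))"
    and f_nonneg: "\<And>x s. x \<ge> 0 \<Longrightarrow> f x s \<ge> 0"
    and "T > 0"
    and f_convex: "\<And>t. t \<ge> 0 \<Longrightarrow> ennreal t \<le> T \<Longrightarrow> convex_on {0..} (\<lambda>x. f x (T - ennreal t))"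
    and f_mono: "\<And>t. t \<ge> 0 \<Longrightarrow> ennreal t \<le> T \<Longrightarrow> antimono_on {0..} (\<lambda>x. f x (T - ennreal t))"
    and "0 < c" and "c < K"
    and c_boundary: "{x \<in> {0<..}. J_op M W r vol lam K \<nu> f x T > ennreal (max 0 (K - x))} = {c<..}"
  shows "(\<forall>x>0. J_op M W r vol lam K \<nu> f x T < \<infinity>)
    \<and> convex_on {0<..} (\<lambda>x. enn2real (J_op M W r vol lam K \<nu> f x T))
    \<and> ((\<lambda>x. enn2real (J_op M W r vol lam K \<nu> f x T)) has_real_derivative -1) (at c)"
proof -
  interpret wiener_process M W by fact
  \<comment> \<open>The clamp makes \<open>k\<close> a function on the whole line, as joint
    measurability requires; at the positive prices that occur it changes nothing.\<close>
  define k where "k y t = ennreal (exp (- (r + lam) * t) * lam) * P_op \<nu> f (max 0 y) (T - ennreal t)" for y t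
  \<comment> \<open>The conditions on \<open>k\<close> concern all real times. Truncated subtraction
    in \<open>ennreal\<close> gives every time before 0 or beyond \<open>T\<close> the same
    remaining horizon as 0 or \<open>T\<close>, so the hypotheses on \<open>f\<close> still
    apply.\<close>
  have time: "\<exists>t'\<ge>0. ennreal t' \<le> T \<and> T - ennreal t = T - ennreal t'" for t
  proof (cases "ennreal t \<le> T")
    case True
    then show ?thesis by (intro exI[of _ "max 0 t"]) (auto simp: max_def ennreal_neg)
  next
    case False
    then have "T < \<infinity>" "ennreal t > T" by (auto simp: not_le intro: less_trans[OF _ ennreal_less_top])
    then show ?thesis by (intro exI[of _ "enn2real T"]) (auto simp: diff_eq_0_ennreal)
  qed
  have mono: "f y (T - ennreal t) \<le> f x (T - ennreal t)" if "0 \<le> x" "x \<le> y" for x y t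
    using time[of t] f_mono that by (auto simp: monotone_on_def)
  have conv: "f ((1 - u) * x + u * y) (T - ennreal t) \<le> (1 - u) * f x (T - ennreal t) + u * f y (T - ennreal t)"
    if "0 \<le> x" "0 \<le> y" "0 \<le> u" "u \<le> 1" for x y u t
    using time[of t] convex_onD[OF f_convex, of _ u x y] that by auto
  have fm: "(\<lambda>z. ennreal (f (x * z) s) * indicator {0..} z) \<in> borel_measurable \<nu>" if "0 \<le> x" for x s
    by (rule P_op_measurable(2)[OF assms(6,7) f_measurable that])
  interpret put_problem M W vol "drift r lam \<nu>" "r + lam" K k T
  proof
    have "0 \<le> mean_jump \<nu>"
      unfolding mean_jump_def using assms(8) by (intro integral_nonneg_AE) auto
    then show "drift r lam \<nu> \<le> r + lam" using \<open>lam > 0\<close> by (simp add: drift_def)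
    show "(\<lambda>(y, t). k y t) \<in> borel_measurable (borel \<Otimes>\<^sub>M borel)"
      using P_op_measurable(1)[OF assms(6,7) f_measurable, of T]
      unfolding k_def case_prod_beta' by measurable
    show "k y t \<le> k x t" if "0 < x" "x \<le> y" for x y t
      unfolding k_def P_op_def using that
      by (intro mult_left_mono nn_integral_mono)
        (auto simp: indicator_def intro!: ennreal_leI mono mult_right_mono)
    show "k ((1 - u) * x + u * y) t \<le> ennreal (1 - u) * k x t + ennreal u * k y t"
      if "0 < x" "0 < y" "0 \<le> u" "u \<le> 1" for x y u t
    proof -
      let ?s = "T - ennreal t"
      have w: "0 \<le> (1 - u) * x + u * y" using that by simp
      have "P_op \<nu> f ((1 - u) * x + u * y) ?s
         \<le> (\<integral>\<^sup>+z. ennreal (1 - u) * (ennreal (f (x * z) ?s) * indicator {0..} z)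
            + ennreal u * (ennreal (f (y * z) ?s) * indicator {0..} z) \<partial>\<nu>)"
        unfolding P_op_def
      proof (intro nn_integral_mono)
        fix z
        show "ennreal (f (((1 - u) * x + u * y) * z) ?s) * indicator {0..} z
          \<le> ennreal (1 - u) * (ennreal (f (x * z) ?s) * indicator {0..} z)
            + ennreal u * (ennreal (f (y * z) ?s) * indicator {0..} z)"
        proof (cases "0 \<le> z")
          case True
          have "((1 - u) * x + u * y) * z = (1 - u) * (x * z) + u * (y * z)" by (simp add: algebra_simps)
          then have "f (((1 - u) * x + u * y) * z) ?s \<le> (1 - u) * f (x * z) ?s + u * f (y * z) ?s"
            using that True by (simp only:) (intro conv; simp)
          then show ?thesis
            using that True f_nonneg
            by (simp add: ennreal_leI ennreal_mult[symmetric] ennreal_plus[symmetric] del: ennreal_plus)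
        qed simp
      qed
      also have "\<dots> = ennreal (1 - u) * P_op \<nu> f x ?s + ennreal u * P_op \<nu> f y ?s"
        unfolding P_op_def using fm that by (simp add: nn_integral_add nn_integral_cmult)
      finally have "ennreal (exp (- (r + lam) * t) * lam) * P_op \<nu> f ((1 - u) * x + u * y) ?s
         \<le> ennreal (exp (- (r + lam) * t) * lam) * (ennreal (1 - u) * P_op \<nu> f x ?s + ennreal u * P_op \<nu> f y ?s)"
        by (intro mult_left_mono) auto
      then show ?thesis
        using that w by (simp add: k_def max_absorb2 distrib_left ac_simps)
    qed
  qed (use \<open>r \<ge> 0\<close> \<open>vol > 0\<close> \<open>lam > 0\<close> \<open>K > 0\<close> \<open>T > 0\<close> in auto)
  have J: "J_op M W r vol lam K \<nu> f x T = V x" if x: "0 < x" for x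
  proof -
    let ?S = "\<lambda>t \<omega>. x * H_proc r vol lam \<nu> W t \<omega>"
    have S: "?S = (\<lambda>t \<omega>. x * H t \<omega>)" by (simp add: H_proc_def H_def fun_eq_iff)
    have nf: "natural_filtration M ?S s = natural_filtration M W s" for s
    proof (rule natural_filtration_cong)
      fix t :: real assume "0 \<le> t"
      let ?a = "(drift r lam \<nu> - vol\<^sup>2 / 2) * t"
      show "\<exists>\<phi>\<in>borel_measurable borel. \<forall>\<omega>\<in>space M. ?S t \<omega> = \<phi> (W t \<omega>)"
        by (intro bexI[of _ "\<lambda>w. x * exp (?a + vol * w)"]) (auto simp: H_proc_def)
      show "\<exists>\<phi>\<in>borel_measurable borel. \<forall>\<omega>\<in>space M. W t \<omega> = \<phi> (?S t \<omega>)"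
        using x \<open>vol > 0\<close>
        by (intro bexI[of _ "\<lambda>y. (ln (y / x) - ?a) / vol"]) (auto simp: H_proc_def)
    qed
    then have "natural_filtration M ?S = natural_filtration M W" by (rule ext)
    then have st: "stopping_times M ?S T = stopping_times M W T"
      unfolding stopping_times_def by (simp only:)
    have "reward M r lam K \<nu> ?S f T \<tau> = value_of x \<tau>" for \<tau>
      unfolding S reward_def value_of_def gain_def run_def stopped_payoff_def pay_def k_def
      using x by (simp add: max_absorb2 less_imp_le)
    then show ?thesis unfolding J_op_def Let_def st V_def by simp
  qed
  have boundary: "{x \<in> {0<..}. V x > ennreal (max 0 (K - x))} = {c<..}"
    using c_boundary J by (simp cong: conj_cong)
  note fit = smooth_fit[OF \<open>0 < c\<close> \<open>c < K\<close> boundary]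
  show ?thesis
  proof (intro conjI)
    show "\<forall>x>0. J_op M W r vol lam K \<nu> f x T < \<infinity>" using fit(1) J by simp
    show "convex_on {0<..} (\<lambda>x. enn2real (J_op M W r vol lam K \<nu> f x T))"
    proof (rule convex_onI)
      fix u x y :: real assume *: "0 < u" "u < 1" "x \<in> {0<..}" "y \<in> {0<..}"
      then have "0 < (1 - u) * x + u * y" by (intro add_pos_pos mult_pos_pos) auto
      then show "enn2real (J_op M W r vol lam K \<nu> f ((1 - u) *\<^sub>R x + u *\<^sub>R y) T)
        \<le> (1 - u) * enn2real (J_op M W r vol lam K \<nu> f x T) + u * enn2real (J_op M W r vol lam K \<nu> f y T)"
        using convex_onD[OF fit(2), of u x y] * J by simp
    qed simp
    show "((\<lambda>x. enn2real (J_op M W r vol lam K \<nu> f x T)) has_real_derivative -1) (at c)"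
      by (rule has_field_derivative_transform_within_open[OF fit(3), of "{0<..}"])
        (use \<open>0 < c\<close> J in auto)
  qed
qed

end
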